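(* Let $\Gamma_0\subseteq G=\mathrm{SL}(2,\mathbf{R})$ be a lattice such that $-I\in\Gamma_0$. Assume $\Lambda_0=\left\{\begin{pmatrix}1&n\\0&1\end{pmatrix}\mid n\in\mathbf{Z}\right\}$ is a maximal unipotent subgroup of $\Gamma_0$. The Eisenstein series $$E(z,s)=\frac12\sum_{\gamma\in\Gamma_0/\Lambda_0}(\mathrm{Im}\,\gamma^{-1}z)^s\qquad(z\in\mathcal{H},\ \mathrm{Re}\,s>1)$$ is convergent for $\mathrm{Re}\,s>1$. Moreover, if $U(\sigma)$, $0<\sigma<\infty$, is the set $$U(\sigma)=\left\{s\in\mathbf{C}\mid\mathrm{Re}\,s>1,\ \frac{|s-1|}{\mathrm{Re}\,s-1}<\sigma\right\},$$ then for all $\sigma$ and all $z\in\mathcal{H}$ $$\lim_{\substack{s\to1\\ s\in U(\sigma)}}(s-1)E(z,s)=|\Gamma_0\backslash\mathcal{H}|^{-1},$$ where $|\cdot|$ denotes Poincaré volume.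
   Context: $\mathcal{H}=\{z\in\mathbf{C}\mid\mathrm{Im}\,z>0\}$, on which $G$ acts by fractional linear transformations; Poincaré volume is given by $\frac i2\frac{dz\wedge d\bar z}{(\mathrm{Im}\,z)^2}=\frac{dx\,dy}{y^2}$. The summand depends only on the coset $\gamma\Lambda_0$. *)

theory Defs
  imports "HOL-Analysis.Analysis" "HOL-Algebra.Left_Coset"
begin

type_synonym mat2 = "real^2^2"

definition mat2 :: "real \<Rightarrow> real \<Rightarrow> real \<Rightarrow> real \<Rightarrow> mat2" where
  "mat2 a b c d = vector [vector [a, b], vector [c, d]]"

definition SL2R :: "mat2 monoid" where
  "SL2R = \<lparr>carrier = {A. det A = 1}, mult = (**), one = mat 1\<rparr>"

lemma group_SL2R: "group SL2R"
proof (rule groupI)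
  fix A assume A: "A \<in> carrier SL2R"
  let ?B = "mat2 (A$2$2) (- A$1$2) (- A$2$1) (A$1$1)"
  have "?B ** A = mat 1"
    using A by (simp add: SL2R_def mat2_def det_2 vec_eq_iff forall_2 matrix_matrix_mult_def
        sum_2 mat_def algebra_simps)
  moreover have "det ?B = 1"
    using A by (simp add: SL2R_def mat2_def det_2 algebra_simps)
  ultimately show "\<exists>B\<in>carrier SL2R. B \<otimes>\<^bsub>SL2R\<^esub> A = \<one>\<^bsub>SL2R\<^esub>"
    by (auto simp: SL2R_def)
qed (auto simp: SL2R_def det_mul matrix_mul_assoc)


subsection \<open>Lattices\<close>

text \<open>
  The topology of \<open>SL(2,\<real>)\<close> is the subspace topology of the space of \<open>2\<times>2\<close> matrices. Left cosets
  of \<open>\<Gamma>\<close> are subsets of the group, so the preimage of a set \<open>B\<close> of cosets under the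
  projection \<open>SL(2,\<real>) \<rightarrow> SL(2,\<real>)/\<Gamma>\<close> is \<open>\<Union>B\<close>; hence the following is the Borel \<open>\<sigma>\<close>-algebra of
  the quotient topology.
\<close>

definition borel_quotient :: "mat2 set \<Rightarrow> mat2 set measure" where
  "borel_quotient \<Gamma> = sigma (lcosets\<^bsub>SL2R\<^esub> \<Gamma>)
     {B. B \<subseteq> lcosets\<^bsub>SL2R\<^esub> \<Gamma> \<and> openin (top_of_set (carrier SL2R)) (\<Union>B)}"

definition is_lattice :: "mat2 set \<Rightarrow> bool" where
  "is_lattice \<Gamma> \<longleftrightarrow> subgroup \<Gamma> SL2R \<and> discrete \<Gamma> \<and>
     (\<exists>M. sets M = sets (borel_quotient \<Gamma>) \<and> finite_measure M \<and> emeasure M (space M) \<noteq> 0 \<and>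
          (\<forall>g\<in>carrier SL2R. \<forall>B\<in>sets M. emeasure M ((\<lambda>C. g <#\<^bsub>SL2R\<^esub> C) ` B) = emeasure M B))"


subsection \<open>Unipotent subgroups\<close>

text \<open>\<open>A\<close> is unipotent iff \<open>(A - I)\<^sup>k = 0\<close> for some \<open>k\<close>.\<close>

definition unipotent :: "mat2 \<Rightarrow> bool" where
  "unipotent A \<longleftrightarrow> (\<exists>k. (((**) (A - mat 1)) ^^ k) (mat 1) = 0)"

definition unipotent_subgroup :: "mat2 set \<Rightarrow> mat2 set \<Rightarrow> bool" where
  "unipotent_subgroup U \<Gamma> \<longleftrightarrow> subgroup U SL2R \<and> U \<subseteq> \<Gamma> \<and> (\<forall>A\<in>U. unipotent A)"

definition maximal_unipotent_subgroup :: "mat2 set \<Rightarrow> mat2 set \<Rightarrow> bool" where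
  "maximal_unipotent_subgroup U \<Gamma> \<longleftrightarrow>
     unipotent_subgroup U \<Gamma> \<and> (\<forall>V. unipotent_subgroup V \<Gamma> \<longrightarrow> U \<subseteq> V \<longrightarrow> V = U)"

definition \<Lambda>\<^sub>0 :: "mat2 set" where
  "\<Lambda>\<^sub>0 = {mat2 1 (of_int n) 0 1 | n::int. True}"


subsection \<open>The upper half-plane and Poincare volume\<close>

definition upper_half_plane :: "complex set" (\<open>\<H>\<close>) where
  "\<H> = {z. Im z > 0}"

definition act :: "mat2 \<Rightarrow> complex \<Rightarrow> complex" where
  "act A = moebius (of_real (A$1$1)) (of_real (A$1$2)) (of_real (A$2$1)) (of_real (A$2$2))"

definition poincare_measure :: "complex measure" where
  "poincare_measure = density lborel (\<lambda>z. ennreal (indicator \<H> z / (Im z)\<^sup>2))"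

definition fundamental_set :: "mat2 set \<Rightarrow> complex set \<Rightarrow> bool" where
  "fundamental_set \<Gamma> F \<longleftrightarrow>
     F \<in> sets borel \<and> F \<subseteq> \<H> \<and> (\<forall>z\<in>\<H>. \<exists>!w. w \<in> F \<and> (\<exists>\<gamma>\<in>\<Gamma>. w = act \<gamma> z))"

text \<open>
  The volume of the quotient of \<open>\<H>\<close> by \<open>\<Gamma>\<close>: a fundamental set maps bijectively onto the quotient. For discrete \<open>\<Gamma>\<close>
  fundamental sets exist, and they all have the same volume because \<open>\<Gamma>\<close> is countable and preserves
  the Poincare measure.
\<close>

definition quotient_volume :: "mat2 set \<Rightarrow> real" where
  "quotient_volume \<Gamma> = measure poincare_measure (SOME F. fundamental_set \<Gamma> F)"


subsection \<open>The Eisenstein series\<close>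

text \<open>
  The summand at a coset \<open>C = \<gamma>\<Lambda>\<^sub>0\<close> is \<open>(Im \<gamma>\<^sup>-\<^sup>1z)\<^sup>s\<close>, which does not depend on the
  representative \<open>\<gamma>\<close> (see \<open>Im_act_coset\<close> below).
\<close>

definition eisenstein_term :: "complex \<Rightarrow> complex \<Rightarrow> mat2 set \<Rightarrow> complex" where
  "eisenstein_term z s C = of_real (Im (act (inv\<^bsub>SL2R\<^esub> (SOME \<gamma>. \<gamma> \<in> C)) z)) powr s"

definition eisenstein :: "mat2 set \<Rightarrow> complex \<Rightarrow> complex \<Rightarrow> complex" where
  "eisenstein \<Gamma> z s =
     1/2 * (\<Sum>\<^sub>\<infinity>C\<in>lcosets\<^bsub>SL2R\<lparr>carrier := \<Gamma>\<rparr>\<^esub> \<Lambda>\<^sub>0. eisenstein_term z s C)"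

lemma inv_SL2R:
  assumes "A \<in> carrier SL2R"
  shows "inv\<^bsub>SL2R\<^esub> A = mat2 (A$2$2) (- A$1$2) (- A$2$1) (A$1$1)"
proof (rule group.inv_equality[OF group_SL2R])
  show "mat2 (A$2$2) (- A$1$2) (- A$2$1) (A$1$1) \<otimes>\<^bsub>SL2R\<^esub> A = \<one>\<^bsub>SL2R\<^esub>"
    using assms by (simp add: SL2R_def mat2_def det_2 vec_eq_iff forall_2 matrix_matrix_mult_def
        sum_2 mat_def algebra_simps)
  show "mat2 (A$2$2) (- A$1$2) (- A$2$1) (A$1$1) \<in> carrier SL2R"
    using assms by (simp add: SL2R_def mat2_def det_2 algebra_simps)
qed (use assms in auto)

lemma Im_act_coset:
  assumes "\<gamma> \<in> carrier SL2R" "\<gamma>' \<in> \<gamma> <#\<^bsub>SL2R\<^esub> \<Lambda>\<^sub>0" "z \<in> \<H>"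
  shows "Im (act (inv\<^bsub>SL2R\<^esub> \<gamma>') z) = Im (act (inv\<^bsub>SL2R\<^esub> \<gamma>) z)"
proof -
  obtain n :: int where \<gamma>': "\<gamma>' = \<gamma> ** mat2 1 (of_int n) 0 1"
    using assms(2) by (auto simp: l_coset_def SL2R_def \<Lambda>\<^sub>0_def)
  have c': "\<gamma>' \<in> carrier SL2R"
    using assms(1) by (simp add: \<gamma>' SL2R_def det_mul) (simp add: mat2_def det_2)
  define D where "D = - of_real (\<gamma>$2$1) * z + of_real (\<gamma>$1$1)"
  have "D \<noteq> 0"
  proof
    assume "D = 0"
    then have "\<gamma>$2$1 = 0 \<and> \<gamma>$1$1 = 0"
      using assms(3) by (auto simp: D_def upper_half_plane_def complex_eq_iff)
    then show False using assms(1) by (simp add: SL2R_def det_2)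
  qed
  have "act (inv\<^bsub>SL2R\<^esub> \<gamma>') z = act (inv\<^bsub>SL2R\<^esub> \<gamma>) z - of_int n"
    using \<open>D \<noteq> 0\<close> unfolding inv_SL2R[OF c'] inv_SL2R[OF assms(1)]
    by (simp add: act_def moebius_def mat2_def \<gamma>' matrix_matrix_mult_def sum_2 D_def
        field_simps)
  then show ?thesis by simp
qed

definition U :: "real \<Rightarrow> complex set" where
  "U \<sigma> = {s. Re s > 1 \<and> cmod (s - 1) / (Re s - 1) < \<sigma>}"

end

theory Submission
  imports Defs "HOL-Complex_Analysis.Great_Picard"
begin

text \<open>
  Integration over hyperbolic balls of a fixed radius commutes with the group, and the powers \<open>y\<^sup>s\<close> and
  \<open>y\<^sup>1\<^sup>-\<^sup>s\<close> of the height are eigenfunctions of it with the same eigenvalue \<open>\<lambda>(s)\<close>, which at \<open>s = 1\<close> is the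
  eigenvalue of the constants and grows linearly in \<open>s - 1\<close> (\<open>lam_symmetric\<close>, \<open>lamr_lower\<close>). Their minimum \<open>g\<^sub>s\<close> is
  therefore an eigenfunction except for a defect near height 1. Summing \<open>g\<^sub>s\<close> over the cosets gives a function
  \<open>\<Theta>\<^sub>s\<close> on the quotient which differs from twice the Eisenstein series, at each point, by finitely many terms that stay bounded as
  \<open>s \<rightarrow> 1\<close>, and which solves the eigenvalue equation up to an error that is bounded uniformly in \<open>s\<close>.

  The function \<open>u\<^sub>s = (s - 1) \<Theta>\<^sub>s / 2\<close> has three properties. Unfolding computes its integral over the
  quotient, \<open>1 + (s - 1) / s\<close> (\<open>intF_scaled\<close>). A geometric series with ratio \<open>\<lambda>(1) / \<lambda>(s)\<close> bounds its mean square independently of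
  \<open>s\<close> (\<open>intF_scaled_square\<close>). Finally, for every fixed radius the mean square of \<open>u\<^sub>s(z) - u\<^sub>s(w)\<close> over pairs of points within that distance is
  the quadratic form of the identity minus the normalized averaging operator, hence
  \<open>O(s - 1)\<close> (\<open>oscillation_bound\<close>). So \<open>u\<^sub>s\<close> becomes constant on every bounded part of the
  quotient, the bound on the mean square keeps its mass from escaping into the cusps, and the total mass tends to 1:
  the constant must be the inverse of the volume (\<open>ball_mean_tendsto\<close>). The approximate eigenvalue equation
  turns the limit of the averages over balls into a limit at every point.

  This gives the limit for real \<open>s\<close>. The series is dominated by its values at real arguments, so
  multiplied by \<open>s - 1\<close> it is a bounded holomorphic function in each sector \<open>U(\<sigma>)\<close> near 1, and Montel's theorem,
  applied to rescalings about the point 1, extends the limit from the real axis to the sector (\<open>sector_limit\<close>).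
\<close>

section \<open>The action of SL(2,R) on the upper half-plane\<close>

lemma mat2_nth [simp]:
  "mat2 a b c d $ 1 $ 1 = a" "mat2 a b c d $ 1 $ 2 = b"
  "mat2 a b c d $ 2 $ 1 = c" "mat2 a b c d $ 2 $ 2 = d"
  by (simp_all add: mat2_def)

lemma mat2_eqI:
  assumes "A $ 1 $ 1 = B $ 1 $ 1" "A $ 1 $ 2 = B $ 1 $ 2" "A $ 2 $ 1 = B $ 2 $ 1" "A $ 2 $ 2 = B $ 2 $ 2"
  shows "A = (B :: mat2)"
  using assms by (simp add: vec_eq_iff forall_2)

lemma mult_nth:
  fixes A B :: mat2
  shows "(A ** B) $ i $ j = A $ i $ 1 * B $ 1 $ j + A $ i $ 2 * B $ 2 $ j"
  by (simp add: matrix_matrix_mult_def sum_2)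

lemma mat_1_nth [simp]:
  "(mat 1 :: mat2) $ 1 $ 1 = 1" "(mat 1 :: mat2) $ 1 $ 2 = 0"
  "(mat 1 :: mat2) $ 2 $ 1 = 0" "(mat 1 :: mat2) $ 2 $ 2 = 1"
  by (simp_all add: mat_def)

abbreviation SL2 :: "mat2 set" where "SL2 \<equiv> carrier SL2R"

lemma SL2_iff: "A \<in> SL2 \<longleftrightarrow> A $ 1 $ 1 * A $ 2 $ 2 - A $ 1 $ 2 * A $ 2 $ 1 = 1"
  by (simp add: SL2R_def det_2)

lemma SL2_mult: "A \<in> SL2 \<Longrightarrow> B \<in> SL2 \<Longrightarrow> A ** B \<in> SL2"
  by (simp add: SL2R_def det_mul)

definition adj :: "mat2 \<Rightarrow> mat2" where
  "adj A = mat2 (A$2$2) (- A$1$2) (- A$2$1) (A$1$1)"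

lemma adj_nth [simp]:
  "adj A $ 1 $ 1 = A $ 2 $ 2" "adj A $ 1 $ 2 = - A $ 1 $ 2"
  "adj A $ 2 $ 1 = - A $ 2 $ 1" "adj A $ 2 $ 2 = A $ 1 $ 1"
  by (simp_all add: adj_def)

lemma adj_adj [simp]: "adj (adj A) = A"
  by (rule mat2_eqI) auto

lemma adj_SL2: "A \<in> SL2 \<Longrightarrow> adj A \<in> SL2"
  by (simp add: SL2_iff algebra_simps)

lemma adj_mult: "adj (A ** B) = adj B ** adj A"
  by (rule mat2_eqI) (simp_all add: mult_nth algebra_simps)

lemma mult_adj: "A \<in> SL2 \<Longrightarrow> A ** adj A = mat 1" "A \<in> SL2 \<Longrightarrow> adj A ** A = mat 1"
  by (auto intro!: mat2_eqI simp: mult_nth SL2_iff algebra_simps)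

lemma adj_uminus: "adj (- A) = - adj A"
  by (rule mat2_eqI) auto

definition den :: "mat2 \<Rightarrow> complex \<Rightarrow> complex" where
  "den A z = of_real (A $ 2 $ 1) * z + of_real (A $ 2 $ 2)"

lemma act_altdef: "act A z = (of_real (A $ 1 $ 1) * z + of_real (A $ 1 $ 2)) / den A z"
  by (simp add: act_def moebius_def den_def)

lemma upper_iff: "z \<in> \<H> \<longleftrightarrow> Im z > 0"
  by (simp add: upper_half_plane_def)

lemma den_nonzero:
  assumes "A \<in> SL2" "z \<in> \<H>"
  shows "den A z \<noteq> 0"
proof
  assume "den A z = 0"
  hence "A $ 2 $ 1 = 0 \<and> A $ 2 $ 2 = 0"
    using assms(2) by (auto simp: den_def upper_iff complex_eq_iff)
  thus False using assms(1) by (simp add: SL2_iff)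
qed

lemma act_diff:
  assumes "A \<in> SL2" "z \<in> \<H>" "w \<in> \<H>"
  shows "act A z - act A w = (z - w) / (den A z * den A w)"
proof -
  define a b c d where "a = complex_of_real (A$1$1)" "b = complex_of_real (A$1$2)"
    "c = complex_of_real (A$2$1)" "d = complex_of_real (A$2$2)"
  have det: "a * d - b * c = 1"
    using assms(1) unfolding a_b_c_d_def SL2_iff
    by (metis of_real_1 of_real_diff of_real_mult)
  have nz: "c * z + d \<noteq> 0" "c * w + d \<noteq> 0"
    using den_nonzero[OF assms(1,2)] den_nonzero[OF assms(1,3)] by (auto simp: den_def a_b_c_d_def)
  have "(a * z + b) * (c * w + d) - (a * w + b) * (c * z + d) = (a * d - b * c) * (z - w)"
    by (simp add: algebra_simps)
  thus ?thesis
    using nz by (simp add: act_altdef den_def flip: a_b_c_d_def) (simp add: det divide_simps)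
qed

lemma Im_act:
  assumes "A \<in> SL2" "z \<in> \<H>"
  shows "Im (act A z) = Im z / (cmod (den A z))\<^sup>2"
proof -
  define a b c d where "a = A$1$1" "b = A$1$2" "c = A$2$1" "d = A$2$2"
  have det: "a * d - b * c = 1" using assms(1) by (simp add: a_b_c_d_def SL2_iff)
  have "Im ((of_real a * z + of_real b) * cnj (of_real c * z + of_real d)) = (a * d - b * c) * Im z"
    by (simp add: algebra_simps)
  thus ?thesis
    unfolding act_altdef complex_div_cnj[of _ "den A z"] Im_divide_of_real
    by (simp add: den_def det flip: a_b_c_d_def of_real_power)
qed

lemma act_upper: "A \<in> SL2 \<Longrightarrow> z \<in> \<H> \<Longrightarrow> act A z \<in> \<H>"
  using Im_act den_nonzero by (simp add: upper_iff)

lemma den_mult: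
  assumes "A \<in> SL2" "B \<in> SL2" "z \<in> \<H>"
  shows "den (A ** B) z = den A (act B z) * den B z"
  using den_nonzero[OF assms(2,3)] unfolding act_altdef
  by (simp add: den_def[of A] field_simps) (simp add: den_def mult_nth algebra_simps)

lemma act_mult:
  assumes "A \<in> SL2" "B \<in> SL2" "z \<in> \<H>"
  shows "act (A ** B) z = act A (act B z)"
proof -
  define w where "w = act B z"
  have wB: "w * den B z = of_real (B $ 1 $ 1) * z + of_real (B $ 1 $ 2)"
    using den_nonzero[OF assms(2,3)] by (simp add: w_def act_altdef)
  have "of_real ((A ** B) $ 1 $ 1) * z + of_real ((A ** B) $ 1 $ 2)
      = of_real (A $ 1 $ 1) * (of_real (B $ 1 $ 1) * z + of_real (B $ 1 $ 2)) + of_real (A $ 1 $ 2) * den B z"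
    by (simp add: mult_nth den_def algebra_simps)
  also have "\<dots> = (of_real (A $ 1 $ 1) * w + of_real (A $ 1 $ 2)) * den B z"
    unfolding wB[symmetric] by (simp add: algebra_simps)
  finally show ?thesis
    unfolding act_altdef[of "A ** B"] den_mult[OF assms]
    using den_nonzero[OF assms(2,3)] by (simp add: act_altdef[of A] flip: w_def)
qed

lemma act_1 [simp]: "act (mat 1) z = z"
  by (simp add: act_altdef den_def)

lemma act_adj_cancel:
  assumes "A \<in> SL2" "z \<in> \<H>"
  shows "act A (act (adj A) z) = z" "act (adj A) (act A z) = z"
  using assms by (simp_all add: adj_SL2 mult_adj flip: act_mult)

lemma act_uminus: "act (- A) z = act A z"
proof -
  have "act (- A) z = (- (of_real (A $ 1 $ 1) * z + of_real (A $ 1 $ 2))) / (- den A z)"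
    by (simp add: act_altdef den_def)
  thus ?thesis by (simp add: act_altdef del: minus_add_distrib)
qed

lemma measurable_act [measurable]: "act A \<in> borel_measurable borel"
  unfolding act_altdef den_def by measurable

lemma upper_measurable [measurable]: "\<H> \<in> sets borel"
proof -
  have "\<H> = {z. 0 < Im z}" by (auto simp: upper_iff)
  thus ?thesis using open_halfspace_Im_gt[of 0] by (simp add: borel_open)
qed

text \<open>
  The hyperbolic distance \<open>d\<close> satisfies \<open>cosh d = 1 + \<bar>z - w\<bar>\<^sup>2 / (2 Im z Im w)\<close>, so in the upper half-plane this is
  the closed ball of radius \<open>arcosh (1 + R / 2)\<close>.
\<close>

definition near :: "real \<Rightarrow> complex \<Rightarrow> complex \<Rightarrow> bool" where
  "near R z w \<longleftrightarrow> (cmod (z - w))\<^sup>2 \<le> R * Im z * Im w"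

lemma near_act:
  assumes "A \<in> SL2" "z \<in> \<H>" "w \<in> \<H>"
  shows "near R (act A z) (act A w) \<longleftrightarrow> near R z w"
proof -
  define N where "N = (cmod (den A z))\<^sup>2 * (cmod (den A w))\<^sup>2"
  have "N > 0" using den_nonzero assms by (simp add: N_def)
  have "near R (act A z) (act A w) \<longleftrightarrow> (cmod (z - w))\<^sup>2 / N \<le> (R * Im z * Im w) / N"
    by (simp add: near_def act_diff[OF assms] Im_act assms norm_divide norm_mult power_divide N_def
        power_mult_distrib mult_ac)
  also have "\<dots> \<longleftrightarrow> near R z w"
    using \<open>N > 0\<close> by (simp add: near_def divide_le_cancel)
  finally show ?thesis .
qed

lemma near_sym: "near R z w \<longleftrightarrow> near R w z"
  by (simp add: near_def norm_minus_commute mult_ac)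

lemma near_Im:
  assumes "near R z w" "z \<in> \<H>" "w \<in> \<H>" "R \<ge> 0"
  shows "Im w \<le> (R + 2) * Im z"
proof -
  have "(Im w)\<^sup>2 - 2 * Im w * Im z \<le> (Im z - Im w)\<^sup>2"
    by (simp add: power2_eq_square algebra_simps)
  also have "\<dots> \<le> (cmod (z - w))\<^sup>2"
    by (simp add: cmod_power2)
  also have "\<dots> \<le> R * Im z * Im w" using assms(1) by (simp add: near_def)
  finally have "Im w * Im w \<le> ((R + 2) * Im z) * Im w"
    by (simp add: power2_eq_square algebra_simps)
  thus ?thesis using assms(3) by (simp add: upper_iff)
qed

section \<open>The Poincare measure\<close>

lemma measurable_Complex [measurable (raw)]:
  assumes [measurable]: "f \<in> borel_measurable M" "g \<in> borel_measurable M"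
  shows "(\<lambda>x. Complex (f x) (g x)) \<in> borel_measurable M"
  unfolding Complex_eq by measurable

lemma lborel_complex: "(lborel :: complex measure) = distr (lborel \<Otimes>\<^sub>M lborel) borel (\<lambda>(x, y). Complex x y)"
proof (rule lborel_eqI)
  have [measurable]: "(\<lambda>(x, y). Complex x y) \<in> borel_measurable (lborel \<Otimes>\<^sub>M lborel)"
    by measurable
  fix l u :: complex
  assume le: "\<And>b. b \<in> Basis \<Longrightarrow> l \<bullet> b \<le> u \<bullet> b"
  from le[of 1] le[of \<i>] have le': "Re l \<le> Re u" "Im l \<le> Im u"
    by (auto simp: Basis_complex_def)
  have "(\<lambda>(x, y). Complex x y) -` box l u \<inter> space (lborel \<Otimes>\<^sub>M lborel) = {Re l<..<Re u} \<times> {Im l<..<Im u}"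
    by (auto simp: box_def Basis_complex_def space_pair_measure)
  thus "emeasure (distr (lborel \<Otimes>\<^sub>M lborel) borel (\<lambda>(x, y). Complex x y)) (box l u) = (\<Prod>b\<in>Basis. (u - l) \<bullet> b)"
    using le' by (subst emeasure_distr)
      (auto simp: lborel.emeasure_pair_measure_Times Basis_complex_def ennreal_mult)
qed auto

abbreviation poincare_symbol (\<open>\<mu>\<close>) where "\<mu> \<equiv> poincare_measure"

lemma sets_poincare [measurable_cong, simp]: "sets \<mu> = sets borel"
  by (simp add: poincare_measure_def)

lemma space_poincare [simp]: "space \<mu> = UNIV"
  by (simp add: poincare_measure_def)

lemma AE_upper: "AE z in \<mu>. z \<in> \<H>"
  unfolding poincare_measure_def
  by (subst AE_density) (auto simp: indicator_def)

lemma sigma_finite_poincare: "sigma_finite_measure \<mu>"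
  unfolding poincare_measure_def
  by (subst sigma_finite_measure.sigma_finite_iff_density_finite[OF sigma_finite_lborel]) auto

interpretation poincare: sigma_finite_measure \<mu>
  by (rule sigma_finite_poincare)

interpretation poincare2: pair_sigma_finite \<mu> \<mu> ..

lemma nn_integral_poincare_cong:
  assumes "\<And>z. z \<in> \<H> \<Longrightarrow> f z = g z"
  shows "(\<integral>\<^sup>+z. f z \<partial>\<mu>) = (\<integral>\<^sup>+z. g z \<partial>\<mu>)"
  using AE_upper by (intro nn_integral_cong_AE) (auto elim!: eventually_mono intro: assms)

lemma nn_integral_poincare_mono:
  assumes "\<And>z. z \<in> \<H> \<Longrightarrow> f z \<le> g z"
  shows "(\<integral>\<^sup>+z. f z \<partial>\<mu>) \<le> (\<integral>\<^sup>+z. g z \<partial>\<mu>)"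
  using AE_upper by (intro nn_integral_mono_AE) (auto elim!: eventually_mono intro: assms)

text \<open>
  The substitution rule for compact intervals, applied to \<open>[-n, n]\<close>, and monotone convergence.
\<close>

lemma nn_integral_substitute_exp:
  assumes [measurable]: "g \<in> borel_measurable borel"
  shows "(\<integral>\<^sup>+y. indicator {0<..} y * (ennreal (1 / y) * g y) \<partial>lborel) = (\<integral>\<^sup>+v. g (exp v) \<partial>lborel)"
proof -
  let ?f = "\<lambda>y. ennreal (1 / y) * g y"
  have sup: "(SUP n. F x * indicator (A n) x) = F x * indicator (\<Union>n. A n) x" if "incseq A"
    for F :: "real \<Rightarrow> ennreal" and A :: "nat \<Rightarrow> real set" and x
  proof (cases "x \<in> (\<Union>n. A n)")
    case True
    then obtain k where "x \<in> A k" by auto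
    hence "(SUP n. F x * indicator (A n) x) \<ge> F x"
      by (intro SUP_upper2[of k]) auto
    moreover have "(SUP n. F x * indicator (A n) x) \<le> F x"
      by (intro SUP_least) (auto simp: indicator_def)
    ultimately show ?thesis using True by simp
  qed auto
  have inc1: "incseq (\<lambda>n. {exp (- real (Suc n))..exp (real (Suc n))})"
    by (auto simp: incseq_def intro: order_trans[rotated] order_trans)
  have inc2: "incseq (\<lambda>n. {- real (Suc n)..real (Suc n)})"
    by (auto simp: incseq_def)
  have U1: "(\<Union>n. {exp (- real (Suc n))..exp (real (Suc n))}) = {0<..}"
  proof (intro equalityI subsetI)
    fix y :: real assume "y \<in> {0<..}"
    obtain n where "\<bar>ln y\<bar> \<le> real n" using real_arch_simple by blast
    hence "- real (Suc n) \<le> ln y" "ln y \<le> real (Suc n)" by auto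
    hence "y \<in> {exp (- real (Suc n))..exp (real (Suc n))}"
      using \<open>y \<in> _\<close> by (metis atLeastAtMost_iff exp_le_cancel_iff exp_ln greaterThan_iff)
    thus "y \<in> (\<Union>n. {exp (- real (Suc n))..exp (real (Suc n))})" by blast
  next
    fix y :: real assume "y \<in> (\<Union>n. {exp (- real (Suc n))..exp (real (Suc n))})"
    then obtain n where "exp (- real (Suc n)) \<le> y" by auto
    thus "y \<in> {0<..}" by (simp add: less_le_trans[OF exp_gt_zero])
  qed
  have U2: "(\<Union>n. {- real (Suc n)..real (Suc n)}) = UNIV"
  proof (intro equalityI subsetI)
    fix y :: real
    obtain n where "\<bar>y\<bar> \<le> real n" using real_arch_simple by blast
    hence "y \<in> {- real (Suc n)..real (Suc n)}" by auto
    thus "y \<in> (\<Union>n. {- real (Suc n)..real (Suc n)})" by blast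
  qed auto
  have "(\<integral>\<^sup>+y. indicator {0<..} y * ?f y \<partial>lborel)
      = (\<integral>\<^sup>+y. (SUP n. ?f y * indicator {exp (- real (Suc n))..exp (real (Suc n))} y) \<partial>lborel)"
    by (intro nn_integral_cong) (subst sup[OF inc1], subst U1, rule mult.commute)
  also have "\<dots> = (SUP n. \<integral>\<^sup>+y. ?f y * indicator {exp (- real (Suc n))..exp (real (Suc n))} y \<partial>lborel)"
    using inc1 by (intro nn_integral_monotone_convergence_SUP)
      (auto simp: incseq_def le_fun_def indicator_def subset_iff)
  also have "(\<lambda>n. \<integral>\<^sup>+y. ?f y * indicator {exp (- real (Suc n))..exp (real (Suc n))} y \<partial>lborel)
      = (\<lambda>n. \<integral>\<^sup>+v. g (exp v) * indicator {- real (Suc n)..real (Suc n)} v \<partial>lborel)"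
  proof
    fix n
    have "(\<integral>\<^sup>+y. ?f y * indicator {exp (- real (Suc n))..exp (real (Suc n))} y \<partial>lborel)
        = (\<integral>\<^sup>+v. ?f (exp v) * ennreal (exp v) * indicator {- real (Suc n)..real (Suc n)} v \<partial>lborel)"
      by (intro nn_integral_substitution_aux) (auto intro!: DERIV_exp continuous_intros)
    also have "\<dots> = (\<integral>\<^sup>+v. g (exp v) * indicator {- real (Suc n)..real (Suc n)} v \<partial>lborel)"
    proof (intro nn_integral_cong)
      fix v :: real
      have "ennreal (1 / exp v) * ennreal (exp v) = 1" by (simp flip: ennreal_mult)
      hence "?f (exp v) * ennreal (exp v) = g (exp v)"
        by (metis mult.assoc mult.commute mult.right_neutral)
      thus "?f (exp v) * ennreal (exp v) * indicator {- real (Suc n)..real (Suc n)} v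
          = g (exp v) * indicator {- real (Suc n)..real (Suc n)} v" by simp
    qed
    finally show "(\<integral>\<^sup>+y. ?f y * indicator {exp (- real (Suc n))..exp (real (Suc n))} y \<partial>lborel)
        = (\<integral>\<^sup>+v. g (exp v) * indicator {- real (Suc n)..real (Suc n)} v \<partial>lborel)" .
  qed
  also have "(SUP n. \<integral>\<^sup>+v. g (exp v) * indicator {- real (Suc n)..real (Suc n)} v \<partial>lborel)
      = (\<integral>\<^sup>+v. (SUP n. g (exp v) * indicator {- real (Suc n)..real (Suc n)} v) \<partial>lborel)"
    using inc2 by (intro nn_integral_monotone_convergence_SUP[symmetric])
      (auto simp: incseq_def le_fun_def indicator_def subset_iff)
  also have "\<dots> = (\<integral>\<^sup>+v. g (exp v) \<partial>lborel)"
    by (intro nn_integral_cong) (subst sup[OF inc2], subst U2, simp)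
  finally show ?thesis .
qed

text \<open>
  In the coordinates \<open>t = x / y\<close> and \<open>v = ln y\<close> the Poincare measure is Lebesgue measure.
  Translations, dilations and the inversion \<open>z \<mapsto> -1/z\<close> each become a translation or reflection
  in one of the two coordinates while the other is held fixed.
\<close>

definition hpoint :: "real \<Rightarrow> real \<Rightarrow> complex" where
  "hpoint t v = Complex (t * exp v) (exp v)"

lemma measurable_hpoint [measurable (raw)]:
  assumes [measurable]: "f \<in> borel_measurable M" "g \<in> borel_measurable M"
  shows "(\<lambda>x. hpoint (f x) (g x)) \<in> borel_measurable M"
  unfolding hpoint_def complex_eq by measurable

lemma nn_integral_xy:
  assumes [measurable]: "f \<in> borel_measurable borel"
  shows "(\<integral>\<^sup>+z. f z \<partial>lborel) = (\<integral>\<^sup>+y. \<integral>\<^sup>+x. f (Complex x y) \<partial>lborel \<partial>lborel)"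
proof -
  have [measurable]: "(\<lambda>(x, y). Complex x y) \<in> borel_measurable (lborel \<Otimes>\<^sub>M lborel)"
    by measurable
  have [measurable]: "(\<lambda>(x, y). f (Complex x y)) \<in> borel_measurable (lborel \<Otimes>\<^sub>M lborel)"
    by measurable
  have "(\<integral>\<^sup>+z. f z \<partial>lborel) = (\<integral>\<^sup>+p. (\<lambda>(x, y). f (Complex x y)) p \<partial>(lborel \<Otimes>\<^sub>M lborel))"
    unfolding lborel_complex by (subst nn_integral_distr) (auto simp: case_prod_unfold)
  thus ?thesis
    by (subst (asm) lborel_pair.nn_integral_snd[symmetric]) auto
qed

lemma nn_integral_poincare:
  assumes [measurable]: "f \<in> borel_measurable borel"
  shows "(\<integral>\<^sup>+z. f z \<partial>\<mu>) = (\<integral>\<^sup>+v. \<integral>\<^sup>+t. f (hpoint t v) \<partial>lborel \<partial>lborel)"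
proof -
  have [measurable]: "(\<lambda>(y, t). f (Complex (t * y) y)) \<in> borel_measurable (borel \<Otimes>\<^sub>M borel)"
    by measurable
  have "(\<integral>\<^sup>+z. f z \<partial>\<mu>) = (\<integral>\<^sup>+z. ennreal (indicator \<H> z / (Im z)\<^sup>2) * f z \<partial>lborel)"
    unfolding poincare_measure_def by (rule nn_integral_density) auto
  also have "\<dots> = (\<integral>\<^sup>+y. \<integral>\<^sup>+x. ennreal (indicator \<H> (Complex x y) / (Im (Complex x y))\<^sup>2) * f (Complex x y) \<partial>lborel \<partial>lborel)"
    by (rule nn_integral_xy) measurable
  also have "\<dots> = (\<integral>\<^sup>+y. indicator {0<..} y * (ennreal (1 / y) * (\<integral>\<^sup>+t. f (Complex (t * y) y) \<partial>lborel)) \<partial>lborel)"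
  proof (rule nn_integral_cong)
    fix y :: real
    show "(\<integral>\<^sup>+x. ennreal (indicator \<H> (Complex x y) / (Im (Complex x y))\<^sup>2) * f (Complex x y) \<partial>lborel)
      = indicator {0<..} y * (ennreal (1 / y) * (\<integral>\<^sup>+t. f (Complex (t * y) y) \<partial>lborel))"
    proof (cases "y > 0")
      case True
      have [measurable]: "(\<lambda>x. f (Complex x y)) \<in> borel_measurable borel"
        by measurable
      have "ennreal (1 / y\<^sup>2) * (\<integral>\<^sup>+x. f (Complex x y) \<partial>lborel)
          = ennreal (1 / y\<^sup>2) * (ennreal \<bar>y\<bar> * (\<integral>\<^sup>+t. f (Complex (0 + y * t) y) \<partial>lborel))"
        using True by (subst nn_integral_real_affine[where c = y and t = 0]) auto
      also have "\<dots> = ennreal (1 / y) * (\<integral>\<^sup>+t. f (Complex (t * y) y) \<partial>lborel)"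
        using True by (simp add: mult.assoc[symmetric] power2_eq_square mult.commute flip: ennreal_mult)
      finally show ?thesis
        using True by (simp add: upper_iff nn_integral_cmult)
    qed (simp add: upper_iff)
  qed
  also have "\<dots> = (\<integral>\<^sup>+v. \<integral>\<^sup>+t. f (hpoint t v) \<partial>lborel \<partial>lborel)"
    unfolding hpoint_def by (rule nn_integral_substitute_exp) measurable
  finally show ?thesis .
qed

lemma nn_integral_poincare':
  assumes [measurable]: "f \<in> borel_measurable borel"
  shows "(\<integral>\<^sup>+z. f z \<partial>\<mu>) = (\<integral>\<^sup>+t. \<integral>\<^sup>+v. f (hpoint t v) \<partial>lborel \<partial>lborel)"
  unfolding nn_integral_poincare[OF assms]
  by (rule lborel_pair.Fubini') measurable

lemma poincare_translate:
  assumes [measurable]: "f \<in> borel_measurable borel"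
  shows "(\<integral>\<^sup>+z. f (z + of_real b) \<partial>\<mu>) = (\<integral>\<^sup>+z. f z \<partial>\<mu>)"
proof -
  have "(\<integral>\<^sup>+t. f (hpoint t v + of_real b) \<partial>lborel) = (\<integral>\<^sup>+t. f (hpoint t v) \<partial>lborel)" for v
  proof -
    have "hpoint t v + of_real b = hpoint (b * exp (- v) + 1 * t) v" for t
      by (simp add: hpoint_def complex_eq_iff exp_minus field_simps)
    thus ?thesis
      by (subst (2) nn_integral_real_affine[where c = 1 and t = "b * exp (- v)"]) auto
  qed
  thus ?thesis by (simp add: nn_integral_poincare)
qed

lemma poincare_dilate:
  assumes [measurable]: "f \<in> borel_measurable borel" and "a > 0"
  shows "(\<integral>\<^sup>+z. f (of_real a * z) \<partial>\<mu>) = (\<integral>\<^sup>+z. f z \<partial>\<mu>)"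
proof -
  have "(\<integral>\<^sup>+v. f (of_real a * hpoint t v) \<partial>lborel) = (\<integral>\<^sup>+v. f (hpoint t v) \<partial>lborel)" for t
  proof -
    have "of_real a * hpoint t v = hpoint t (ln a + 1 * v)" for v
      using \<open>a > 0\<close> by (simp add: hpoint_def complex_eq_iff exp_add)
    thus ?thesis
      by (subst (2) nn_integral_real_affine[where c = 1 and t = "ln a"]) auto
  qed
  thus ?thesis by (simp add: nn_integral_poincare')
qed

lemma poincare_invert:
  assumes [measurable]: "f \<in> borel_measurable borel"
  shows "(\<integral>\<^sup>+z. f (- 1 / z) \<partial>\<mu>) = (\<integral>\<^sup>+z. f z \<partial>\<mu>)"
proof -
  have "(\<integral>\<^sup>+v. f (- 1 / hpoint t v) \<partial>lborel) = (\<integral>\<^sup>+v. f (hpoint (- t) v) \<partial>lborel)" for t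
  proof -
    have "- 1 / hpoint t v = hpoint (- t) (- ln (1 + t\<^sup>2) + (-1) * v)" for v
    proof -
      have pos: "1 + t\<^sup>2 > 0" by (simp add: add_pos_nonneg)
      have e: "exp (- ln (1 + t\<^sup>2) + (-1) * v) = 1 / ((1 + t\<^sup>2) * exp v)"
        using pos by (simp add: exp_diff exp_minus field_simps)
      have N: "(t * exp v)\<^sup>2 + (exp v)\<^sup>2 = ((1 + t\<^sup>2) * exp v) * exp v"
        by (simp add: power2_eq_square algebra_simps)
      have "Re (- 1 / hpoint t v) = - t * (1 / ((1 + t\<^sup>2) * exp v))"
        using pos by (simp add: Re_divide hpoint_def N)
      moreover have "Im (- 1 / hpoint t v) = 1 / ((1 + t\<^sup>2) * exp v)"
        using pos by (simp add: Im_divide hpoint_def N)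
      ultimately show ?thesis
        unfolding hpoint_def e by (simp add: complex_eq_iff)
    qed
    thus ?thesis
      by (subst (2) nn_integral_real_affine[where c = "-1" and t = "- ln (1 + t\<^sup>2)"]) auto
  qed
  hence "(\<integral>\<^sup>+z. f (- 1 / z) \<partial>\<mu>) = (\<integral>\<^sup>+t. \<integral>\<^sup>+v. f (hpoint (- t) v) \<partial>lborel \<partial>lborel)"
    by (simp add: nn_integral_poincare')
  also have "\<dots> = (\<integral>\<^sup>+t. \<integral>\<^sup>+v. f (hpoint t v) \<partial>lborel \<partial>lborel)"
    by (subst (2) nn_integral_real_affine[where c = "-1" and t = 0]) auto
  finally show ?thesis by (simp add: nn_integral_poincare')
qed

text \<open>
  If \<open>c = 0\<close> the map is a dilation followed by a translation; otherwise \<open>(a z + b) / (c z + d) = a / c - 1 / (c\<^sup>2 (z + d / c))\<close>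
  reduces it to two translations, a dilation and the inversion.
\<close>

lemma poincare_act:
  assumes [measurable]: "f \<in> borel_measurable borel" and A: "A \<in> SL2"
  shows "(\<integral>\<^sup>+z. f (act A z) \<partial>\<mu>) = (\<integral>\<^sup>+z. f z \<partial>\<mu>)"
proof -
  define a b c d where "a = A$1$1" "b = A$1$2" "c = A$2$1" "d = A$2$2"
  have det: "a * d - b * c = 1" using A by (simp add: a_b_c_d_def SL2_iff)
  show ?thesis
  proof (cases "c = 0")
    case True
    have "a \<noteq> 0" using det True by auto
    moreover have "d = 1 / a" using det True \<open>a \<noteq> 0\<close> by (simp add: field_simps)
    ultimately have "act A z = of_real (a\<^sup>2) * z + of_real (a * b)" for z
      using True by (simp add: act_altdef den_def power2_eq_square algebra_simps flip: a_b_c_d_def)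
    hence "(\<integral>\<^sup>+z. f (act A z) \<partial>\<mu>)
        = (\<integral>\<^sup>+z. (\<lambda>z. f (z + of_real (a * b))) (of_real (a\<^sup>2) * z) \<partial>\<mu>)" by simp
    also have "\<dots> = (\<integral>\<^sup>+z. f (z + of_real (a * b)) \<partial>\<mu>)"
      using \<open>a \<noteq> 0\<close> by (intro poincare_dilate) auto
    finally show ?thesis by (simp only: poincare_translate[OF assms(1)])
  next
    case False
    define g1 where "g1 = (\<lambda>z. f (z + of_real (a / c)))"
    define g2 where "g2 = (\<lambda>z. g1 (of_real (1 / c\<^sup>2) * z))"
    define g3 where "g3 = (\<lambda>z. g2 (- 1 / z))"
    have [measurable]: "g1 \<in> borel_measurable borel" by (simp add: g1_def)
    have [measurable]: "g2 \<in> borel_measurable borel" by (simp add: g2_def)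
    have [measurable]: "g3 \<in> borel_measurable borel" by (simp add: g3_def)
    have "f (act A z) = g3 (z + of_real (d / c))" if "z \<in> \<H>" for z
    proof -
      have nz: "of_real c * z + of_real d \<noteq> 0"
        using den_nonzero[OF A that] by (simp add: den_def a_b_c_d_def)
      have "of_real (1 / c\<^sup>2) * (- 1 / (z + of_real (d / c))) + of_real (a / c)
          = - 1 / (of_real c * (of_real c * z + of_real d)) + of_real a / of_real c"
        using False nz by (simp add: field_simps power2_eq_square)
      also have "\<dots> = (of_real a * (of_real c * z + of_real d) - of_real (a * d - b * c)) / (of_real c * (of_real c * z + of_real d))"
        unfolding det using False nz by (simp add: divide_simps)
      also have "\<dots> = (of_real a * z + of_real b) / (of_real c * z + of_real d)"
        using False nz by (simp add: divide_simps) (simp add: algebra_simps)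
      finally show ?thesis
        unfolding g3_def g2_def g1_def act_altdef den_def a_b_c_d_def by simp
    qed
    hence "(\<integral>\<^sup>+z. f (act A z) \<partial>\<mu>) = (\<integral>\<^sup>+z. g3 (z + of_real (d / c)) \<partial>\<mu>)"
      by (intro nn_integral_poincare_cong)
    also have "\<dots> = (\<integral>\<^sup>+z. g3 z \<partial>\<mu>)" by (rule poincare_translate) simp
    also have "\<dots> = (\<integral>\<^sup>+z. g2 z \<partial>\<mu>)" unfolding g3_def by (rule poincare_invert) simp
    also have "\<dots> = (\<integral>\<^sup>+z. g1 z \<partial>\<mu>)" unfolding g2_def using False by (intro poincare_dilate) auto
    also have "\<dots> = (\<integral>\<^sup>+z. f z \<partial>\<mu>)" unfolding g1_def by (rule poincare_translate) simp
    finally show ?thesis .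
  qed
qed

section \<open>Integration over hyperbolic balls\<close>

definition kern :: "real \<Rightarrow> complex \<Rightarrow> complex \<Rightarrow> ennreal" where
  "kern R z w = (if near R z w then 1 else 0)"

text \<open>
  The integral is not divided by the volume of the ball: the constants have that volume as their eigenvalue.
\<close>

definition ballint :: "real \<Rightarrow> (complex \<Rightarrow> ennreal) \<Rightarrow> complex \<Rightarrow> ennreal" where
  "ballint R f z = (\<integral>\<^sup>+w. kern R z w * f w \<partial>\<mu>)"

lemma kern_measurable [measurable]: "(\<lambda>(z, w). kern R z w) \<in> borel_measurable (borel \<Otimes>\<^sub>M borel)"
  unfolding kern_def near_def by measurable

lemma kern_measurable' [measurable]:
  assumes [measurable]: "f \<in> borel_measurable M" "g \<in> borel_measurable M"
  shows "(\<lambda>x. kern R (f x) (g x)) \<in> borel_measurable M"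
  unfolding kern_def near_def by measurable

lemma kern_sym: "kern R z w = kern R w z"
  unfolding kern_def using near_sym by simp

lemma kern_act:
  assumes "A \<in> SL2" "z \<in> \<H>" "w \<in> \<H>"
  shows "kern R (act A z) (act A w) = kern R z w"
  unfolding kern_def by (simp add: near_act assms)

lemma ballint_measurable [measurable]:
  assumes [measurable]: "f \<in> borel_measurable borel"
  shows "ballint R f \<in> borel_measurable borel"
  unfolding ballint_def
  by (rule poincare.borel_measurable_nn_integral) measurable

lemma ballint_act:
  assumes [measurable]: "f \<in> borel_measurable borel" and A: "A \<in> SL2" "z \<in> \<H>"
  shows "ballint R (\<lambda>w. f (act A w)) z = ballint R f (act A z)"
proof -
  have "ballint R f (act A z) = (\<integral>\<^sup>+w. kern R (act A z) (act A w) * f (act A w) \<partial>\<mu>)"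
    unfolding ballint_def by (rule poincare_act[symmetric]) (use A in auto)
  also have "\<dots> = ballint R (\<lambda>w. f (act A w)) z"
    unfolding ballint_def by (rule nn_integral_poincare_cong) (simp add: kern_act A)
  finally show ?thesis ..
qed

lemma ballint_cong:
  assumes "\<And>w. w \<in> \<H> \<Longrightarrow> near R z w \<Longrightarrow> f w = g w"
  shows "ballint R f z = ballint R g z"
  unfolding ballint_def by (rule nn_integral_poincare_cong) (auto simp: kern_def assms)

lemma ballint_mono:
  assumes "\<And>w. w \<in> \<H> \<Longrightarrow> near R z w \<Longrightarrow> f w \<le> g w"
  shows "ballint R f z \<le> ballint R g z"
  unfolding ballint_def by (rule nn_integral_poincare_mono) (auto simp: kern_def assms)

lemma ballint_cmult:
  assumes [measurable]: "f \<in> borel_measurable borel"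
  shows "ballint R (\<lambda>w. c * f w) z = c * ballint R f z"
  unfolding ballint_def by (subst nn_integral_cmult[symmetric]) (auto simp: mult_ac)

lemma ballint_add:
  assumes [measurable]: "f \<in> borel_measurable borel" "g \<in> borel_measurable borel"
  shows "ballint R (\<lambda>w. f w + g w) z = ballint R f z + ballint R g z"
  unfolding ballint_def by (subst nn_integral_add[symmetric]) (auto simp: distrib_left)

text \<open>
  The eigenvalue of \<^const>\<open>ballint\<close> on the \<open>s\<close>-th power of the height.
\<close>

definition lam :: "real \<Rightarrow> real \<Rightarrow> ennreal" where
  "lam R s = ballint R (\<lambda>w. ennreal (Im w powr s)) \<i>"

lemma i_upper [simp]: "\<i> \<in> \<H>"
  by (simp add: upper_iff)

text \<open>
  The affine maps \<open>w \<mapsto> y w + x\<close> act transitively and multiply the height by a constant, so the value at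
  \<open>i\<close> determines the value everywhere.
\<close>

lemma ballint_powr:
  assumes "z \<in> \<H>"
  shows "ballint R (\<lambda>w. ennreal (Im w powr s)) z = lam R s * ennreal (Im z powr s)"
proof -
  define x y where "x = Re z" "y = Im z"
  have y: "y > 0" using assms by (simp add: x_y_def upper_iff)
  define A where "A = mat2 (sqrt y) (x / sqrt y) 0 (1 / sqrt y)"
  have A: "A \<in> SL2" using y by (simp add: A_def SL2_iff)
  have sq: "complex_of_real (sqrt y) * complex_of_real (sqrt y) = of_real y"
    using y by (simp flip: of_real_mult)
  have act: "act A w = of_real y * w + of_real x" for w
    using y by (simp add: act_altdef den_def A_def field_simps sq)
  have "act A \<i> = z" unfolding act by (simp add: complex_eq_iff x_y_def)
  have "ballint R (\<lambda>w. ennreal (Im w powr s)) z = ballint R (\<lambda>w. ennreal (Im (act A w) powr s)) \<i>"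
    unfolding \<open>act A \<i> = z\<close>[symmetric] by (rule ballint_act[symmetric]) (use A in auto)
  also have "\<dots> = ballint R (\<lambda>w. ennreal (y powr s) * ennreal (Im w powr s)) \<i>"
    using y by (intro ballint_cong) (simp add: act powr_mult upper_iff ennreal_mult)
  also have "\<dots> = lam R s * ennreal (y powr s)"
    unfolding lam_def by (subst ballint_cmult) (auto simp: mult.commute)
  finally show ?thesis by (simp add: x_y_def)
qed

lemma lam_0: "z \<in> \<H> \<Longrightarrow> ballint R (\<lambda>w. 1) z = lam R 0"
  using ballint_powr[of z R 0] ballint_cong[of R z "\<lambda>w. 1" "\<lambda>w. ennreal (Im w powr 0)"]
  by (auto simp: upper_iff)

text \<open>
  The involution \<open>x + i y \<mapsto> (i - x) / y\<close> sends \<open>g i\<close> to \<open>g\<^sup>-\<^sup>1 i\<close> for affine \<open>g\<close>. It preserves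
  the distance to \<open>i\<close> and changes the Poincare measure by the factor \<open>y\<close>. The proof uses its composition
  with the reflection \<open>x \<mapsto> -x\<close>, which has the same properties.
\<close>

lemma lam_symmetric: "lam R (1 - s) = lam R s"
proof -
  have near: "near R \<i> (hpoint t v) \<longleftrightarrow> near R \<i> (hpoint (exp v * t) (- v))" for t v
  proof -
    have e: "exp (- v) = inverse (exp v)" by (simp add: exp_minus)
    have "near R \<i> (hpoint (exp v * t) (- v)) \<longleftrightarrow> (exp v * t * exp (- v))\<^sup>2 + (1 - exp (- v))\<^sup>2 \<le> R * exp (- v)"
      by (simp add: near_def cmod_power2 hpoint_def)
    also have "\<dots> \<longleftrightarrow> ((exp v * t * exp (- v))\<^sup>2 + (1 - exp (- v))\<^sup>2) * (exp v)\<^sup>2 \<le> R * exp (- v) * (exp v)\<^sup>2"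
      by simp
    also have "((exp v * t * exp (- v))\<^sup>2 + (1 - exp (- v))\<^sup>2) * (exp v)\<^sup>2 = (t * exp v)\<^sup>2 + (1 - exp v)\<^sup>2"
      by (simp add: e field_simps power2_eq_square)
    also have "R * exp (- v) * (exp v)\<^sup>2 = R * exp v"
      by (simp add: e field_simps power2_eq_square)
    also have "(t * exp v)\<^sup>2 + (1 - exp v)\<^sup>2 \<le> R * exp v \<longleftrightarrow> near R \<i> (hpoint t v)"
      by (simp add: near_def cmod_power2 hpoint_def)
    finally show ?thesis ..
  qed
  define G where "G = (\<lambda>v. \<integral>\<^sup>+t. kern R \<i> (hpoint t v) \<partial>lborel)"
  have [measurable]: "G \<in> borel_measurable borel"
    unfolding G_def by measurable
  have G: "G v = ennreal (exp (- v)) * G (- v)" for v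
  proof -
    have "G v = (\<integral>\<^sup>+t. kern R \<i> (hpoint (exp v * t) (- v)) \<partial>lborel)"
      unfolding G_def kern_def using near by simp
    moreover have "G (- v) = ennreal \<bar>exp v\<bar> * (\<integral>\<^sup>+t. kern R \<i> (hpoint (0 + exp v * t) (- v)) \<partial>lborel)"
      unfolding G_def by (rule nn_integral_real_affine) auto
    ultimately have "G (- v) = ennreal (exp v) * G v" by simp
    hence "ennreal (exp (- v)) * G (- v) = ennreal (exp (- v) * exp v) * G v"
      by (simp add: ennreal_mult mult.assoc)
    thus ?thesis by (simp flip: exp_add)
  qed
  have lam: "lam R s = (\<integral>\<^sup>+v. ennreal (exp (s * v)) * G v \<partial>lborel)" for s
  proof -
    have "lam R s = (\<integral>\<^sup>+v. \<integral>\<^sup>+t. kern R \<i> (hpoint t v) * ennreal (Im (hpoint t v) powr s) \<partial>lborel \<partial>lborel)"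
      unfolding lam_def ballint_def by (rule nn_integral_poincare) simp
    also have "\<dots> = (\<integral>\<^sup>+v. ennreal (exp (s * v)) * G v \<partial>lborel)"
      unfolding G_def by (subst nn_integral_cmult[symmetric])
        (auto simp: hpoint_def powr_def mult_ac intro!: nn_integral_cong)
    finally show ?thesis .
  qed
  have "lam R s = ennreal \<bar>-1\<bar> * (\<integral>\<^sup>+v. ennreal (exp (s * (0 + (-1) * v))) * G (0 + (-1) * v) \<partial>lborel)"
    unfolding lam by (rule nn_integral_real_affine) auto
  also have "\<dots> = (\<integral>\<^sup>+v. ennreal (exp ((1 - s) * v)) * G v \<partial>lborel)"
  proof -
    have "ennreal (exp ((1 - s) * v)) * G v = ennreal (exp (s * - v)) * G (- v)" for v
    proof -
      have "ennreal (exp ((1 - s) * v)) * G v = ennreal (exp ((1 - s) * v)) * (ennreal (exp (- v)) * G (- v))"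
        by (subst G) simp
      also have "\<dots> = ennreal (exp ((1 - s) * v) * exp (- v)) * G (- v)"
        by (simp add: ennreal_mult mult.assoc)
      also have "exp ((1 - s) * v) * exp (- v) = exp (s * - v)"
        by (simp add: algebra_simps flip: exp_add)
      finally show ?thesis .
    qed
    thus ?thesis by simp
  qed
  also have "\<dots> = lam R (1 - s)" by (rule lam[symmetric])
  finally show ?thesis ..
qed

lemma near_Im_lower:
  assumes "near R z w" "z \<in> \<H>" "w \<in> \<H>" "R \<ge> 0"
  shows "Im z / (R + 2) \<le> Im w"
  using near_Im[of R w z] assms by (simp add: near_sym pos_divide_le_eq mult.commute)

lemma near_Re:
  assumes "near R z w" "z \<in> \<H>" "w \<in> \<H>" "R \<ge> 0"
  shows "\<bar>Re w - Re z\<bar> \<le> (R + 2) * Im z"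
proof -
  have pos: "Im z > 0" using assms by (simp add: upper_iff)
  have "(Re w - Re z)\<^sup>2 \<le> (cmod (z - w))\<^sup>2"
    by (simp add: cmod_power2 power2_commute)
  also have "\<dots> \<le> R * Im z * Im w" using assms(1) by (simp add: near_def)
  also have "\<dots> \<le> R * Im z * ((R + 2) * Im z)"
    using near_Im[OF assms] assms(4) pos by (intro mult_left_mono) auto
  also have "\<dots> \<le> ((R + 2) * Im z)\<^sup>2"
  proof -
    have "R * (R + 2) * (Im z)\<^sup>2 \<le> (R + 2) * (R + 2) * (Im z)\<^sup>2"
      using assms(4) by (intro mult_right_mono) auto
    thus ?thesis by (simp add: power2_eq_square mult_ac)
  qed
  finally have "\<bar>Re w - Re z\<bar> \<le> \<bar>(R + 2) * Im z\<bar>" by (simp only: abs_le_square_iff)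
  thus ?thesis using assms(4) pos by simp
qed

text \<open>
  Compact sets of the half-plane with both coordinates controlled by two numbers; the lower edge
  is tied to the upper one so that a single parameter keeps the set away from the real axis.
\<close>

definition rect :: "real \<Rightarrow> real \<Rightarrow> complex set" where
  "rect a c = {z. \<bar>Re z\<bar> \<le> a \<and> 1 / c \<le> Im z \<and> Im z \<le> c}"

lemma rect_measurable [measurable]: "rect a c \<in> sets borel"
  unfolding rect_def by measurable

lemma rect_upper:
  assumes "c > 0"
  shows "rect a c \<subseteq> \<H>"
proof
  fix z assume "z \<in> rect a c"
  hence "1 / c \<le> Im z" by (simp add: rect_def)
  moreover have "0 < 1 / c" using assms by simp
  ultimately show "z \<in> \<H>" unfolding upper_iff by linarith
qed

lemma rect_finite:
  assumes "c > 0"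
  shows "emeasure \<mu> (rect a c) < \<infinity>"
proof -
  have sub: "rect a c \<subseteq> cbox (Complex (- a) (1 / c)) (Complex a c)"
    by (auto simp: rect_def in_cbox_complex_iff)
  have "emeasure \<mu> (rect a c)
      = (\<integral>\<^sup>+z. ennreal (indicator \<H> z / (Im z)\<^sup>2) * indicator (rect a c) z \<partial>lborel)"
    unfolding poincare_measure_def by (rule emeasure_density) auto
  also have "\<dots> \<le> (\<integral>\<^sup>+z. ennreal (c\<^sup>2) * indicator (cbox (Complex (- a) (1 / c)) (Complex a c)) z \<partial>lborel)"
  proof (rule nn_integral_mono)
    fix z
    show "ennreal (indicator \<H> z / (Im z)\<^sup>2) * indicator (rect a c) z
        \<le> ennreal (c\<^sup>2) * indicator (cbox (Complex (- a) (1 / c)) (Complex a c)) z"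
    proof (cases "z \<in> rect a c")
      case True
      hence le: "1 / c \<le> Im z" by (simp add: rect_def)
      have "Im z > 0" using subsetD[OF rect_upper[OF assms] True] by (simp add: upper_iff)
      have "1 \<le> c * Im z" using assms le by (simp add: field_simps)
      hence "1\<^sup>2 \<le> (c * Im z)\<^sup>2" by (intro power_mono) auto
      hence "indicator \<H> z / (Im z)\<^sup>2 \<le> c\<^sup>2"
        using \<open>Im z > 0\<close> by (simp add: upper_iff power_mult_distrib pos_divide_le_eq)
      thus ?thesis using True sub by (auto simp: indicator_def intro!: ennreal_leI)
    qed auto
  qed
  also have "\<dots> = ennreal (c\<^sup>2) * emeasure lborel (cbox (Complex (- a) (1 / c)) (Complex a c))"
    by (simp add: nn_integral_cmult_indicator)
  also have "\<dots> < \<infinity>"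
    using emeasure_lborel_cbox_finite[of "Complex (- a) (1 / c)" "Complex a c"] by (simp add: ennreal_mult_less_top)
  finally show ?thesis .
qed

lemma near_rect:
  assumes "z \<in> \<H>" "R \<ge> 0"
  obtains a c where "c > 0" "\<And>w. w \<in> \<H> \<Longrightarrow> near R z w \<Longrightarrow> w \<in> rect a c"
proof
  have pos: "Im z > 0" using assms by (simp add: upper_iff)
  let ?c = "max ((R + 2) * Im z) ((R + 2) / Im z)"
  show "?c > 0" using pos assms(2) by (simp add: less_max_iff_disj)
  fix w assume w: "w \<in> \<H>" "near R z w"
  have "1 / ?c \<le> 1 / ((R + 2) / Im z)"
    using pos assms(2) by (intro divide_left_mono mult_pos_pos) (auto simp: less_max_iff_disj)
  also have "\<dots> = Im z / (R + 2)" by simp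
  also have "\<dots> \<le> Im w" using near_Im_lower w assms by blast
  finally show "w \<in> rect (\<bar>Re z\<bar> + (R + 2) * Im z) ?c"
    using near_Im[OF w(2) assms(1) w(1) assms(2)] near_Re[OF w(2) assms(1) w(1) assms(2)]
    by (auto simp: rect_def le_max_iff_disj)
qed

lemma rect_mono:
  assumes "0 < c" "c \<le> c'" "a \<le> a'"
  shows "rect a c \<subseteq> rect a' c'"
proof -
  have "1 / c' \<le> 1 / c" using assms by (intro divide_left_mono) auto
  thus ?thesis using assms by (auto simp: rect_def)
qed

lemma lam_finite:
  assumes "R \<ge> 0"
  shows "lam R s < \<infinity>"
proof -
  obtain a c where ac: "c > 0" "\<And>w. w \<in> \<H> \<Longrightarrow> near R \<i> w \<Longrightarrow> w \<in> rect a c"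
    by (rule near_rect[OF i_upper assms]) (rule that)
  have "lam R s \<le> (\<integral>\<^sup>+w. ennreal ((1 / c) powr s + c powr s) * indicator (rect a c) w \<partial>\<mu>)"
    unfolding lam_def ballint_def
  proof (rule nn_integral_poincare_mono)
    fix w assume w: "w \<in> \<H>"
    show "kern R \<i> w * ennreal (Im w powr s) \<le> ennreal ((1 / c) powr s + c powr s) * indicator (rect a c) w"
    proof (cases "near R \<i> w")
      case True
      hence wr: "w \<in> rect a c" using ac w by auto
      have pos: "Im w > 0" using w by (simp add: upper_iff)
      have "Im w powr s \<le> (1 / c) powr s + c powr s"
      proof (cases "s \<ge> 0")
        case True
        have "0 \<le> (1 / c) powr s" by (rule powr_ge_zero)
        moreover have "Im w powr s \<le> c powr s" using wr pos True by (intro powr_mono2) (auto simp: rect_def)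
        ultimately show ?thesis by linarith
      next
        case False
        have "0 \<le> c powr s" by (rule powr_ge_zero)
        moreover have "Im w powr s \<le> (1 / c) powr s" using wr pos False ac(1) by (intro powr_mono2') (auto simp: rect_def)
        ultimately show ?thesis by linarith
      qed
      hence "ennreal (Im w powr s) \<le> ennreal ((1 / c) powr s + c powr s)" by (rule ennreal_leI)
      thus ?thesis using wr True by (simp add: kern_def del: ennreal_plus)
    qed (simp add: kern_def)
  qed
  also have "\<dots> = ennreal ((1 / c) powr s + c powr s) * emeasure \<mu> (rect a c)"
    by (rule nn_integral_cmult_indicator) simp
  also have "\<dots> < \<infinity>" using rect_finite[OF ac(1), of a] by (simp add: ennreal_mult_less_top)
  finally show ?thesis .
qed

definition lamr :: "real \<Rightarrow> real \<Rightarrow> real" where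
  "lamr R s = enn2real (lam R s)"

lemma lam_eq: "R \<ge> 0 \<Longrightarrow> lam R s = ennreal (lamr R s)"
  using lam_finite[of R s] by (simp add: lamr_def less_top)

lemma lamr_nonneg: "lamr R s \<ge> 0"
  by (simp add: lamr_def)

lemma lamr_1: "lamr R 1 = lamr R 0"
  using lam_symmetric[of R 0] by (simp add: lamr_def)

text \<open>
  Pairing \<open>s\<close> with \<open>1 - s\<close> makes the term of first order in \<open>s - 1\<close> nonnegative for every \<open>y\<close>.
\<close>

lemma powr_sum_ge:
  assumes "y > (0 :: real)"
  shows "y powr s + y powr (1 - s) \<ge> y + 1 + (s - 1) * ((y - 1) * ln y)"
proof -
  define x where "x = (s - 1) * ln y"
  have e: "y powr s = y * exp x" "y powr (1 - s) = exp (- x)"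
    using assms by (simp_all add: powr_def x_def algebra_simps exp_diff exp_add)
  have "y * exp x \<ge> y * (1 + x)" using assms exp_ge_add_one_self[of x] by (intro mult_left_mono) auto
  moreover have "exp (- x) \<ge> 1 - x" using exp_ge_add_one_self[of "- x"] by simp
  ultimately show ?thesis unfolding e by (simp add: x_def algebra_simps)
qed

text \<open>
  By convexity the eigenvalue grows at least linearly in \<open>s - 1\<close>; this is the spectral gap that
  makes the resolvent argument below work uniformly for \<open>s\<close> near 1.
\<close>

lemma lamr_lower:
  assumes R: "R \<ge> 1"
  obtains k where "k > 0" "\<And>s. s \<ge> 1 \<Longrightarrow> lamr R s \<ge> lamr R 0 + k * (s - 1)"
proof -
  \<comment> \<open>A box inside the ball of parameter 1 about \<open>i\<close> that stays away from the line \<open>y = 1\<close>, where the first order term vanishes.\<close>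
  define B where "B = cbox (Complex (- 1 / 2) (5 / 4)) (Complex (1 / 2) (3 / 2))"
  have Bup: "w \<in> B \<Longrightarrow> w \<in> \<H>" for w by (auto simp: B_def in_cbox_complex_iff upper_iff)
  have near: "near R \<i> w" if "w \<in> B" for w
  proof -
    have b: "\<bar>Re w\<bar> \<le> 1 / 2" "5 / 4 \<le> Im w" "Im w \<le> 3 / 2" using that by (auto simp: B_def in_cbox_complex_iff)
    have "(Re w)\<^sup>2 \<le> (1 / 2)\<^sup>2" using b(1) by (simp add: abs_le_square_iff[symmetric])
    moreover have "(1 - Im w)\<^sup>2 \<le> (1 / 2)\<^sup>2" using b by (simp add: abs_le_square_iff[symmetric])
    ultimately have "(cmod (\<i> - w))\<^sup>2 \<le> 1 / 2"
      unfolding cmod_power2 by (simp add: power2_eq_square)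
    also have "\<dots> \<le> R * Im w" using R b by (intro order_trans[OF _ mult_mono[of 1 R 1 "Im w"]]) auto
    finally show ?thesis by (simp add: near_def)
  qed
  have [measurable]: "B \<in> sets borel" by (simp add: B_def)
  have Bpos: "emeasure \<mu> B \<noteq> 0"
  proof
    assume "emeasure \<mu> B = 0"
    hence "(\<integral>\<^sup>+z. ennreal (indicator \<H> z / (Im z)\<^sup>2) * indicator B z \<partial>lborel) = 0"
      unfolding poincare_measure_def by (subst (asm) emeasure_density) auto
    hence "AE z in lborel. ennreal (indicator \<H> z / (Im z)\<^sup>2) * indicator B z = 0"
      by (subst (asm) nn_integral_0_iff_AE) auto
    hence "AE z in lborel. z \<notin> B"
      by eventually_elim (use Bup in \<open>auto simp: indicator_def upper_iff divide_le_0_iff split: if_splits\<close>)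
    hence "emeasure lborel B = 0"
      by (subst (asm) AE_iff_measurable[of B]) auto
    thus False by (simp add: B_def emeasure_lborel_cbox_eq Basis_complex_def)
  qed
  have Bfin: "emeasure \<mu> B < \<infinity>"
  proof -
    have "B \<subseteq> rect 1 2" by (auto simp: B_def rect_def in_cbox_complex_iff)
    thus ?thesis using rect_finite[of 2 1] emeasure_mono[of B "rect 1 2" \<mu>]
      by (auto intro: le_less_trans)
  qed
  define b where "b = measure \<mu> B"
  have b: "b > 0" "emeasure \<mu> B = ennreal b"
    using Bpos Bfin by (auto simp: b_def measure_def less_top enn2real_positive_iff zero_less_iff_neq_zero)
  define c where "c = (1 / 4) * ln (5 / 4 :: real)"
  have c: "c > 0" by (simp add: c_def)
  have main: "2 * lamr R s \<ge> 2 * lamr R 0 + (s - 1) * c * b" if s: "s \<ge> 1" for s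
  proof -
    have "ennreal (lamr R 1) + ennreal (lamr R 0) + ennreal ((s - 1) * c) * ennreal b
        = lam R 1 + lam R 0 + (\<integral>\<^sup>+w. ennreal ((s - 1) * c) * indicator B w \<partial>\<mu>)"
      using R by (simp add: nn_integral_cmult_indicator b(2) lam_eq)
    also have "\<dots> = (\<integral>\<^sup>+w. kern R \<i> w * ennreal (Im w powr 1) + kern R \<i> w * ennreal (Im w powr 0)
         + ennreal ((s - 1) * c) * indicator B w \<partial>\<mu>)"
    proof -
      have "(\<integral>\<^sup>+w. kern R \<i> w * ennreal (Im w powr 1) + kern R \<i> w * ennreal (Im w powr 0)
            + ennreal ((s - 1) * c) * indicator B w \<partial>\<mu>)
          = (\<integral>\<^sup>+w. kern R \<i> w * ennreal (Im w powr 1) + kern R \<i> w * ennreal (Im w powr 0) \<partial>\<mu>)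
            + (\<integral>\<^sup>+w. ennreal ((s - 1) * c) * indicator B w \<partial>\<mu>)"
        by (rule nn_integral_add) measurable
      also have "(\<integral>\<^sup>+w. kern R \<i> w * ennreal (Im w powr 1) + kern R \<i> w * ennreal (Im w powr 0) \<partial>\<mu>)
          = lam R 1 + lam R 0"
        unfolding lam_def ballint_def by (rule nn_integral_add) measurable
      finally show ?thesis ..
    qed
    also have "\<dots> \<le> (\<integral>\<^sup>+w. kern R \<i> w * ennreal (Im w powr s) + kern R \<i> w * ennreal (Im w powr (1 - s)) \<partial>\<mu>)"
    proof (rule nn_integral_poincare_mono)
      fix w assume w: "w \<in> \<H>"
      hence pos: "Im w > 0" by (simp add: upper_iff)
      show "kern R \<i> w * ennreal (Im w powr 1) + kern R \<i> w * ennreal (Im w powr 0) + ennreal ((s - 1) * c) * indicator B w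
        \<le> kern R \<i> w * ennreal (Im w powr s) + kern R \<i> w * ennreal (Im w powr (1 - s))"
      proof (cases "near R \<i> w")
        case False
        hence "w \<notin> B" using near[of w] by auto
        thus ?thesis using False by (simp add: kern_def)
      next
        case True
        have "(s - 1) * (c * indicator B w) \<le> (s - 1) * ((Im w - 1) * ln (Im w))"
        proof (intro mult_left_mono)
          show "c * indicator B w \<le> (Im w - 1) * ln (Im w)"
          proof (cases "w \<in> B")
            case True
            hence "5 / 4 \<le> Im w" by (auto simp: B_def in_cbox_complex_iff)
            hence "1 / 4 * ln (5 / 4) \<le> (Im w - 1) * ln (Im w)" by (intro mult_mono) auto
            thus ?thesis using True unfolding c_def by simp
          next
            case False
            have "0 \<le> (Im w - 1) * ln (Im w)"
              using pos by (cases "Im w \<ge> 1") (auto intro: mult_nonneg_nonneg mult_nonpos_nonpos)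
            thus ?thesis using False by simp
          qed
        qed (use s in auto)
        hence "Im w + 1 + (s - 1) * c * indicator B w \<le> Im w powr s + Im w powr (1 - s)"
          using powr_sum_ge[OF pos, of s] by (simp add: mult.assoc)
        hence "ennreal (Im w + 1 + (s - 1) * c * indicator B w) \<le> ennreal (Im w powr s + Im w powr (1 - s))"
          by (rule ennreal_leI)
        thus ?thesis using True pos s c
          by (cases "w \<in> B") (simp_all add: kern_def)
      qed
    qed
    also have "\<dots> = lam R s + lam R (1 - s)"
      unfolding lam_def ballint_def by (rule nn_integral_add) auto
    also have "\<dots> = ennreal (lamr R s) + ennreal (lamr R s)" using R by (simp add: lam_symmetric lam_eq)
    finally show ?thesis using s c b lamr_nonneg
      by (simp add: lamr_1 ennreal_mult[symmetric] ennreal_plus[symmetric] del: ennreal_plus)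
  qed
  show thesis
  proof (rule that[of "c * b / 2"])
    show "c * b / 2 > 0" using b c by simp
    show "lamr R s \<ge> lamr R 0 + c * b / 2 * (s - 1)" if "s \<ge> 1" for s
    proof -
      have "c * b / 2 * (s - 1) = ((s - 1) * c * b) / 2" by simp
      thus ?thesis using main[OF that] by linarith
    qed
  qed
qed

lemma lamr_0_pos:
  assumes "R \<ge> 1"
  shows "lamr R 0 > 0"
proof (rule ccontr)
  assume "\<not> lamr R 0 > 0"
  hence "lam R 0 = 0" using lamr_nonneg[of R 0] assms by (simp add: lam_eq)
  hence "AE w in \<mu>. kern R \<i> w * ennreal (Im w powr 0) = 0"
    unfolding lam_def ballint_def by (subst (asm) nn_integral_0_iff_AE) auto
  hence "AE w in \<mu>. kern R \<i> w * ennreal (Im w powr 2) = 0"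
    using AE_upper by eventually_elim (auto simp: upper_iff)
  hence "lam R 2 = 0"
    unfolding lam_def ballint_def by (subst nn_integral_0_iff_AE) auto
  moreover obtain k where "k > 0" "\<And>s. s \<ge> 1 \<Longrightarrow> lamr R s \<ge> lamr R 0 + k * (s - 1)"
    using lamr_lower[OF assms] by blast
  from this(1) this(2)[of 2] have "lamr R 2 > 0" using lamr_nonneg[of R 0] by simp
  ultimately show False by (simp add: lamr_def)
qed

lemma lamr_ge:
  assumes "R \<ge> 1" "s \<ge> 1"
  shows "lamr R s \<ge> lamr R 0"
proof -
  obtain k where k: "k > 0" "\<And>s. s \<ge> 1 \<Longrightarrow> lamr R s \<ge> lamr R 0 + k * (s - 1)"
    using lamr_lower[OF assms(1)] by blast
  have "0 \<le> k * (s - 1)" using k(1) assms by simp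
  thus ?thesis using k(2)[OF assms(2)] by linarith
qed

lemma powr_convex:
  assumes "y > (0 :: real)" "1 \<le> s" "s \<le> 2"
  shows "y powr s \<le> (2 - s) * y + (s - 1) * y powr 2"
proof -
  from convex_onD[OF exp_convex, of "s - 1" "ln y" "2 * ln y"] assms
  have "exp ((2 - s) * ln y + (s - 1) * (2 * ln y)) \<le> (2 - s) * exp (ln y) + (s - 1) * exp (2 * ln y)"
    by simp
  also have "(2 - s) * ln y + (s - 1) * (2 * ln y) = s * ln y" by (simp add: algebra_simps)
  finally show ?thesis using assms by (simp add: powr_def)
qed

lemma lamr_upper:
  assumes R: "R \<ge> 0" and s: "1 \<le> s" "s \<le> 2"
  shows "lamr R s \<le> (2 - s) * lamr R 0 + (s - 1) * lamr R 2"
proof -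
  have "ennreal (lamr R s) \<le> ballint R (\<lambda>w. ennreal (2 - s) * ennreal (Im w powr 1) + ennreal (s - 1) * ennreal (Im w powr 2)) \<i>"
    unfolding lam_eq[OF R, symmetric] lam_def
    using s powr_convex[of _ s]
    by (intro ballint_mono) (auto simp: upper_iff ennreal_mult[symmetric] ennreal_plus[symmetric] simp del: ennreal_plus intro!: ennreal_leI)
  also have "\<dots> = ennreal (2 - s) * lam R 1 + ennreal (s - 1) * lam R 2"
    unfolding lam_def by (simp add: ballint_add ballint_cmult)
  also have "\<dots> = ennreal ((2 - s) * lamr R 0 + (s - 1) * lamr R 2)"
    using s lamr_nonneg[of R] by (simp add: lam_eq[OF R] lamr_1 ennreal_mult ennreal_plus)
  finally show ?thesis using s lamr_nonneg[of R] by (subst (asm) ennreal_le_iff) auto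
qed

lemma lamr_le:
  assumes "R \<ge> 0" "1 \<le> s" "s \<le> 2"
  shows "lamr R s \<le> lamr R 0 + lamr R 2"
proof -
  have "(2 - s) * lamr R 0 \<le> 1 * lamr R 0"
    by (rule mult_right_mono) (use assms lamr_nonneg in auto)
  moreover have "(s - 1) * lamr R 2 \<le> 1 * lamr R 2"
    by (rule mult_right_mono) (use assms lamr_nonneg in auto)
  ultimately show ?thesis using lamr_upper[OF assms] by simp
qed

lemma lamr_tendsto:
  assumes "R \<ge> 1"
  shows "(lamr R \<longlongrightarrow> lamr R 0) (at_right 1)"
proof (rule tendsto_sandwich)
  show "\<forall>\<^sub>F s in at_right 1. lamr R 0 \<le> lamr R s"
    using lamr_ge[OF assms] by (auto simp: eventually_at_right_field intro!: exI[of _ 2])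
  show "\<forall>\<^sub>F s in at_right 1. lamr R s \<le> (2 - s) * lamr R 0 + (s - 1) * lamr R 2"
    using lamr_upper[of R] assms by (auto simp: eventually_at_right_field intro!: exI[of _ 2])
  show "((\<lambda>s. (2 - s) * lamr R 0 + (s - 1) * lamr R 2) \<longlongrightarrow> lamr R 0) (at_right 1)"
    by (auto intro!: tendsto_eq_intros)
qed auto

section \<open>A superharmonic function of the height\<close>

text \<open>
  Up to a constant, the Green function of the Laplacian on functions of the height, with its pole at height 1. The powers
  \<open>y\<^sup>s\<close> and \<open>y\<^sup>1\<^sup>-\<^sup>s\<close> belong to the same eigenvalue.
\<close>

definition gfun :: "real \<Rightarrow> complex \<Rightarrow> ennreal" where
  "gfun s z = ennreal (min (Im z powr s) (Im z powr (1 - s)))"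

text \<open>
  The defect of \<^const>\<open>gfun\<close> in the eigenvalue equation. It is nonnegative by \<open>ballint_gfun_le\<close>, so the subtraction of
  extended reals does not truncate.
\<close>

definition source :: "real \<Rightarrow> real \<Rightarrow> complex \<Rightarrow> ennreal" where
  "source R s z = gfun s z - ennreal (1 / lamr R s) * ballint R (gfun s) z"

text \<open>
  Partial sums of the Neumann series that solves the eigenvalue equation with the given source. They are
  finite sums of images of the source, and this is how bounds for the source reach \<^const>\<open>gfun\<close>.
\<close>

fun gpart :: "real \<Rightarrow> real \<Rightarrow> nat \<Rightarrow> complex \<Rightarrow> ennreal" where
  "gpart R s 0 z = 0"
| "gpart R s (Suc N) z = source R s z + ennreal (1 / lamr R s) * ballint R (gpart R s N) z"

lemma gfun_measurable [measurable]: "gfun s \<in> borel_measurable borel"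
  unfolding gfun_def by measurable

lemma source_measurable [measurable]: "source R s \<in> borel_measurable borel"
  unfolding source_def by measurable

lemma gpart_measurable [measurable]: "gpart R s N \<in> borel_measurable borel"
proof (induction N)
  case 0
  have "gpart R s 0 = (\<lambda>z. 0)" by auto
  thus ?case by simp
next
  case (Suc N)
  note [measurable] = Suc
  have "gpart R s (Suc N) = (\<lambda>z. source R s z + ennreal (1 / lamr R s) * ballint R (gpart R s N) z)" by auto
  thus ?case by simp
qed

lemma gfun_le_1:
  assumes "z \<in> \<H>" "s \<ge> 1"
  shows "gfun s z \<le> 1"
proof -
  have pos: "Im z > 0" using assms by (simp add: upper_iff)
  have "min (Im z powr s) (Im z powr (1 - s)) \<le> 1"
  proof (cases "Im z \<le> 1")
    case True
    have "Im z powr s \<le> 1 powr s" using True pos assms by (intro powr_mono2) auto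
    thus ?thesis by simp
  next
    case False
    have "Im z powr (1 - s) \<le> Im z powr 0" using False pos assms by (intro powr_mono) auto
    thus ?thesis using pos by simp
  qed
  thus ?thesis unfolding gfun_def by (metis ennreal_leI ennreal_1)
qed

lemma gfun_low:
  assumes "z \<in> \<H>" "Im z \<le> 1" "s \<ge> 1"
  shows "gfun s z = ennreal (Im z powr s)"
proof -
  have "Im z powr s \<le> Im z powr (1 - s)"
    using assms by (intro powr_mono') (auto simp: upper_iff)
  thus ?thesis by (simp add: gfun_def)
qed

lemma gfun_high:
  assumes "Im z \<ge> 1" "s \<ge> 1"
  shows "gfun s z = ennreal (Im z powr (1 - s))"
proof -
  have "Im z powr (1 - s) \<le> Im z powr s"
    using assms by (intro powr_mono) auto
  thus ?thesis by (simp add: gfun_def)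
qed

lemma gfun_cmult_lam:
  assumes "R \<ge> 0"
  shows "ennreal (lamr R s) * gfun s z = ennreal (min (lamr R s * Im z powr s) (lamr R s * Im z powr (1 - s)))"
  using assms lamr_nonneg[of R s]
  by (simp add: gfun_def ennreal_mult[symmetric] min_mult_distrib_left)

text \<open>
  A minimum of two positive eigenfunctions with a common eigenvalue is superharmonic.
\<close>

lemma ballint_gfun_le:
  assumes "z \<in> \<H>" "R \<ge> 0"
  shows "ballint R (gfun s) z \<le> ennreal (lamr R s) * gfun s z"
proof -
  have "ballint R (gfun s) z \<le> ballint R (\<lambda>w. ennreal (Im w powr s)) z"
    by (rule ballint_mono) (auto simp: gfun_def intro!: ennreal_leI)
  moreover have "ballint R (gfun s) z \<le> ballint R (\<lambda>w. ennreal (Im w powr (1 - s))) z"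
    by (rule ballint_mono) (auto simp: gfun_def intro!: ennreal_leI)
  ultimately show ?thesis
    using assms lamr_nonneg[of R s]
    by (auto simp: ballint_powr lam_symmetric lam_eq gfun_cmult_lam ennreal_mult[symmetric] min_def)
qed

lemma ballint_gfun_eq:
  assumes z: "z \<in> \<H>" and R: "R \<ge> 0" and s: "s \<ge> 1"
    and far: "Im z < 1 / (R + 2) \<or> Im z > R + 2"
  shows "ballint R (gfun s) z = ennreal (lamr R s) * gfun s z"
  using far
proof
  assume low: "Im z < 1 / (R + 2)"
  hence low': "(R + 2) * Im z < 1" using R by (simp add: field_simps)
  have "Im z \<le> (R + 2) * Im z" using R z by (simp add: upper_iff)
  hence "Im z \<le> 1" using low' by linarith
  have "ballint R (gfun s) z = ballint R (\<lambda>w. ennreal (Im w powr s)) z"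
  proof (rule ballint_cong)
    fix w assume w: "w \<in> \<H>" "near R z w"
    show "gfun s w = ennreal (Im w powr s)"
      using near_Im[OF w(2) z w(1) R] low' by (intro gfun_low w s) linarith
  qed
  thus ?thesis using gfun_low[OF z \<open>Im z \<le> 1\<close> s] R z by (simp add: ballint_powr lam_eq)
next
  assume high: "Im z > R + 2"
  hence high': "Im z / (R + 2) > 1" using R by (simp add: field_simps)
  have "Im z \<ge> 1" using R high by linarith
  have "ballint R (gfun s) z = ballint R (\<lambda>w. ennreal (Im w powr (1 - s))) z"
  proof (rule ballint_cong)
    fix w assume w: "w \<in> \<H>" "near R z w"
    show "gfun s w = ennreal (Im w powr (1 - s))"
      using near_Im_lower[OF w(2) z w(1) R] high' by (intro gfun_high s) linarith
  qed
  thus ?thesis using gfun_high[OF \<open>Im z \<ge> 1\<close> s] R z by (simp add: ballint_powr lam_eq lam_symmetric)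
qed

lemma lamr_pos: "R \<ge> 1 \<Longrightarrow> s \<ge> 1 \<Longrightarrow> lamr R s > 0"
  using lamr_ge[of R s] lamr_0_pos[of R] by linarith

lemma lamr_inverse_cancel:
  assumes "R \<ge> 1" "s \<ge> 1"
  shows "ennreal (1 / lamr R s) * (ennreal (lamr R s) * x) = x"
proof -
  have "ennreal (1 / lamr R s) * ennreal (lamr R s) = 1"
    using lamr_pos[OF assms] by (simp flip: ennreal_mult)
  thus ?thesis by (simp flip: mult.assoc)
qed

lemma ballint_gfun_normalized_le:
  assumes "z \<in> \<H>" "R \<ge> 1" "s \<ge> 1"
  shows "ennreal (1 / lamr R s) * ballint R (gfun s) z \<le> gfun s z"
proof -
  have "ennreal (1 / lamr R s) * ballint R (gfun s) z \<le> ennreal (1 / lamr R s) * (ennreal (lamr R s) * gfun s z)"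
    using ballint_gfun_le[of z R s] assms by (intro mult_left_mono) auto
  thus ?thesis by (simp only: lamr_inverse_cancel[OF assms(2,3)])
qed

lemma gfun_eq_source:
  assumes "z \<in> \<H>" "R \<ge> 1" "s \<ge> 1"
  shows "gfun s z = source R s z + ennreal (1 / lamr R s) * ballint R (gfun s) z"
  unfolding source_def using ballint_gfun_normalized_le[OF assms]
  by (simp add: diff_add_cancel_ennreal)

text \<open>Away from height 1 the function \<^const>\<open>gfun\<close> is locally an eigenfunction, so the defect is concentrated there.\<close>

lemma source_le:
  assumes "z \<in> \<H>" "R \<ge> 1" "s \<ge> 1"
  shows "source R s z \<le> indicator {z. 1 / (R + 2) \<le> Im z \<and> Im z \<le> R + 2} z"
proof (cases "1 / (R + 2) \<le> Im z \<and> Im z \<le> R + 2")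
  case True
  have "source R s z \<le> gfun s z" unfolding source_def by (rule diff_le_self_ennreal)
  also have "\<dots> \<le> 1" using assms by (intro gfun_le_1)
  finally show ?thesis using True by simp
next
  case False
  hence "ballint R (gfun s) z = ennreal (lamr R s) * gfun s z"
    using assms by (intro ballint_gfun_eq) auto
  hence "source R s z = gfun s z - gfun s z"
    unfolding source_def by (simp only: lamr_inverse_cancel[OF assms(2,3)])
  also have "\<dots> = 0" by (simp add: gfun_def)
  finally show ?thesis by simp
qed

lemma gpart_le:
  assumes "z \<in> \<H>" "R \<ge> 1" "s \<ge> 1"
  shows "gpart R s N z \<le> gfun s z"
  using assms(1)
proof (induction N arbitrary: z)
  case (Suc N)
  have "gpart R s (Suc N) z \<le> source R s z + ennreal (1 / lamr R s) * ballint R (gfun s) z"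
    using Suc.IH by (simp add: ballint_mono mult_left_mono add_left_mono)
  thus ?case using gfun_eq_source[OF Suc.prems assms(2,3)] by simp
qed auto

lemma gpart_incseq: "incseq (\<lambda>N. gpart R s N z)"
proof (rule incseq_SucI)
  show "gpart R s N z \<le> gpart R s (Suc N) z" for N
  proof (induction N arbitrary: z)
    case (Suc N)
    have "ballint R (gpart R s N) z \<le> ballint R (gpart R s (Suc N)) z"
      using Suc.IH by (intro ballint_mono) auto
    thus ?case by (simp add: mult_left_mono add_left_mono)
  qed auto
qed

text \<open>
  Since \<^const>\<open>gfun\<close> is at most 1 and the operator multiplies constants by \<open>\<lambda>(1)\<close>, the remainder after \<open>N\<close> steps
  is at most \<open>(\<lambda>(1) / \<lambda>(s))\<^sup>N\<close>.
\<close>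

lemma gfun_le_gpart:
  assumes "z \<in> \<H>" "R \<ge> 1" "s \<ge> 1"
  shows "gfun s z \<le> gpart R s N z + ennreal ((lamr R 0 / lamr R s) ^ N)"
  using assms(1)
proof (induction N arbitrary: z)
  case 0
  thus ?case using gfun_le_1[of z s] assms by simp
next
  case (Suc N)
  let ?q = "lamr R 0 / lamr R s"
  have q: "?q \<ge> 0" by (simp add: lamr_nonneg)
  have "ballint R (gfun s) z \<le> ballint R (\<lambda>w. gpart R s N w + ennreal (?q ^ N) * 1) z"
    using Suc.IH by (intro ballint_mono) auto
  also have "\<dots> = ballint R (gpart R s N) z + ballint R (\<lambda>w. ennreal (?q ^ N) * 1) z"
    by (rule ballint_add) auto
  also have "ballint R (\<lambda>w. ennreal (?q ^ N) * 1) z = ennreal (?q ^ N) * ballint R (\<lambda>w. 1) z"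
    by (rule ballint_cmult) auto
  also have "ballint R (\<lambda>w. 1) z = ennreal (lamr R 0)"
    using Suc.prems assms by (simp add: lam_0 lam_eq)
  finally have "gfun s z \<le> source R s z + ennreal (1 / lamr R s) * (ballint R (gpart R s N) z + ennreal (?q ^ N) * ennreal (lamr R 0))"
    using gfun_eq_source[OF Suc.prems assms(2,3)] by (simp add: mult_left_mono add_left_mono)
  also have "\<dots> = gpart R s (Suc N) z + ennreal (1 / lamr R s) * (ennreal (?q ^ N) * ennreal (lamr R 0))"
    by (simp add: distrib_left add.assoc)
  also have "ennreal (1 / lamr R s) * (ennreal (?q ^ N) * ennreal (lamr R 0)) = ennreal (?q ^ Suc N)"
    using q by (simp add: lamr_nonneg mult_ac flip: ennreal_mult)
  finally show ?case .
qed

lemma gfun_eq_SUP: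
  assumes "z \<in> \<H>" "R \<ge> 1" "s > 1"
  shows "gfun s z = (SUP N. gpart R s N z)"
proof (rule antisym)
  show "(SUP N. gpart R s N z) \<le> gfun s z"
    using gpart_le[of z R s] assms by (intro SUP_least) auto
  show "gfun s z \<le> (SUP N. gpart R s N z)"
  proof (rule ennreal_le_epsilon)
    fix e :: real assume e: "e > 0"
    obtain k where k: "k > 0" "\<And>s. s \<ge> 1 \<Longrightarrow> lamr R s \<ge> lamr R 0 + k * (s - 1)"
      using lamr_lower[OF assms(2)] by blast
    have "0 < k * (s - 1)" using k(1) assms by simp
    hence "lamr R 0 < lamr R s" using k(2)[of s] assms by linarith
    hence "lamr R 0 / lamr R s < 1" using lamr_pos[of R s] assms by simp
    then obtain N where N: "(lamr R 0 / lamr R s) ^ N < e"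
      using real_arch_pow_inv[OF e] by blast
    have "gfun s z \<le> gpart R s N z + ennreal ((lamr R 0 / lamr R s) ^ N)"
      using assms by (intro gfun_le_gpart) auto
    also have "\<dots> \<le> (SUP N. gpart R s N z) + ennreal e"
      using N by (intro add_mono SUP_upper ennreal_leI) auto
    finally show "gfun s z \<le> (SUP N. gpart R s N z) + ennreal e" .
  qed
qed

definition periodic :: "(complex \<Rightarrow> ennreal) \<Rightarrow> bool" where
  "periodic f \<longleftrightarrow> (\<forall>z\<in>\<H>. \<forall>n :: int. f (z + of_int n) = f z)"

lemma periodic_gfun: "periodic (gfun s)"
  by (simp add: periodic_def gfun_def)

definition shift :: "int \<Rightarrow> mat2" where
  "shift n = mat2 1 (of_int n) 0 1"

lemma shift_nth [simp]:
  "shift n $ 1 $ 1 = 1" "shift n $ 1 $ 2 = of_int n" "shift n $ 2 $ 1 = 0" "shift n $ 2 $ 2 = 1"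
  by (simp_all add: shift_def)

lemma shift_SL2 [simp]: "shift n \<in> SL2"
  by (simp add: SL2_iff)

lemma act_shift: "act (shift n) z = z + of_int n"
  by (simp add: act_altdef den_def)

lemma periodic_ballint:
  assumes "periodic f" and [measurable]: "f \<in> borel_measurable borel"
  shows "periodic (ballint R f)"
  unfolding periodic_def
proof (intro ballI allI)
  fix z n assume z: "z \<in> \<H>"
  have "ballint R f (z + of_int n) = ballint R (\<lambda>w. f (act (shift n) w)) z"
    by (subst ballint_act) (auto simp: z act_shift)
  also have "\<dots> = ballint R f z"
    using assms(1) by (intro ballint_cong) (auto simp: act_shift periodic_def)
  finally show "ballint R f (z + of_int n) = ballint R f z" .
qed

lemma periodic_source: "periodic (source R s)"
  using periodic_ballint[OF periodic_gfun, of s R] periodic_gfun[of s]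
  by (simp add: periodic_def source_def)

lemma periodic_gpart: "periodic (gpart R s N)"
proof (induction N)
  case 0
  thus ?case by (simp add: periodic_def)
next
  case (Suc N)
  thus ?case using periodic_ballint[OF Suc gpart_measurable, of R] periodic_source[of R s]
    by (simp add: periodic_def)
qed

section \<open>Discrete groups containing the integral translations\<close>

locale cusp_group =
  fixes \<Gamma> :: "mat2 set"
  assumes subgroup: "subgroup \<Gamma> SL2R"
    and discrete: "discrete \<Gamma>"
    and minus_one: "- mat 1 \<in> \<Gamma>"
    and shifts: "\<Lambda>\<^sub>0 \<subseteq> \<Gamma>"
begin

lemma in_SL2: "A \<in> \<Gamma> \<Longrightarrow> A \<in> SL2"
  using subgroup.subset[OF subgroup] by blast

lemma mult_closed: "A \<in> \<Gamma> \<Longrightarrow> B \<in> \<Gamma> \<Longrightarrow> A ** B \<in> \<Gamma>"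
  using subgroup.m_closed[OF subgroup] by (simp add: SL2R_def)

lemma adj_closed: "A \<in> \<Gamma> \<Longrightarrow> adj A \<in> \<Gamma>"
  using subgroup.m_inv_closed[OF subgroup, of A] inv_SL2R[of A] in_SL2[of A] by (simp add: adj_def)

lemma one_closed: "mat 1 \<in> \<Gamma>"
  using subgroup.one_closed[OF subgroup] by (simp add: SL2R_def)

lemma shift_closed: "shift n \<in> \<Gamma>"
  using shifts by (auto simp: \<Lambda>\<^sub>0_def shift_def)

lemma uminus_closed:
  assumes "A \<in> \<Gamma>"
  shows "- A \<in> \<Gamma>"
proof -
  have "- A = - mat 1 ** A" by (rule mat2_eqI) (simp_all add: mult_nth)
  thus ?thesis using mult_closed[OF minus_one assms] by simp
qed

lemma bij_adj: "bij_betw adj \<Gamma> \<Gamma>"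
  by (rule bij_betw_byWitness[where f' = adj]) (auto intro: adj_closed)

lemma bij_mult_right:
  assumes "B \<in> \<Gamma>"
  shows "bij_betw (\<lambda>A. A ** B) \<Gamma> \<Gamma>"
proof (rule bij_betw_byWitness[where f' = "\<lambda>A. A ** adj B"])
  show "(\<lambda>A. A ** B) ` \<Gamma> \<subseteq> \<Gamma>" "(\<lambda>A. A ** adj B) ` \<Gamma> \<subseteq> \<Gamma>"
    using assms by (auto intro: mult_closed adj_closed)
qed (use mult_adj[OF in_SL2[OF assms]] in \<open>auto simp: matrix_mul_assoc[symmetric]\<close>)

text \<open>
  A bounded infinite set contains distinct elements \<open>A\<close> and \<open>A'\<close> that are arbitrarily close; then \<open>A\<^sup>-\<^sup>1 A'\<close> is close to, but
  different from, the identity.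
\<close>

lemma finite_bounded: "finite {A \<in> \<Gamma>. \<forall>i j. \<bar>A $ i $ j\<bar> \<le> c}" (is "finite ?X")
proof (rule ccontr)
  assume inf: "infinite ?X"
  have entry: "\<bar>A $ i $ j\<bar> \<le> norm A" for A :: mat2 and i j
    using component_le_norm_cart[of "A $ i" j] Finite_Cartesian_Product.norm_nth_le[of A i] by linarith
  have norm_le: "norm A \<le> 4 * e" if "\<And>i j. \<bar>A $ i $ j\<bar> \<le> e" for A :: mat2 and e
  proof -
    have "norm (A $ i) \<le> 2 * e" for i
      using norm_le_l1_cart[of "A $ i"] that[of i 1] that[of i 2] by (simp add: sum_2)
    moreover have "norm A \<le> norm (A $ 1) + norm (A $ 2)"
      unfolding norm_vec_def[of A] using L2_set_le_sum[of UNIV "\<lambda>i. norm (A $ i)"] by (simp add: sum_2)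
    ultimately show ?thesis by (smt (verit))
  qed
  have "bounded ?X"
    unfolding bounded_iff by (intro exI[of _ "4 * c"] ballI norm_le) auto
  then obtain l where l: "l islimpt ?X"
    using inf bounded_infinite_imp_islimpt[OF order_refl] by blast
  obtain A0 where "A0 \<in> ?X" using infinite_imp_nonempty[OF inf] by blast
  hence "\<bar>A0 $ 1 $ 1\<bar> \<le> c" by blast
  hence c: "c \<ge> 0" by linarith
  have "mat 1 isolated_in \<Gamma>" using discrete one_closed by (simp add: discrete_def)
  then obtain e where e: "e > 0" "\<And>B. B \<in> \<Gamma> \<Longrightarrow> dist (mat 1) B < e \<Longrightarrow> B = mat 1"
    unfolding isolated_in_dist_Ex_iff by blast
  \<comment> \<open>Entries of a product of two matrices are sums of two terms, and the norm is at most four times the largest entry; together with the distance \<open>2 d\<close> between \<open>A\<close> and \<open>A'\<close> this makes 16.\<close>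
  define d where "d = e / (16 * (c + 1))"
  have d: "d > 0" using e(1) c by (simp add: d_def)
  obtain A where A: "A \<in> ?X" "A \<noteq> l" "dist A l < d"
    using l d unfolding islimpt_approachable by blast
  have "min d (dist A l) > 0" using d A(2) by simp
  then obtain A' where A': "A' \<in> ?X" "A' \<noteq> l" "dist A' l < min d (dist A l)"
    using l unfolding islimpt_approachable by blast
  have "A' \<noteq> A" using A' by auto
  have D: "norm (A' - A) \<le> 2 * d"
    using dist_triangle2[of A' A l] A A' by (simp add: dist_norm)
  have "\<bar>(adj A ** A' - mat 1) $ i $ j\<bar> \<le> 2 * (c * (2 * d))" for i j
  proof -
    have "adj A ** A' - mat 1 = adj A ** A' - adj A ** A"
      using A(1) by (simp add: mult_adj in_SL2)
    also have "\<dots> = adj A ** (A' - A)"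
      by (rule mat2_eqI) (simp_all add: mult_nth algebra_simps)
    finally have eq: "adj A ** A' - mat 1 = adj A ** (A' - A)" .
    hence "\<bar>(adj A ** A' - mat 1) $ i $ j\<bar> \<le> \<bar>adj A $ i $ 1 * (A' - A) $ 1 $ j\<bar> + \<bar>adj A $ i $ 2 * (A' - A) $ 2 $ j\<bar>"
      by (simp only: mult_nth abs_triangle_ineq)
    also have "\<dots> \<le> c * (2 * d) + c * (2 * d)"
    proof -
      have "\<forall>i j. \<bar>adj A $ i $ j\<bar> \<le> c" using A(1) by (simp add: forall_2)
      moreover have "\<bar>(A' - A) $ i $ j\<bar> \<le> 2 * d" for i j using entry[of "A' - A" i j] D by linarith
      ultimately show ?thesis unfolding abs_mult using c by (intro add_mono mult_mono) auto
    qed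
    finally show ?thesis by simp
  qed
  from norm_le[OF this] have "norm (adj A ** A' - mat 1) \<le> 16 * (c * d)" by simp
  also have "\<dots> < 16 * ((c + 1) * d)" using d by simp
  also have "\<dots> = e" using c by (simp add: d_def field_simps)
  finally have "dist (mat 1) (adj A ** A') < e" by (simp add: dist_norm norm_minus_commute)
  moreover have "adj A ** A' \<in> \<Gamma>" using A(1) A'(1) by (auto intro: mult_closed adj_closed)
  ultimately have "adj A ** A' = mat 1" using e(2) by blast
  hence "A ** (adj A ** A') = A" by simp
  hence "A' = A" using A(1) by (simp add: matrix_mul_assoc mult_adj in_SL2)
  thus False using \<open>A' \<noteq> A\<close> by simp
qed

lemma countable: "countable \<Gamma>"
proof -
  have "\<Gamma> \<subseteq> (\<Union>n::nat. {A \<in> \<Gamma>. \<forall>i j. \<bar>A $ i $ j\<bar> \<le> real n})"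
  proof
    fix A assume A: "A \<in> \<Gamma>"
    obtain n :: nat where "\<bar>A $ 1 $ 1\<bar> + \<bar>A $ 1 $ 2\<bar> + \<bar>A $ 2 $ 1\<bar> + \<bar>A $ 2 $ 2\<bar> \<le> real n"
      using real_arch_simple by blast
    hence "\<forall>i j. \<bar>A $ i $ j\<bar> \<le> real n" unfolding forall_2 by linarith
    thus "A \<in> (\<Union>n::nat. {A \<in> \<Gamma>. \<forall>i j. \<bar>A $ i $ j\<bar> \<le> real n})" using A by blast
  qed
  moreover have "countable (\<Union>n::nat. {A \<in> \<Gamma>. \<forall>i j. \<bar>A $ i $ j\<bar> \<le> real n})"
    by (rule countable_UN) (auto intro: countable_finite finite_bounded)
  ultimately show ?thesis by (rule countable_subset)
qed

text \<open>
  Proper discontinuity. The quotient of the heights of \<open>z\<close> and \<open>A z\<close> is \<open>\<bar>c z + d\<bar>\<^sup>2\<close>, so it bounds the lower row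
  of \<open>A\<close>; the upper row is then bounded because \<open>a z + b = A z \<cdot> (c z + d)\<close>.
\<close>

lemma finite_returns:
  assumes "c > 0"
  shows "finite {A \<in> \<Gamma>. \<exists>z\<in>rect a c. act A z \<in> rect a c}"
proof (rule finite_subset[OF _ finite_bounded])
  define C where "C = c * c + (c + c * c * a) + (a + c) * c * c + ((a + c) * c + (a + c) * c * c * a)"
  show "{A \<in> \<Gamma>. \<exists>z\<in>rect a c. act A z \<in> rect a c} \<subseteq> {A \<in> \<Gamma>. \<forall>i j. \<bar>A $ i $ j\<bar> \<le> C}"
  proof
    fix A assume "A \<in> {A \<in> \<Gamma>. \<exists>z\<in>rect a c. act A z \<in> rect a c}"
    then obtain z where A: "A \<in> \<Gamma>" and z: "z \<in> rect a c" and Az: "act A z \<in> rect a c" by blast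
    define w where "w = act A z"
    have zH: "z \<in> \<H>" using rect_upper[OF assms] z by blast
    have S: "A \<in> SL2" using A by (rule in_SL2)
    have a: "a \<ge> 0" using z by (auto simp: rect_def)
    have y: "Im z > 0" using zH by (simp add: upper_iff)
    have c1: "1 \<le> c * Im z" using z assms by (simp add: rect_def field_simps)
    have c2: "1 \<le> c * Im w" using Az assms by (simp add: w_def rect_def field_simps)
    have divide: "x \<le> b * c" if "x * Im z \<le> b" "x \<ge> 0" "b \<ge> 0" for x b
    proof -
      have "x * 1 \<le> x * (c * Im z)" using c1 that by (intro mult_left_mono) auto
      also have "\<dots> = c * (x * Im z)" by simp
      also have "\<dots> \<le> c * b" using that assms by (intro mult_left_mono) auto
      finally show ?thesis by (simp add: mult.commute)
    qed
    define p q r s where "p = A$1$1" "q = A$1$2" "r = A$2$1" "s = A$2$2"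
    have nz: "den A z \<noteq> 0" by (rule den_nonzero[OF S zH])
    have "(cmod (den A z))\<^sup>2 * Im w = Im z" using nz by (simp add: w_def Im_act[OF S zH])
    moreover have "(cmod (den A z))\<^sup>2 * 1 \<le> (cmod (den A z))\<^sup>2 * (c * Im w)"
      using c2 by (intro mult_left_mono) auto
    ultimately have "(cmod (den A z))\<^sup>2 \<le> c * Im z" by (simp add: mult_ac)
    also have "\<dots> \<le> c * c" using z assms by (intro mult_left_mono) (auto simp: rect_def)
    finally have "(cmod (den A z))\<^sup>2 \<le> c\<^sup>2" by (simp add: power2_eq_square)
    hence den: "cmod (den A z) \<le> c" by (rule power2_le_imp_le) (use assms in simp)
    have "\<bar>r\<bar> * Im z = \<bar>Im (den A z)\<bar>" using y by (simp add: den_def p_q_r_s_def abs_mult)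
    also have "\<dots> \<le> c" using abs_Im_le_cmod[of "den A z"] den by linarith
    finally have r: "\<bar>r\<bar> \<le> c * c" by (rule divide) (use assms in auto)
    have "s = Re (den A z) - r * Re z" by (simp add: den_def p_q_r_s_def)
    hence "\<bar>s\<bar> \<le> \<bar>Re (den A z)\<bar> + \<bar>r\<bar> * \<bar>Re z\<bar>" by (simp add: abs_mult[symmetric])
    also have "\<dots> \<le> c + (c * c) * a"
      using abs_Re_le_cmod[of "den A z"] den r z assms by (intro add_mono mult_mono) (auto simp: rect_def)
    finally have s: "\<bar>s\<bar> \<le> c + c * c * a" .
    define N where "N = w * den A z"
    have N: "N = of_real p * z + of_real q" using nz by (simp add: N_def w_def act_altdef p_q_r_s_def)
    have "cmod w \<le> a + c"
    proof -
      have "Im w > 0" using act_upper[OF S zH] by (simp add: w_def upper_iff)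
      thus ?thesis using cmod_le[of w] Az by (auto simp: rect_def w_def)
    qed
    hence normN: "cmod N \<le> (a + c) * c" unfolding N_def norm_mult using den a assms by (intro mult_mono) auto
    have "\<bar>p\<bar> * Im z = \<bar>Im N\<bar>" using y by (simp add: N abs_mult)
    also have "\<dots> \<le> (a + c) * c" using abs_Im_le_cmod[of N] normN by linarith
    finally have p: "\<bar>p\<bar> \<le> (a + c) * c * c" by (rule divide) (use a assms in auto)
    have "q = Re N - p * Re z" by (simp add: N)
    hence "\<bar>q\<bar> \<le> \<bar>Re N\<bar> + \<bar>p\<bar> * \<bar>Re z\<bar>" by (simp add: abs_mult[symmetric])
    also have "\<dots> \<le> (a + c) * c + ((a + c) * c * c) * a"
      using abs_Re_le_cmod[of N] normN p z assms a by (intro add_mono mult_mono) (auto simp: rect_def)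
    finally have q: "\<bar>q\<bar> \<le> (a + c) * c + (a + c) * c * c * a" .
    have nn: "c * c \<ge> 0" "c + c * c * a \<ge> 0" "(a + c) * c * c \<ge> 0" "(a + c) * c + (a + c) * c * c * a \<ge> 0"
      using a assms by auto
    have "\<forall>i j. \<bar>A $ i $ j\<bar> \<le> C"
      using p q r s nn unfolding forall_2 C_def p_q_r_s_def by (intro conjI) linarith+
    thus "A \<in> {A \<in> \<Gamma>. \<forall>i j. \<bar>A $ i $ j\<bar> \<le> C}" using A by blast
  qed
qed

lemma finite_near:
  assumes "z \<in> \<H>" "w \<in> \<H>" "R \<ge> 0"
  shows "finite {A \<in> \<Gamma>. near R w (act A z)}"
proof -
  obtain a c where ac: "c > 0" "\<And>x. x \<in> \<H> \<Longrightarrow> near R w x \<Longrightarrow> x \<in> rect a c"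
    by (rule near_rect[OF assms(2,3)]) (rule that)
  define a' where "a' = max a \<bar>Re z\<bar>"
  define c' where "c' = max c (max (Im z) (1 / Im z))"
  have y: "Im z > 0" using assms by (simp add: upper_iff)
  have c': "c' > 0" "c \<le> c'" using ac(1) by (auto simp: c'_def)
  have "1 / c' \<le> Im z"
  proof -
    have "1 / Im z \<le> c'" by (simp add: c'_def)
    thus ?thesis using y c' by (simp add: field_simps)
  qed
  hence z: "z \<in> rect a' c'" by (auto simp: rect_def a'_def c'_def)
  have sub: "rect a c \<subseteq> rect a' c'" by (rule rect_mono) (use ac c' in \<open>auto simp: a'_def\<close>)
  show ?thesis
  proof (rule finite_subset[OF _ finite_returns[OF c'(1), of a']])
    show "{A \<in> \<Gamma>. near R w (act A z)} \<subseteq> {A \<in> \<Gamma>. \<exists>z\<in>rect a' c'. act A z \<in> rect a' c'}"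
    proof
      fix A assume A: "A \<in> {A \<in> \<Gamma>. near R w (act A z)}"
      hence "act A z \<in> rect a c" using in_SL2 by (auto intro!: ac(2) act_upper assms)
      hence "act A z \<in> rect a' c'" using sub by blast
      thus "A \<in> {A \<in> \<Gamma>. \<exists>z\<in>rect a' c'. act A z \<in> rect a' c'}" using A z by auto
    qed
  qed
qed

text \<open>
  A fixed point is a root of \<open>c z\<^sup>2 + (d - a) z - b\<close>, a polynomial with real coefficients that vanishes only for \<open>A = \<plusminus>1\<close> and otherwise
  has at most one root in the upper half-plane; and the group is countable.
\<close>

lemma AE_trivial_stabilizer:
  "AE z in \<mu>. \<forall>A\<in>\<Gamma>. act A z = z \<longrightarrow> A = mat 1 \<or> A = - mat 1"
proof -
  have fin: "countable {z \<in> \<H>. act A z = z}" if A: "A \<in> SL2" "A \<noteq> mat 1" "A \<noteq> - mat 1" for A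
  proof -
    define a b c d where "a = A$1$1" "b = A$1$2" "c = A$2$1" "d = A$2$2"
    have det: "a * d - b * c = 1" using A(1) by (simp add: a_b_c_d_def SL2_iff)
    have fixed: "2 * c * Re z = a - d \<and> c * ((Re z)\<^sup>2 - (Im z)\<^sup>2) + (d - a) * Re z = b" if "z \<in> \<H>" "act A z = z" for z
    proof -
      have "of_real a * z + of_real b = z * (of_real c * z + of_real d)"
        using that den_nonzero[OF A(1) that(1)] by (simp add: act_altdef den_def a_b_c_d_def field_simps)
      hence "Re (of_real a * z + of_real b) = Re (z * (of_real c * z + of_real d))"
        "Im (of_real a * z + of_real b) = Im (z * (of_real c * z + of_real d))" by simp_all
      hence 1: "a * Re z + b = c * ((Re z)\<^sup>2 - (Im z)\<^sup>2) + d * Re z"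
        and 2: "Im z * (2 * c * Re z + d - a) = 0"
        by (simp_all add: algebra_simps power2_eq_square)
      from 2 have "2 * c * Re z + d - a = 0" using that(1) by (simp add: upper_iff)
      thus ?thesis using 1 by (simp add: algebra_simps)
    qed
    have "z = w" if zw: "z \<in> \<H>" "act A z = z" "w \<in> \<H>" "act A w = w" for z w
    proof (cases "c = 0")
      case True
      from fixed[OF zw(1,2)] True have "a = d" "b = 0" by auto
      hence "a * a = 1" using det True by simp
      hence "a = 1 \<or> a = -1" by (simp add: square_eq_1_iff)
      hence False using A \<open>a = d\<close> \<open>b = 0\<close> True
        by (auto simp: a_b_c_d_def intro!: mat2_eqI)
      thus ?thesis ..
    next
      case False
      from fixed[OF zw(1,2)] fixed[OF zw(3,4)] have "2 * c * Re z = 2 * c * Re w" by simp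
      hence re: "Re z = Re w" using False by simp
      from fixed[OF zw(1,2)] fixed[OF zw(3,4)]
      have "c * ((Re z)\<^sup>2 - (Im z)\<^sup>2) = c * ((Re z)\<^sup>2 - (Im w)\<^sup>2)" unfolding re by linarith
      hence "(Im z)\<^sup>2 = (Im w)\<^sup>2" using False by simp
      hence "Im z = Im w" using zw by (simp add: upper_iff power2_eq_iff)
      thus ?thesis using re by (simp add: complex_eq_iff)
    qed
    then obtain x where "{z \<in> \<H>. act A z = z} \<subseteq> {x}" by blast
    thus ?thesis by (rule countable_subset) simp
  qed
  define X where "X = (\<Union>A\<in>\<Gamma> - {mat 1, - mat 1}. {z \<in> \<H>. act A z = z})"
  have "countable X"
    unfolding X_def using countable fin in_SL2 by (intro countable_UN) auto
  hence "AE z in lborel. z \<notin> X"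
    by (intro AE_not_in countable_imp_null_set_lborel)
  hence "AE z in \<mu>. z \<notin> X"
    unfolding poincare_measure_def by (subst AE_density) (auto elim: eventually_mono)
  thus ?thesis using AE_upper by eventually_elim (auto simp: X_def)
qed

subsection \<open>Existence of fundamental sets\<close>

text \<open>
  Among the finitely many points of an orbit that are closest to \<open>i\<close>, single out the one whose pair
  of coordinates is lexicographically least. The set of the points singled out is Borel because the group is
  countable.
\<close>

definition before :: "complex \<Rightarrow> complex \<Rightarrow> bool" where
  "before z w \<longleftrightarrow> (let k = \<lambda>z. (cmod (z - \<i>))\<^sup>2 / Im z in
     k z < k w \<or> k z = k w \<and> (Re z < Re w \<or> Re z = Re w \<and> Im z \<le> Im w))"

lemma before_antisym: "before z w \<Longrightarrow> before w z \<Longrightarrow> z = w"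
  by (auto simp: before_def Let_def complex_eq_iff)

lemma fundamental_set_exists: "\<exists>F. fundamental_set \<Gamma> F"
proof
  let ?F = "{z \<in> \<H>. \<forall>A\<in>\<Gamma>. before z (act A z)}"
  have [measurable]: "Measurable.pred borel (\<lambda>z. before z (act A z))" for A
    unfolding before_def Let_def by measurable
  have [simp]: "countable \<Gamma>" by (rule countable)
  have "?F \<in> sets borel" by measurable
  moreover have "\<exists>!w. w \<in> ?F \<and> (\<exists>A\<in>\<Gamma>. w = act A z)" if z: "z \<in> \<H>" for z
  proof (rule ex_ex1I)
    define k where "k = (\<lambda>z. (cmod (z - \<i>))\<^sup>2 / Im z)"
    define O1 where "O1 = (\<lambda>A. act A z) ` {A \<in> \<Gamma>. near (k z) \<i> (act A z)}"
    have kz: "k z \<ge> 0" using z by (simp add: k_def upper_iff)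
    have near_k: "near (k z) \<i> w \<longleftrightarrow> k w \<le> k z" if "w \<in> \<H>" for w
      using that by (simp add: near_def k_def upper_iff norm_minus_commute pos_divide_le_eq)
    have fin1: "finite O1" unfolding O1_def using finite_near[OF z i_upper kz] by simp
    have mem1: "z \<in> O1" unfolding O1_def
      using one_closed near_k[OF z] by (intro image_eqI[of _ _ "mat 1"]) auto
    define O2 where "O2 = {w \<in> O1. k w = Min (k ` O1)}"
    have "Min (k ` O1) \<in> k ` O1" using fin1 mem1 by (intro Min_in) auto
    hence ne2: "O2 \<noteq> {}" by (auto simp: O2_def)
    have fin2: "finite O2" using fin1 by (simp add: O2_def)
    define O3 where "O3 = {w \<in> O2. Re w = Min (Re ` O2)}"
    have "Min (Re ` O2) \<in> Re ` O2" using fin2 ne2 by (intro Min_in) auto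
    hence ne3: "O3 \<noteq> {}" by (auto simp: O3_def)
    have fin3: "finite O3" using fin2 by (simp add: O3_def)
    have "Min (Im ` O3) \<in> Im ` O3" using fin3 ne3 by (intro Min_in) auto
    then obtain w where w: "w \<in> O3" "Im w = Min (Im ` O3)" by auto
    have w2: "w \<in> O2" "Re w = Min (Re ` O2)" using w(1) by (auto simp: O3_def)
    have w1: "w \<in> O1" "k w = Min (k ` O1)" using w2(1) by (auto simp: O2_def)
    obtain B where B: "B \<in> \<Gamma>" "w = act B z" using w1(1) by (auto simp: O1_def)
    have wH: "w \<in> \<H>" using B in_SL2 act_upper z by blast
    have "before w (act A w)" if A: "A \<in> \<Gamma>" for A
    proof -
      have v: "act A w = act (A ** B) z" "A ** B \<in> \<Gamma>"
        using A B z by (auto simp: act_mult in_SL2 mult_closed)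
      have vH: "act A w \<in> \<H>" using A wH in_SL2 act_upper by blast
      define v where "v = act A w"
      have v1: "v \<in> O1" if "k v \<le> k w"
      proof -
        have "k w \<le> k z" using w1(2) fin1 mem1 by simp
        hence "near (k z) \<i> v" using that near_k[OF vH] by (simp add: v_def)
        thus ?thesis unfolding O1_def v_def using v by auto
      qed
      have v2: "v \<in> O2" if "k v = k w" using v1 that w1(2) by (auto simp: O2_def)
      have v3: "v \<in> O3" if "k v = k w" "Re v = Re w" using v2 that w2(2) by (auto simp: O3_def)
      have "k w \<le> k v"
      proof (rule ccontr)
        assume "\<not> k w \<le> k v"
        hence "v \<in> O1" using v1 by simp
        thus False using \<open>\<not> k w \<le> k v\<close> w1(2) fin1 by simp
      qed
      moreover have r: "Re w \<le> Re v" if "k v = k w" using v2[OF that] w2(2) fin2 by simp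
      moreover have i: "Im w \<le> Im v" if "k v = k w" "Re v = Re w" using v3[OF that] w(2) fin3 by simp
      ultimately show ?thesis 
        unfolding before_def Let_def k_def[symmetric] v_def[symmetric]
        by (cases "k v = k w"; cases "Re v = Re w") auto
    qed
    thus "\<exists>w. w \<in> ?F \<and> (\<exists>A\<in>\<Gamma>. w = act A z)" using wH B by blast
  next
    fix w w' assume "w \<in> ?F \<and> (\<exists>A\<in>\<Gamma>. w = act A z)" "w' \<in> ?F \<and> (\<exists>A\<in>\<Gamma>. w' = act A z)"
    then obtain A B where AB: "A \<in> \<Gamma>" "B \<in> \<Gamma>" "w = act A z" "w' = act B z"
      and F: "w \<in> ?F" "w' \<in> ?F" by blast
    have "act (B ** adj A) w = w'" "act (A ** adj B) w' = w"
      using AB z by (simp_all add: act_mult in_SL2 adj_SL2 act_upper act_adj_cancel)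
    moreover have "B ** adj A \<in> \<Gamma>" "A ** adj B \<in> \<Gamma>" using AB by (auto intro: mult_closed adj_closed)
    moreover have "before w (act C w)" "before w' (act C w')" if "C \<in> \<Gamma>" for C
      using F that by auto
    ultimately have "before w w'" "before w' w" by metis+
    thus "w = w'" by (rule before_antisym)
  qed
  ultimately show "fundamental_set \<Gamma> ?F" unfolding fundamental_set_def by blast
qed

end

section \<open>Sums over cosets and unfolding\<close>

lemma borel_measurable_countable_sum:
  fixes f :: "'i \<Rightarrow> 'a \<Rightarrow> ennreal"
  assumes "countable I" "\<And>i. i \<in> I \<Longrightarrow> f i \<in> borel_measurable M"
  shows "(\<lambda>x. \<integral>\<^sup>+i. f i x \<partial>count_space I) \<in> borel_measurable M"
proof (rule sigma_finite_measure.borel_measurable_nn_integral[OF sigma_finite_measure_count_space_countable[OF assms(1)]])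
  have "(\<lambda>p. f (snd p) (fst p)) \<in> borel_measurable (M \<Otimes>\<^sub>M count_space I)"
  proof (rule measurable_compose_countable'[where I = I and g = snd and f = "\<lambda>i p. f i (fst p)"])
    show "(\<lambda>p. f i (fst p)) \<in> borel_measurable (M \<Otimes>\<^sub>M count_space I)" if "i \<in> I" for i
      using assms(2)[OF that] by (rule measurable_compose[OF measurable_fst])
  qed (use assms(1) in auto)
  thus "(\<lambda>(x, i). f i x) \<in> borel_measurable (M \<Otimes>\<^sub>M count_space I)"
    by (simp add: case_prod_unfold)
qed

lemma shift_mult: "shift m ** shift n = shift (m + n)"
  by (rule mat2_eqI) (simp_all add: mult_nth)

lemma adj_shift: "adj (shift n) = shift (- n)"
  by (rule mat2_eqI) simp_all

lemma shift_0: "shift 0 = mat 1"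
  by (rule mat2_eqI) simp_all

lemma inj_shift: "inj shift"
  by (rule injI) (metis of_int_eq_iff shift_nth(2))

lemma range_shift: "range shift = \<Lambda>\<^sub>0"
  by (auto simp: shift_def \<Lambda>\<^sub>0_def)

definition rep :: "mat2 set \<Rightarrow> mat2" where
  "rep C = adj (SOME A. A \<in> C)"

definition strip :: "complex set" where
  "strip = {z. 0 \<le> Re z \<and> Re z < 1}"

lemma strip_measurable [measurable]: "strip \<in> sets borel"
  unfolding strip_def by measurable

lemma strip_translate: "(\<integral>\<^sup>+n. indicator strip (w + of_int n) \<partial>count_space (UNIV :: int set)) = (1 :: ennreal)"
proof -
  have "indicator strip (w + of_int n) = (indicator {- \<lfloor>Re w\<rfloor>} n :: ennreal)" for n
  proof -
    have "w + of_int n \<in> strip \<longleftrightarrow> n = - \<lfloor>Re w\<rfloor>"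
    proof -
      have "w + of_int n \<in> strip \<longleftrightarrow> of_int (- n) \<le> Re w \<and> Re w < of_int (- n) + 1"
        by (auto simp: strip_def)
      also have "\<dots> \<longleftrightarrow> \<lfloor>Re w\<rfloor> = - n" by (auto simp: floor_eq_iff)
      finally show ?thesis by auto
    qed
    thus ?thesis by (simp add: indicator_def)
  qed
  thus ?thesis by (simp add: nn_integral_count_space_indicator[symmetric] one_ennreal_def)
qed

context cusp_group
begin

definition cosets :: "mat2 set set" where
  "cosets = lcosets\<^bsub>SL2R\<lparr>carrier := \<Gamma>\<rparr>\<^esub> \<Lambda>\<^sub>0"

definition reps :: "mat2 set" where
  "reps = rep ` cosets"

lemma cosets_eq: "cosets = (\<lambda>A. range (\<lambda>n. A ** shift n)) ` \<Gamma>"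
  unfolding cosets_def LCOSETS_def l_coset_def range_shift[symmetric]
  by (auto simp: SL2R_def)

lemma cosetD:
  assumes "C \<in> cosets" "A \<in> C"
  shows "A \<in> \<Gamma>" "C = range (\<lambda>n. A ** shift n)"
proof -
  obtain B where B: "B \<in> \<Gamma>" "C = range (\<lambda>n. B ** shift n)" using assms(1) by (auto simp: cosets_eq)
  then obtain m where m: "A = B ** shift m" using assms(2) by auto
  show "A \<in> \<Gamma>" using m B(1) by (simp add: mult_closed shift_closed)
  have "B ** shift n = A ** shift (n - m)" for n
    by (simp add: m matrix_mul_assoc[symmetric] shift_mult)
  moreover have "A ** shift n = B ** shift (m + n)" for n
    by (simp add: m matrix_mul_assoc[symmetric] shift_mult)
  ultimately show "C = range (\<lambda>n. A ** shift n)" unfolding B(2) by (metis (no_types) rangeI image_subsetI subset_antisym)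
qed

lemma some_in_coset:
  assumes "C \<in> cosets"
  shows "(SOME A. A \<in> C) \<in> C"
proof -
  obtain A where "A \<in> C" using assms by (auto simp: cosets_eq)
  thus ?thesis by (rule someI)
qed

lemma rep_closed: "C \<in> cosets \<Longrightarrow> rep C \<in> \<Gamma>"
  unfolding rep_def using some_in_coset cosetD(1) adj_closed by blast

lemma reps_closed: "t \<in> reps \<Longrightarrow> t \<in> \<Gamma>"
  by (auto simp: reps_def rep_closed)

lemma coset_of_rep: "C \<in> cosets \<Longrightarrow> C = range (\<lambda>n. adj (rep C) ** shift n)"
  unfolding rep_def using cosetD(2)[OF _ some_in_coset] by simp

lemma bij_rep: "bij_betw rep cosets reps"
  unfolding bij_betw_def reps_def
proof (intro conjI refl inj_onI)
  fix C C' assume C: "C \<in> cosets" "C' \<in> cosets" "rep C = rep C'"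
  show "C = C'" using coset_of_rep[OF C(1)] coset_of_rep[OF C(2)] unfolding C(3) by simp
qed

lemma countable_reps: "countable reps"
  by (rule countable_subset[OF _ countable]) (auto intro: reps_closed)

text \<open>
  Inversion turns the left cosets of the translations into right cosets, so \<^const>\<open>reps\<close> contains one element of each orbit of
  the translations acting on the group from the left.
\<close>

lemma bij_shift_reps: "bij_betw (\<lambda>(n, t). shift n ** t) (UNIV \<times> reps) \<Gamma>"
  unfolding bij_betw_def
proof
  show "inj_on (\<lambda>(n, t). shift n ** t) (UNIV \<times> reps)"
  proof (rule inj_onI, clarify)
    fix m n t t' assume t: "t \<in> reps" "t' \<in> reps" and eq: "shift m ** t = shift n ** t'"
    obtain C C' where C: "C \<in> cosets" "t = rep C" "C' \<in> cosets" "t' = rep C'"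
      using t by (auto simp: reps_def)
    have "shift (- n) ** (shift m ** t) = t'"
      unfolding eq by (simp add: matrix_mul_assoc shift_mult shift_0)
    hence "adj t' = adj t ** shift (n - m)"
      by (simp add: matrix_mul_assoc shift_mult adj_mult adj_shift flip: \<open>_ = t'\<close>)
    moreover have "adj t ** shift (n - m) \<in> C" using coset_of_rep[OF C(1)] C(2) by blast
    moreover have "adj t' \<in> C'"
      unfolding C(4) rep_def adj_adj by (rule some_in_coset[OF C(3)])
    ultimately have "C = C'" using cosetD(2)[OF C(1)] cosetD(2)[OF C(3)] by metis
    hence "t = t'" using C by simp
    have "(shift m ** t) ** adj t = (shift n ** t) ** adj t" using eq \<open>t = t'\<close> by simp
    hence "shift m = shift n"
      using t by (simp add: matrix_mul_assoc[symmetric] mult_adj in_SL2 reps_closed)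
    thus "m = n \<and> t = t'" using inj_shift \<open>t = t'\<close> by (auto dest: injD)
  qed
  show "(\<lambda>(n, t). shift n ** t) ` (UNIV \<times> reps) = \<Gamma>"
  proof (intro equalityI subsetI)
    fix A assume A: "A \<in> \<Gamma>"
    define C where "C = range (\<lambda>n. adj A ** shift n)"
    have C: "C \<in> cosets" using adj_closed[OF A] by (auto simp: cosets_eq C_def)
    have "adj (rep C) \<in> C" unfolding rep_def adj_adj by (rule some_in_coset[OF C])
    then obtain n where "adj (rep C) = adj A ** shift n" by (auto simp: C_def)
    hence "adj (adj (rep C)) = shift (- n) ** A" by (simp add: adj_mult adj_shift)
    hence "shift n ** rep C = A" by (simp add: matrix_mul_assoc shift_mult shift_0)
    moreover have "rep C \<in> reps" using C by (simp add: reps_def)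
    ultimately show "A \<in> (\<lambda>(n, t). shift n ** t) ` (UNIV \<times> reps)"
      by (intro image_eqI[of _ _ "(n, rep C)"]) auto
  qed (auto intro: mult_closed shift_closed reps_closed)
qed

lemma eisenstein_term_eq:
  assumes "C \<in> cosets"
  shows "eisenstein_term z s C = of_real (Im (act (rep C) z)) powr s"
proof -
  have "(SOME A. A \<in> C) \<in> SL2" using cosetD(1)[OF assms some_in_coset[OF assms]] by (rule in_SL2)
  thus ?thesis unfolding eisenstein_term_def rep_def by (simp add: inv_SL2R adj_def)
qed

lemma summable_eisenstein_iff:
  "eisenstein_term z s summable_on cosets \<longleftrightarrow> (\<lambda>t. of_real (Im (act t z)) powr s :: complex) summable_on reps"
  unfolding summable_on_reindex_bij_betw[OF bij_rep, of "\<lambda>t. of_real (Im (act t z)) powr s", symmetric]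
  by (rule summable_on_cong) (rule eisenstein_term_eq)

lemma eisenstein_eq:
  "eisenstein \<Gamma> z s = 1 / 2 * (\<Sum>\<^sub>\<infinity>t\<in>reps. of_real (Im (act t z)) powr s)"
  unfolding eisenstein_def cosets_def[symmetric]
    infsum_reindex_bij_betw[OF bij_rep, of "\<lambda>t. of_real (Im (act t z)) powr s", symmetric]
  by (intro arg_cong2[where f = "(*)"] infsum_cong refl) (rule eisenstein_term_eq)

subsection \<open>Poincare series\<close>

definition theta :: "(complex \<Rightarrow> ennreal) \<Rightarrow> complex \<Rightarrow> ennreal" where
  "theta f z = (\<integral>\<^sup>+t. f (act t z) \<partial>count_space reps)"

definition theta_full :: "(complex \<Rightarrow> ennreal) \<Rightarrow> complex \<Rightarrow> ennreal" where
  "theta_full f z = (\<integral>\<^sup>+A. indicator strip (act A z) * f (act A z) \<partial>count_space \<Gamma>)"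

lemma theta_measurable [measurable]:
  assumes [measurable]: "f \<in> borel_measurable borel"
  shows "theta f \<in> borel_measurable borel"
  unfolding theta_def by (rule borel_measurable_countable_sum) (auto intro: countable_reps)

text \<open>
  The sum over coset representatives commutes with invariant operators term by term; the sum
  over the whole group, cut off to a fundamental domain of the translations, is visibly invariant.
\<close>

lemma theta_eq_full:
  assumes "periodic f" "z \<in> \<H>"
  shows "theta f z = theta_full f z"
proof -
  let ?g = "\<lambda>A. indicator strip (act A z) * f (act A z)"
  have c: "countable (UNIV :: int set)" by simp
  interpret R: sigma_finite_measure "count_space reps"
    by (rule sigma_finite_measure_count_space_countable[OF countable_reps])
  interpret Z: sigma_finite_measure "count_space (UNIV :: int set)"
    by (rule sigma_finite_measure_count_space_countable[OF c])
  interpret P: pair_sigma_finite "count_space (UNIV :: int set)" "count_space reps" ..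
  have "theta_full f z = (\<integral>\<^sup>+p. ?g (case p of (n, t) \<Rightarrow> shift n ** t) \<partial>count_space (UNIV \<times> reps))"
    unfolding theta_full_def by (rule nn_integral_bij_count_space[OF bij_shift_reps, symmetric])
  also have "\<dots> = (\<integral>\<^sup>+p. ?g (case p of (n, t) \<Rightarrow> shift n ** t) \<partial>(count_space UNIV \<Otimes>\<^sub>M count_space reps))"
    by (simp only: pair_measure_countable[OF c countable_reps])
  also have "\<dots> = (\<integral>\<^sup>+t. \<integral>\<^sup>+n. ?g (shift n ** t) \<partial>count_space UNIV \<partial>count_space reps)"
    by (subst P.nn_integral_snd[symmetric]) (auto simp: pair_measure_countable[OF c countable_reps])
  also have "\<dots> = (\<integral>\<^sup>+t. f (act t z) \<partial>count_space reps)"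
  proof (rule nn_integral_cong)
    fix t assume "t \<in> space (count_space reps)"
    hence t: "t \<in> SL2" using reps_closed in_SL2 by auto
    have "(\<integral>\<^sup>+n. ?g (shift n ** t) \<partial>count_space UNIV)
        = (\<integral>\<^sup>+n. f (act t z) * indicator strip (act t z + of_int n) \<partial>count_space UNIV)"
      using t assms by (intro nn_integral_cong)
        (auto simp: act_mult act_shift periodic_def act_upper mult.commute)
    also have "\<dots> = f (act t z) * 1"
      by (subst nn_integral_cmult) (auto simp: strip_translate)
    finally show "(\<integral>\<^sup>+n. ?g (shift n ** t) \<partial>count_space UNIV) = f (act t z)" by simp
  qed
  finally show ?thesis by (simp add: theta_def)
qed

lemma theta_full_act:
  assumes "B \<in> \<Gamma>" "z \<in> \<H>"
  shows "theta_full f (act B z) = theta_full f z"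
proof -
  have "theta_full f (act B z) = (\<integral>\<^sup>+A. indicator strip (act (A ** B) z) * f (act (A ** B) z) \<partial>count_space \<Gamma>)"
    unfolding theta_full_def using assms by (intro nn_integral_cong) (auto simp: act_mult in_SL2)
  also have "\<dots> = theta_full f z"
    unfolding theta_full_def by (rule nn_integral_bij_count_space[OF bij_mult_right[OF assms(1)]])
  finally show ?thesis .
qed

lemma theta_act:
  assumes "periodic f" "B \<in> \<Gamma>" "z \<in> \<H>"
  shows "theta f (act B z) = theta f z"
  using assms by (simp add: theta_eq_full theta_full_act act_upper in_SL2)

lemma theta_ballint:
  assumes [measurable]: "f \<in> borel_measurable borel" and z: "z \<in> \<H>"
  shows "ballint R (theta f) z = theta (ballint R f) z"
proof -
  have "ballint R (theta f) z = (\<integral>\<^sup>+w. \<integral>\<^sup>+t. kern R z w * f (act t w) \<partial>count_space reps \<partial>\<mu>)"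
    unfolding ballint_def theta_def by (simp add: nn_integral_cmult)
  also have "\<dots> = (\<integral>\<^sup>+t. ballint R (\<lambda>w. f (act t w)) z \<partial>count_space reps)"
    unfolding ballint_def
    by (rule nn_integral_count_space_nn_integral[OF countable_reps]) auto
  also have "\<dots> = theta (ballint R f) z"
    unfolding theta_def using z reps_closed in_SL2
    by (intro nn_integral_cong ballint_act) auto
  finally show ?thesis .
qed

lemma theta_add: "theta (\<lambda>w. f w + g w) z = theta f z + theta g z"
  unfolding theta_def by (rule nn_integral_add) auto

lemma theta_cmult: "theta (\<lambda>w. c * f w) z = c * theta f z"
  unfolding theta_def by (rule nn_integral_cmult) auto

lemma theta_mono:
  assumes "z \<in> \<H>" "\<And>w. w \<in> \<H> \<Longrightarrow> f w \<le> g w"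
  shows "theta f z \<le> theta g z"
  unfolding theta_def using assms reps_closed in_SL2 act_upper
  by (intro nn_integral_mono) (auto intro!: assms(2))

lemma theta_cong:
  assumes "z \<in> \<H>" "\<And>w. w \<in> \<H> \<Longrightarrow> f w = g w"
  shows "theta f z = theta g z"
  using theta_mono[of z f g] theta_mono[of z g f] assms by (auto intro: antisym)

end

locale cusp_group_domain = cusp_group +
  fixes F :: "complex set"
  assumes fundamental: "fundamental_set \<Gamma> F"
begin

lemma F_measurable [measurable]: "F \<in> sets borel"
  using fundamental by (simp add: fundamental_set_def)

lemma F_upper: "F \<subseteq> \<H>"
  using fundamental by (simp add: fundamental_set_def)

lemma F_unique:
  assumes "z \<in> \<H>" "A \<in> \<Gamma>" "B \<in> \<Gamma>" "act A z \<in> F" "act B z \<in> F"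
  shows "act A z = act B z"
  using fundamental assms unfolding fundamental_set_def by blast

lemma F_exists:
  assumes "z \<in> \<H>"
  obtains A where "A \<in> \<Gamma>" "act A z \<in> F"
  using fundamental assms unfolding fundamental_set_def by blast

text \<open>
  A point whose stabilizer consists of \<open>1\<close> and \<open>-1\<close> lies in exactly two of the translates indexed by the group, because an element and its negative act in the same way.
\<close>

lemma AE_count: "AE z in \<mu>. (\<integral>\<^sup>+A. indicator F (act (adj A) z) \<partial>count_space \<Gamma>) = (2 :: ennreal)"
  using AE_trivial_stabilizer AE_upper
proof eventually_elim
  case (elim z)
  obtain A where A: "A \<in> \<Gamma>" "act A z \<in> F" using F_exists[OF elim(2)] .
  have neq: "adj A \<noteq> - adj A"
  proof
    assume eq: "adj A = - adj A"
    have "A $ i $ j = 0" for i j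
      using arg_cong[OF eq, of "\<lambda>B. adj B $ i $ j"] by (simp add: adj_uminus)
    thus False using in_SL2[OF A(1)] by (simp add: SL2_iff)
  qed
  have iff: "act (adj B) z \<in> F \<longleftrightarrow> B \<in> {adj A, - adj A}" if B: "B \<in> \<Gamma>" for B
  proof
    assume "act (adj B) z \<in> F"
    hence "act (adj B) z = act A z" using F_unique[OF elim(2)] A adj_closed[OF B] by blast
    hence "act B (act (adj B) z) = act (B ** A) z" using A B elim(2) by (simp add: act_mult in_SL2)
    hence "act (B ** A) z = z" using B elim(2) by (simp add: act_adj_cancel in_SL2)
    hence "B ** A = mat 1 \<or> B ** A = - mat 1" using elim(1) mult_closed[OF B A(1)] by blast
    moreover have "B = (B ** A) ** adj A"
      using A by (simp add: matrix_mul_assoc[symmetric] mult_adj in_SL2)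
    moreover have "- mat 1 ** adj A = - adj A" by (rule mat2_eqI) (simp_all add: mult_nth)
    ultimately show "B \<in> {adj A, - adj A}" by (metis insertCI matrix_mul_lid)
  next
    assume "B \<in> {adj A, - adj A}"
    thus "act (adj B) z \<in> F" using A by (auto simp: adj_uminus act_uminus)
  qed
  have "(\<integral>\<^sup>+B. indicator F (act (adj B) z) \<partial>count_space \<Gamma>) = (\<integral>\<^sup>+B. indicator {adj A, - adj A} B \<partial>count_space \<Gamma>)"
    using iff by (intro nn_integral_cong) (auto simp: indicator_def)
  also have "\<dots> = emeasure (count_space \<Gamma>) {adj A, - adj A}"
    using A by (intro nn_integral_indicator) (auto intro: adj_closed uminus_closed)
  also have "\<dots> = 2"
    using A neq by (subst emeasure_count_space_finite) (auto intro: adj_closed uminus_closed)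
  finally show ?case .
qed

lemma fold_integral:
  assumes [measurable]: "g \<in> borel_measurable borel"
  shows "2 * (\<integral>\<^sup>+z. g z \<partial>\<mu>)
    = (\<integral>\<^sup>+A. \<integral>\<^sup>+z. indicator F z * g (act A z) \<partial>\<mu> \<partial>count_space \<Gamma>)"
proof -
  have "(\<integral>\<^sup>+A. \<integral>\<^sup>+z. indicator F z * g (act A z) \<partial>\<mu> \<partial>count_space \<Gamma>)
      = (\<integral>\<^sup>+A. \<integral>\<^sup>+z. indicator F (act (adj A) z) * g z \<partial>\<mu> \<partial>count_space \<Gamma>)"
  proof (rule nn_integral_cong)
    fix A assume "A \<in> space (count_space \<Gamma>)"
    hence A: "A \<in> SL2" by (simp add: in_SL2)
    have "(\<integral>\<^sup>+z. indicator F z * g (act A z) \<partial>\<mu>)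
        = (\<integral>\<^sup>+z. indicator F (act (adj A) (act A z)) * g (act A z) \<partial>\<mu>)"
      using A by (intro nn_integral_poincare_cong) (simp add: act_adj_cancel)
    also have "\<dots> = (\<integral>\<^sup>+z. indicator F (act (adj A) z) * g z \<partial>\<mu>)"
      by (rule poincare_act[OF _ A]) simp
    finally show "(\<integral>\<^sup>+z. indicator F z * g (act A z) \<partial>\<mu>)
        = (\<integral>\<^sup>+z. indicator F (act (adj A) z) * g z \<partial>\<mu>)" .
  qed
  also have "\<dots> = (\<integral>\<^sup>+z. \<integral>\<^sup>+A. indicator F (act (adj A) z) * g z \<partial>count_space \<Gamma> \<partial>\<mu>)"
    by (rule nn_integral_count_space_nn_integral[OF countable, symmetric]) simp
  also have "\<dots> = (\<integral>\<^sup>+z. 2 * g z \<partial>\<mu>)"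
  proof (rule nn_integral_cong_AE, use AE_count in eventually_elim)
    fix z assume "(\<integral>\<^sup>+A. indicator F (act (adj A) z) \<partial>count_space \<Gamma>) = (2 :: ennreal)"
    thus "(\<integral>\<^sup>+A. indicator F (act (adj A) z) * g z \<partial>count_space \<Gamma>) = 2 * g z"
      by (simp add: nn_integral_multc)
  qed
  also have "\<dots> = 2 * (\<integral>\<^sup>+z. g z \<partial>\<mu>)"
    by (rule nn_integral_cmult) simp
  finally show ?thesis ..
qed

text \<open>
  The sum over the group inside the integral over the domain becomes, by \<open>fold_integral\<close>, an integral over the half-plane; the cut-off to the strip makes
  it an integral over a fundamental domain of the translations.
\<close>

lemma unfold_theta:
  assumes [measurable]: "f \<in> borel_measurable borel" "h \<in> borel_measurable borel"
    and per: "periodic f"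
    and inv: "\<And>A z. A \<in> \<Gamma> \<Longrightarrow> z \<in> \<H> \<Longrightarrow> h (act A z) = h z"
  shows "(\<integral>\<^sup>+z. indicator F z * (theta f z * h z) \<partial>\<mu>)
    = 2 * (\<integral>\<^sup>+z. indicator strip z * f z * h z \<partial>\<mu>)"
proof -
  have "2 * (\<integral>\<^sup>+z. indicator strip z * f z * h z \<partial>\<mu>)
      = (\<integral>\<^sup>+A. \<integral>\<^sup>+z. indicator F z * (indicator strip (act A z) * f (act A z) * h (act A z)) \<partial>\<mu> \<partial>count_space \<Gamma>)"
    by (rule fold_integral) simp
  also have "\<dots> = (\<integral>\<^sup>+z. \<integral>\<^sup>+A. indicator F z * (indicator strip (act A z) * f (act A z) * h (act A z)) \<partial>count_space \<Gamma> \<partial>\<mu>)"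
    by (rule nn_integral_count_space_nn_integral[OF countable, symmetric]) simp
  also have "\<dots> = (\<integral>\<^sup>+z. indicator F z * (theta f z * h z) \<partial>\<mu>)"
  proof (rule nn_integral_poincare_cong)
    fix z assume z: "z \<in> \<H>"
    have "(\<integral>\<^sup>+A. indicator F z * (indicator strip (act A z) * f (act A z) * h (act A z)) \<partial>count_space \<Gamma>)
        = (\<integral>\<^sup>+A. (indicator F z * h z) * (indicator strip (act A z) * f (act A z)) \<partial>count_space \<Gamma>)"
      using inv z by (intro nn_integral_cong) (auto simp: mult_ac)
    also have "\<dots> = (indicator F z * h z) * theta_full f z"
      unfolding theta_full_def by (rule nn_integral_cmult) simp
    finally show "(\<integral>\<^sup>+A. indicator F z * (indicator strip (act A z) * f (act A z) * h (act A z)) \<partial>count_space \<Gamma>)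
        = indicator F z * (theta f z * h z)"
      by (simp add: theta_eq_full[OF per z] mult_ac)
  qed
  finally show ?thesis ..
qed

lemma two_cancel: "2 * a = 2 * b \<Longrightarrow> a = (b :: ennreal)"
  by (cases a; cases b) (auto simp: ennreal_mult_top simp flip: ennreal_numeral ennreal_mult ennreal_mult'')

text \<open>
  For a kernel that is invariant under the diagonal action one may move the restriction to the domain from
  one variable to the other: fold the free variable and replace \<open>K z (A w)\<close> by \<open>K (A\<^sup>-\<^sup>1 z) w\<close>.
\<close>

lemma transfer_integral:
  assumes [measurable]: "(\<lambda>(z, w). K z w) \<in> borel_measurable (borel \<Otimes>\<^sub>M borel)"
    and inv: "\<And>A z w. A \<in> \<Gamma> \<Longrightarrow> z \<in> \<H> \<Longrightarrow> w \<in> \<H> \<Longrightarrow> K (act A z) (act A w) = K z w"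
  shows "(\<integral>\<^sup>+z. indicator F z * (\<integral>\<^sup>+w. K z w \<partial>\<mu>) \<partial>\<mu>)
    = (\<integral>\<^sup>+w. indicator F w * (\<integral>\<^sup>+z. K z w \<partial>\<mu>) \<partial>\<mu>)"
proof -
  have [measurable]: "(\<lambda>x. K (f x) (g x)) \<in> borel_measurable M"
    if "f \<in> borel_measurable M" "g \<in> borel_measurable M" for f g and M :: "'a measure"
    using measurable_compose[OF measurable_Pair[OF that] assms(1)] by simp
  have *: "2 * (\<integral>\<^sup>+z. indicator F z * (\<integral>\<^sup>+w. L z w \<partial>\<mu>) \<partial>\<mu>)
      = (\<integral>\<^sup>+A. \<integral>\<^sup>+z. \<integral>\<^sup>+w. indicator F z * indicator F w * L z (act A w) \<partial>\<mu> \<partial>\<mu> \<partial>count_space \<Gamma>)"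
    if meas: "(\<lambda>(z, w). L z w) \<in> borel_measurable (borel \<Otimes>\<^sub>M borel)" for L
  proof -
    have [measurable]: "(\<lambda>x. L (f x) (g x)) \<in> borel_measurable M"
      if "f \<in> borel_measurable M" "g \<in> borel_measurable M" for f g and M :: "'b measure"
      using measurable_compose[OF measurable_Pair[OF that] meas] by simp
    have [measurable]: "(\<lambda>x. L (f x) (g x)) \<in> borel_measurable M"
      if "f \<in> borel_measurable M" "g \<in> borel_measurable M" for f g and M :: "(complex \<times> complex) measure"
      using measurable_compose[OF measurable_Pair[OF that] meas] by simp
    have [measurable]: "(\<lambda>x. L (f x) (g x)) \<in> borel_measurable M"
      if "f \<in> borel_measurable M" "g \<in> borel_measurable M" for f g and M :: "complex measure"
      using measurable_compose[OF measurable_Pair[OF that] meas] by simp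
    have "2 * (\<integral>\<^sup>+z. indicator F z * (\<integral>\<^sup>+w. L z w \<partial>\<mu>) \<partial>\<mu>)
       = (\<integral>\<^sup>+z. indicator F z * (2 * (\<integral>\<^sup>+w. L z w \<partial>\<mu>)) \<partial>\<mu>)"
      by (subst nn_integral_cmult[symmetric]) (auto simp: mult_ac)
    also have "\<dots> = (\<integral>\<^sup>+z. indicator F z * (\<integral>\<^sup>+A. \<integral>\<^sup>+w. indicator F w * L z (act A w) \<partial>\<mu> \<partial>count_space \<Gamma>) \<partial>\<mu>)"
      by (subst fold_integral) auto
    also have "\<dots> = (\<integral>\<^sup>+z. \<integral>\<^sup>+A. \<integral>\<^sup>+w. indicator F z * indicator F w * L z (act A w) \<partial>\<mu> \<partial>count_space \<Gamma> \<partial>\<mu>)"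
      by (simp add: nn_integral_cmult mult.assoc)
    also have "\<dots> = (\<integral>\<^sup>+A. \<integral>\<^sup>+z. \<integral>\<^sup>+w. indicator F z * indicator F w * L z (act A w) \<partial>\<mu> \<partial>\<mu> \<partial>count_space \<Gamma>)"
      by (rule nn_integral_count_space_nn_integral[OF countable]) measurable
    finally show ?thesis .
  qed
  have "2 * (\<integral>\<^sup>+z. indicator F z * (\<integral>\<^sup>+w. K z w \<partial>\<mu>) \<partial>\<mu>)
      = (\<integral>\<^sup>+A. \<integral>\<^sup>+z. \<integral>\<^sup>+w. indicator F z * indicator F w * K z (act A w) \<partial>\<mu> \<partial>\<mu> \<partial>count_space \<Gamma>)"
    by (rule *) (rule assms(1))
  also have "\<dots> = (\<integral>\<^sup>+A. \<integral>\<^sup>+w. \<integral>\<^sup>+z. indicator F z * indicator F w * K z (act A w) \<partial>\<mu> \<partial>\<mu> \<partial>count_space \<Gamma>)"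
    by (intro nn_integral_cong poincare2.Fubini') measurable
  also have "\<dots> = (\<integral>\<^sup>+A. \<integral>\<^sup>+w. \<integral>\<^sup>+z. indicator F w * indicator F z * K (act (adj A) z) w \<partial>\<mu> \<partial>\<mu> \<partial>count_space \<Gamma>)"
  proof (rule nn_integral_cong, rule nn_integral_poincare_cong, rule nn_integral_poincare_cong)
    fix A z w assume "A \<in> space (count_space \<Gamma>)" and zw: "z \<in> \<H>" "w \<in> \<H>"
    hence A: "A \<in> \<Gamma>" by simp
    have "K z (act A w) = K (act A (act (adj A) z)) (act A w)" using A zw by (simp add: act_adj_cancel in_SL2)
    also have "\<dots> = K (act (adj A) z) w" using A zw by (intro inv act_upper adj_SL2 in_SL2)
    finally show "indicator F z * indicator F w * K z (act A w) = indicator F w * indicator F z * K (act (adj A) z) w"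
      by (simp add: mult_ac)
  qed
  also have "\<dots> = (\<integral>\<^sup>+A. \<integral>\<^sup>+w. \<integral>\<^sup>+z. indicator F w * indicator F z * K (act A z) w \<partial>\<mu> \<partial>\<mu> \<partial>count_space \<Gamma>)"
    by (rule nn_integral_bij_count_space[OF bij_adj])
  also have "\<dots> = 2 * (\<integral>\<^sup>+w. indicator F w * (\<integral>\<^sup>+z. K z w \<partial>\<mu>) \<partial>\<mu>)"
    by (rule *[symmetric]) measurable
  finally show ?thesis by (rule two_cancel)
qed

text \<open>
  On the quotient the averaging operator preserves the integral up to the factor \<open>\<lambda>(1)\<close>, since its kernel is symmetric.
\<close>

lemma integral_ballint:
  assumes [measurable]: "h \<in> borel_measurable borel" and R: "R \<ge> 0"
    and inv: "\<And>A z. A \<in> \<Gamma> \<Longrightarrow> z \<in> \<H> \<Longrightarrow> h (act A z) = h z"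
  shows "(\<integral>\<^sup>+z. indicator F z * ballint R h z \<partial>\<mu>)
    = ennreal (lamr R 0) * (\<integral>\<^sup>+z. indicator F z * h z \<partial>\<mu>)"
proof -
  have "(\<integral>\<^sup>+z. indicator F z * ballint R h z \<partial>\<mu>)
      = (\<integral>\<^sup>+w. indicator F w * (\<integral>\<^sup>+z. kern R z w * h w \<partial>\<mu>) \<partial>\<mu>)"
    unfolding ballint_def
    by (rule transfer_integral) (auto simp: kern_act in_SL2 inv)
  also have "\<dots> = (\<integral>\<^sup>+w. ennreal (lamr R 0) * (indicator F w * h w) \<partial>\<mu>)"
  proof (rule nn_integral_poincare_cong)
    fix w assume w: "w \<in> \<H>"
    have "(\<integral>\<^sup>+z. kern R z w * h w \<partial>\<mu>) = ballint R (\<lambda>z. 1) w * h w"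
      unfolding ballint_def by (subst nn_integral_multc) (auto simp: kern_sym[of R w])
    thus "indicator F w * (\<integral>\<^sup>+z. kern R z w * h w \<partial>\<mu>) = ennreal (lamr R 0) * (indicator F w * h w)"
      using w R by (simp add: lam_0 lam_eq mult_ac)
  qed
  also have "\<dots> = ennreal (lamr R 0) * (\<integral>\<^sup>+z. indicator F z * h z \<partial>\<mu>)"
    by (rule nn_integral_cmult) simp
  finally show ?thesis .
qed

end

section \<open>Estimates on the quotient\<close>

lemma nn_integral_exp_decay:
  assumes "b > 0"
  shows "(\<integral>\<^sup>+v. ennreal (exp (- (b * v))) * indicator {0..} v \<partial>lborel) = ennreal (1 / b)"
proof -
  have "(\<integral>\<^sup>+v. ennreal (exp (- (b * v))) * indicator {0..} v \<partial>lborel) = ennreal (0 - (\<lambda>v. - exp (- (b * v)) / b) 0)"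
  proof (rule nn_integral_FTC_atLeast)
    show "((\<lambda>v. - exp (- (b * v)) / b) has_real_derivative exp (- (b * x))) (at x)" for x
      using assms by (auto intro!: derivative_eq_intros)
    have "filterlim (\<lambda>v. b * v) at_top at_top"
      using assms filterlim_tendsto_pos_mult_at_top[OF tendsto_const _ filterlim_ident] by blast
    hence "((\<lambda>v. exp (- (b * v))) \<longlongrightarrow> 0) at_top"
      by (intro filterlim_compose[OF exp_at_bot] filterlim_compose[OF filterlim_uminus_at_bot_at_top])
    hence "((\<lambda>v. - exp (- (b * v)) / b) \<longlongrightarrow> - 0 / b) at_top"
      by (intro tendsto_intros) (use assms in auto)
    thus "((\<lambda>v. - exp (- (b * v)) / b) \<longlongrightarrow> 0) at_top" by simp
  qed auto
  thus ?thesis by simp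
qed

lemma nn_integral_strip_height:
  assumes [measurable]: "g \<in> borel_measurable borel"
  shows "(\<integral>\<^sup>+z. indicator strip z * g (Im z) \<partial>\<mu>) = (\<integral>\<^sup>+v. ennreal (exp (- v)) * g (exp v) \<partial>lborel)"
proof -
  have "(\<integral>\<^sup>+z. indicator strip z * g (Im z) \<partial>\<mu>)
      = (\<integral>\<^sup>+v. \<integral>\<^sup>+t. indicator strip (hpoint t v) * g (Im (hpoint t v)) \<partial>lborel \<partial>lborel)"
    by (rule nn_integral_poincare) simp
  also have "\<dots> = (\<integral>\<^sup>+v. \<integral>\<^sup>+t. g (exp v) * indicator {0..<exp (- v)} t \<partial>lborel \<partial>lborel)"
  proof (intro nn_integral_cong)
    fix v t :: real
    have "hpoint t v \<in> strip \<longleftrightarrow> t \<in> {0..<exp (- v)}"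
      by (auto simp: strip_def hpoint_def exp_minus zero_le_mult_iff field_simps)
    thus "indicator strip (hpoint t v) * g (Im (hpoint t v)) = g (exp v) * indicator {0..<exp (- v)} t"
      by (simp add: indicator_def hpoint_def)
  qed
  also have "\<dots> = (\<integral>\<^sup>+v. ennreal (exp (- v)) * g (exp v) \<partial>lborel)"
    by (intro nn_integral_cong) (simp add: nn_integral_cmult_indicator mult.commute)
  finally show ?thesis .
qed

text \<open>
  In the coordinate \<open>v = ln y\<close> the integrand is \<open>exp (- s v)\<close> for \<open>v > 0\<close> and \<open>exp ((s - 1) v)\<close> for \<open>v < 0\<close>.
\<close>

lemma mass_gfun:
  assumes "s > 1"
  shows "(\<integral>\<^sup>+z. indicator strip z * gfun s z \<partial>\<mu>) = ennreal (1 / (s - 1) + 1 / s)"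
proof -
  let ?e = "\<lambda>b v. ennreal (exp (- (b * v))) * indicator {0..} v"
  have "(\<integral>\<^sup>+z. indicator strip z * gfun s z \<partial>\<mu>)
      = (\<integral>\<^sup>+v. ennreal (exp (- v)) * ennreal (min (exp v powr s) (exp v powr (1 - s))) \<partial>lborel)"
    unfolding gfun_def by (rule nn_integral_strip_height) simp
  also have "\<dots> = (\<integral>\<^sup>+v. ?e s v + ?e (s - 1) (0 + (-1) * v) \<partial>lborel)"
  proof (rule nn_integral_cong_AE)
    have "AE v in lborel. v \<noteq> (0 :: real)" by (rule AE_lborel_singleton)
    thus "AE v in lborel. ennreal (exp (- v)) * ennreal (min (exp v powr s) (exp v powr (1 - s)))
        = ?e s v + ?e (s - 1) (0 + (-1) * v)"
    proof eventually_elim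
      case (elim v)
      have p: "exp v powr a = exp (a * v)" for a by (simp add: powr_def)
      show ?case
      proof (cases "v > 0")
        case True
        have "(1 - s) * v \<le> s * v" using True assms by (intro mult_right_mono) auto
        hence "min (exp v powr s) (exp v powr (1 - s)) = exp ((1 - s) * v)" by (simp add: p)
        thus ?thesis using True by (simp add: algebra_simps flip: ennreal_mult exp_add)
      next
        case False
        hence v: "v < 0" using elim by simp
        have "s * v \<le> (1 - s) * v" using v assms by (intro mult_right_mono_neg) auto
        hence "min (exp v powr s) (exp v powr (1 - s)) = exp (s * v)" by (simp add: p)
        thus ?thesis using v by (simp add: algebra_simps flip: ennreal_mult exp_add)
      qed
    qed
  qed
  also have "\<dots> = (\<integral>\<^sup>+v. ?e s v \<partial>lborel) + (\<integral>\<^sup>+v. ?e (s - 1) (0 + (-1) * v) \<partial>lborel)"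
    by (rule nn_integral_add) auto
  also have "(\<integral>\<^sup>+v. ?e (s - 1) (0 + (-1) * v) \<partial>lborel) = (\<integral>\<^sup>+v. ?e (s - 1) v \<partial>lborel)"
    by (subst (2) nn_integral_real_affine[where c = "-1" and t = 0]) auto
  finally show ?thesis using assms by (simp add: nn_integral_exp_decay add.commute)
qed

lemma ennreal_add_mult:
  assumes "0 \<le> x" "0 \<le> y" "0 \<le> x'" "0 \<le> y'"
  shows "ennreal x * ennreal y + ennreal x' * ennreal y' = ennreal (x * y + x' * y')"
  using assms by (simp add: ennreal_mult)

definition band :: "real \<Rightarrow> complex set" where
  "band q = {z. 1 / q \<le> Im z \<and> Im z \<le> q}"

lemma band_measurable [measurable]: "band q \<in> sets borel"
  unfolding band_def by measurable

lemma periodic_band: "periodic (indicator (band q))"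
  by (simp add: periodic_def band_def indicator_def)

lemma strip_band: "z \<in> strip \<Longrightarrow> z \<in> band q \<Longrightarrow> z \<in> rect 1 q"
  by (auto simp: strip_def band_def rect_def)

text \<open>
  Convexity of the square. The weights are chosen so that, with \<open>r\<close> the ratio of a geometric series, the
  recursion in \<open>theta_square_bound\<close> contracts by exactly \<open>r\<close>.
\<close>

lemma weighted_square_sum:
  fixes a b :: ennreal
  assumes "0 < r" "r < 1"
  shows "(a + b)\<^sup>2 \<le> ennreal (1 / (1 - r)) * a\<^sup>2 + ennreal (1 / r) * b\<^sup>2"
proof (cases a; cases b)
  fix x y assume a: "0 \<le> x" "a = ennreal x" and b: "0 \<le> y" "b = ennreal y"
  have "0 \<le> (r * x - (1 - r) * y)\<^sup>2 / (r * (1 - r))" using assms by simp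
  also have "\<dots> = 1 / (1 - r) * x\<^sup>2 + 1 / r * y\<^sup>2 - (x + y)\<^sup>2"
    using assms by (simp add: field_simps power2_eq_square)
  finally have "(x + y)\<^sup>2 \<le> 1 / (1 - r) * x\<^sup>2 + 1 / r * y\<^sup>2" by simp
  hence "ennreal ((x + y)\<^sup>2) \<le> ennreal (1 / (1 - r) * x\<^sup>2 + 1 / r * y\<^sup>2)" by (rule ennreal_leI)
  thus ?thesis using a b assms
    by (simp add: ennreal_power ennreal_mult'[symmetric] ennreal_plus[symmetric] del: ennreal_plus)
qed (use assms in \<open>auto simp: ennreal_mult_top power2_eq_square\<close>)

lemma ballint_square:
  assumes [measurable]: "f \<in> borel_measurable borel" and "z \<in> \<H>" "R \<ge> 0"
  shows "(ballint R f z)\<^sup>2 \<le> ennreal (lamr R 0) * ballint R (\<lambda>w. (f w)\<^sup>2) z"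
proof -
  have k: "kern R z w * kern R z w = kern R z w" for w by (simp add: kern_def)
  have "(ballint R f z)\<^sup>2 = (\<integral>\<^sup>+w. kern R z w * (kern R z w * f w) \<partial>\<mu>)\<^sup>2"
    unfolding ballint_def by (simp add: mult.assoc[symmetric] k)
  also have "\<dots> \<le> (\<integral>\<^sup>+w. (kern R z w)\<^sup>2 \<partial>\<mu>) * (\<integral>\<^sup>+w. (kern R z w * f w)\<^sup>2 \<partial>\<mu>)"
    by (rule Cauchy_Schwarz_nn_integral) auto
  also have "(\<integral>\<^sup>+w. (kern R z w)\<^sup>2 \<partial>\<mu>) = ballint R (\<lambda>w. 1) z"
    unfolding ballint_def by (simp add: power2_eq_square k)
  also have "(\<integral>\<^sup>+w. (kern R z w * f w)\<^sup>2 \<partial>\<mu>) = ballint R (\<lambda>w. (f w)\<^sup>2) z"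
    unfolding ballint_def by (simp add: power_mult_distrib power2_eq_square[of "kern R z _"] k)
  finally show ?thesis using assms by (simp add: lam_0 lam_eq)
qed

context cusp_group
begin

text \<open>
  If \<open>A\<^sub>0 w\<close> lies in the rectangle, then \<open>A \<mapsto> A A\<^sub>0\<^sup>-\<^sup>1\<close> sends the elements that take \<open>w\<close> into the rectangle to elements that take
  one point of the rectangle to another, and of those there are finitely many.
\<close>

lemma count_returns:
  assumes "c > 0"
  obtains N :: nat where "\<And>w. w \<in> \<H> \<Longrightarrow> (\<integral>\<^sup>+A. indicator (rect a c) (act A w) \<partial>count_space \<Gamma>) \<le> ennreal (real N)"
proof
  let ?X = "{A \<in> \<Gamma>. \<exists>z\<in>rect a c. act A z \<in> rect a c}"
  fix w assume w: "w \<in> \<H>"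
  define Y where "Y = {A \<in> \<Gamma>. act A w \<in> rect a c}"
  have fin: "finite ?X" by (rule finite_returns[OF assms])
  have "finite Y \<and> card Y \<le> card ?X"
  proof (cases "Y = {}")
    case False
    then obtain A0 where A0: "A0 \<in> \<Gamma>" "act A0 w \<in> rect a c" by (auto simp: Y_def)
    have inj: "inj_on (\<lambda>A. A ** adj A0) Y"
    proof (rule inj_onI)
      fix A B assume "A ** adj A0 = B ** adj A0"
      hence "(A ** adj A0) ** A0 = (B ** adj A0) ** A0" by simp
      thus "A = B" using A0 by (simp add: matrix_mul_assoc[symmetric] mult_adj in_SL2)
    qed
    have sub: "(\<lambda>A. A ** adj A0) ` Y \<subseteq> ?X"
    proof clarify
      fix A assume "A \<in> Y"
      hence A: "A \<in> \<Gamma>" "act A w \<in> rect a c" by (auto simp: Y_def)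
      have "act (A ** adj A0) (act A0 w) = act A w"
        using A A0 w by (simp add: act_mult act_upper in_SL2 adj_SL2 act_adj_cancel)
      thus "A ** adj A0 \<in> \<Gamma> \<and> (\<exists>z\<in>rect a c. act (A ** adj A0) z \<in> rect a c)"
        using A A0 by (metis mult_closed adj_closed)
    qed
    show ?thesis using card_inj_on_le[OF inj sub fin] finite_subset[OF sub fin] inj
      by (simp add: finite_image_iff)
  qed auto
  hence fY: "finite Y" and cY: "card Y \<le> card ?X" by auto
  have "(\<integral>\<^sup>+A. indicator (rect a c) (act A w) \<partial>count_space \<Gamma>) = (\<integral>\<^sup>+A. indicator Y A \<partial>count_space \<Gamma>)"
    by (intro nn_integral_cong) (auto simp: Y_def indicator_def)
  also have "\<dots> = emeasure (count_space \<Gamma>) Y"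
    by (rule nn_integral_indicator) (auto simp: Y_def)
  also have "\<dots> = of_nat (card Y)"
    using fY by (intro emeasure_count_space_finite) (auto simp: Y_def)
  also have "\<dots> \<le> ennreal (real (card ?X))" using cY by (simp add: ennreal_of_nat_eq_real_of_nat)
  finally show "(\<integral>\<^sup>+A. indicator (rect a c) (act A w) \<partial>count_space \<Gamma>) \<le> ennreal (real (card ?X))" .
qed

lemma theta_band_bounded:
  assumes "q > 0"
  obtains N :: nat where "\<And>w. w \<in> \<H> \<Longrightarrow> theta (indicator (band q)) w \<le> ennreal (real N)"
proof -
  obtain N :: nat where N: "\<And>w. w \<in> \<H> \<Longrightarrow> (\<integral>\<^sup>+A. indicator (rect 1 q) (act A w) \<partial>count_space \<Gamma>) \<le> ennreal (real N)"
    by (rule count_returns[OF assms, of 1]) (rule that)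
  show thesis
  proof (rule that)
    fix w assume w: "w \<in> \<H>"
    have "theta (indicator (band q)) w = theta_full (indicator (band q)) w"
      by (rule theta_eq_full[OF periodic_band w])
    also have "\<dots> \<le> (\<integral>\<^sup>+A. indicator (rect 1 q) (act A w) \<partial>count_space \<Gamma>)"
      unfolding theta_full_def by (intro nn_integral_mono) (auto simp: indicator_def strip_band)
    also have "\<dots> \<le> ennreal (real N)" by (rule N[OF w])
    finally show "theta (indicator (band q)) w \<le> ennreal (real N)" .
  qed
qed

lemma theta_source_bounded:
  assumes "R \<ge> 1"
  obtains N :: nat where "\<And>w (s :: real). w \<in> \<H> \<Longrightarrow> s \<ge> 1 \<Longrightarrow> theta (source R s) w \<le> ennreal (real N)"
proof -
  have "R + 2 > 0" using assms by simp
  then obtain N :: nat where N: "\<And>w. w \<in> \<H> \<Longrightarrow> theta (indicator (band (R + 2))) w \<le> ennreal (real N)"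
    by (rule theta_band_bounded) (rule that)
  show thesis
  proof (rule that)
    fix w :: complex and s :: real assume w: "w \<in> \<H>" "s \<ge> 1"
    have "theta (source R s) w \<le> theta (indicator (band (R + 2))) w"
      using source_le assms w unfolding band_def by (intro theta_mono) auto
    also have "\<dots> \<le> ennreal (real N)" using w by (intro N)
    finally show "theta (source R s) w \<le> ennreal (real N)" .
  qed
qed

lemma theta_gfun_eq:
  assumes "z \<in> \<H>" "R \<ge> 1" "s \<ge> 1"
  shows "theta (gfun s) z = theta (source R s) z + ennreal (1 / lamr R s) * ballint R (theta (gfun s)) z"
proof -
  have "theta (gfun s) z = theta (\<lambda>w. source R s w + ennreal (1 / lamr R s) * ballint R (gfun s) w) z"
    using assms by (intro theta_cong gfun_eq_source) auto
  thus ?thesis using assms(1) by (simp add: theta_add theta_cmult theta_ballint)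
qed

lemma theta_gpart_Suc:
  assumes "z \<in> \<H>"
  shows "theta (gpart R s (Suc N)) z = theta (source R s) z + ennreal (1 / lamr R s) * ballint R (theta (gpart R s N)) z"
proof -
  have "gpart R s (Suc N) = (\<lambda>z. source R s z + ennreal (1 / lamr R s) * ballint R (gpart R s N) z)" by auto
  thus ?thesis using assms by (simp add: theta_add theta_cmult theta_ballint)
qed

lemma theta_gfun_SUP:
  assumes "z \<in> \<H>" "R \<ge> 1" "s > 1"
  shows "theta (gfun s) z = (SUP N. theta (gpart R s N) z)"
proof -
  have "theta (gfun s) z = theta (\<lambda>w. SUP N. gpart R s N w) z"
    using assms by (intro theta_cong gfun_eq_SUP) auto
  also have "\<dots> = (SUP N. theta (gpart R s N) z)"
    unfolding theta_def using gpart_incseq[of R s]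
    by (intro nn_integral_monotone_convergence_SUP) (auto simp: incseq_def le_fun_def)
  finally show ?thesis .
qed

lemma theta_gpart_incseq: "incseq (\<lambda>N. theta (gpart R s N) z)"
  unfolding theta_def using gpart_incseq[of R s]
  by (auto simp: incseq_def intro!: nn_integral_mono)

end

text \<open>
  Multiplication by a constant commutes with suprema; apply this twice and compare with the diagonal.
\<close>

lemma SUP_square_ennreal:
  fixes a :: "nat \<Rightarrow> ennreal"
  assumes "incseq a"
  shows "(SUP n. a n)\<^sup>2 = (SUP n. (a n)\<^sup>2)"
proof (rule antisym)
  have "(SUP n. a n)\<^sup>2 = (SUP m. (SUP n. a n) * a m)"
    unfolding power2_eq_square by (rule SUP_mult_left_ennreal)
  also have "\<dots> = (SUP m. SUP n. a n * a m)"
    by (subst SUP_mult_right_ennreal) simp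
  also have "\<dots> \<le> (SUP n. (a n)\<^sup>2)"
  proof (intro SUP_least)
    fix m n
    have "a n * a m \<le> a (max m n) * a (max m n)"
      using assms by (intro mult_mono) (auto simp: incseq_def)
    also have "\<dots> \<le> (SUP n. (a n)\<^sup>2)"
      unfolding power2_eq_square by (rule SUP_upper) simp
    finally show "a n * a m \<le> (SUP n. (a n)\<^sup>2)" .
  qed
  finally show "(SUP n. a n)\<^sup>2 \<le> (SUP n. (a n)\<^sup>2)" .
  show "(SUP n. (a n)\<^sup>2) \<le> (SUP n. a n)\<^sup>2"
    by (intro SUP_least power_mono SUP_upper) auto
qed

context cusp_group_domain
begin

definition intF :: "(complex \<Rightarrow> ennreal) \<Rightarrow> ennreal" where
  "intF h = (\<integral>\<^sup>+z. indicator F z * h z \<partial>\<mu>)"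

lemma intF_mono: "(\<And>z. z \<in> \<H> \<Longrightarrow> f z \<le> g z) \<Longrightarrow> intF f \<le> intF g"
  unfolding intF_def by (intro nn_integral_poincare_mono mult_left_mono) auto

lemma intF_cong: "(\<And>z. z \<in> \<H> \<Longrightarrow> f z = g z) \<Longrightarrow> intF f = intF g"
  unfolding intF_def by (intro nn_integral_poincare_cong) auto

lemma intF_add:
  assumes [measurable]: "f \<in> borel_measurable borel" "g \<in> borel_measurable borel"
  shows "intF (\<lambda>z. f z + g z) = intF f + intF g"
  unfolding intF_def by (subst nn_integral_add[symmetric]) (auto simp: distrib_left)

lemma intF_cmult:
  assumes [measurable]: "f \<in> borel_measurable borel"
  shows "intF (\<lambda>z. c * f z) = c * intF f"
  unfolding intF_def by (subst nn_integral_cmult[symmetric]) (auto simp: mult_ac)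

lemma intF_theta_gfun:
  assumes "s > 1"
  shows "intF (theta (gfun s)) = ennreal (2 * (1 / (s - 1) + 1 / s))"
proof -
  have "intF (theta (gfun s)) = (\<integral>\<^sup>+z. indicator F z * (theta (gfun s) z * 1) \<partial>\<mu>)"
    by (simp add: intF_def)
  also have "\<dots> = 2 * (\<integral>\<^sup>+z. indicator strip z * gfun s z * 1 \<partial>\<mu>)"
    by (rule unfold_theta) (auto simp: periodic_gfun)
  also have "\<dots> = ennreal (2 * (1 / (s - 1) + 1 / s))"
    using assms by (subst ennreal_mult) (simp_all add: mass_gfun del: ennreal_plus)
  finally show ?thesis .
qed

text \<open>
  The sum of the source over the cosets is bounded, and its integral is finite by unfolding, because the source lives on a
  band that meets the strip in a rectangle.
\<close>

lemma source_square:
  assumes "R \<ge> 1"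
  obtains S where "S \<ge> 0" "\<And>s. s \<ge> 1 \<Longrightarrow> intF (\<lambda>z. (theta (source R s) z)\<^sup>2) \<le> ennreal S"
proof -
  let ?b = "theta (indicator (band (R + 2)))"
  have R2: "R + 2 > 0" using assms by simp
  then obtain N :: nat where N: "\<And>w. w \<in> \<H> \<Longrightarrow> ?b w \<le> ennreal (real N)"
    by (rule theta_band_bounded) (rule that)
  define S where "S = real N * (2 * measure \<mu> (rect 1 (R + 2)))"
  have fin: "emeasure \<mu> (rect 1 (R + 2)) = ennreal (measure \<mu> (rect 1 (R + 2)))"
    using rect_finite[OF R2, of 1] by (intro emeasure_eq_ennreal_measure) auto
  have b: "intF ?b \<le> 2 * emeasure \<mu> (rect 1 (R + 2))"
  proof -
    have "intF ?b = (\<integral>\<^sup>+z. indicator F z * (?b z * 1) \<partial>\<mu>)"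
      by (simp add: intF_def)
    also have "\<dots> = 2 * (\<integral>\<^sup>+z. indicator strip z * indicator (band (R + 2)) z * 1 \<partial>\<mu>)"
      by (rule unfold_theta) (auto simp: periodic_band)
    also have "\<dots> \<le> 2 * (\<integral>\<^sup>+z. indicator (rect 1 (R + 2)) z \<partial>\<mu>)"
      by (intro mult_left_mono nn_integral_mono) (auto simp: indicator_def strip_band)
    finally show ?thesis by simp
  qed
  show thesis
  proof (rule that[of S])
    show "S \<ge> 0" by (simp add: S_def)
    fix s :: real assume s: "s \<ge> 1"
    have "intF (\<lambda>z. (theta (source R s) z)\<^sup>2) \<le> intF (\<lambda>z. ennreal (real N) * ?b z)"
    proof (rule intF_mono)
      fix z assume z: "z \<in> \<H>"
      have le: "theta (source R s) z \<le> ?b z"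
        using source_le assms s z unfolding band_def by (intro theta_mono) auto
      show "(theta (source R s) z)\<^sup>2 \<le> ennreal (real N) * ?b z"
        unfolding power2_eq_square using le N[OF z] by (intro mult_mono order_trans[OF le]) auto
    qed
    also have "\<dots> = ennreal (real N) * intF ?b" by (rule intF_cmult) simp
    also have "\<dots> \<le> ennreal (real N) * (2 * emeasure \<mu> (rect 1 (R + 2)))"
      by (rule mult_left_mono[OF b]) simp
    also have "\<dots> = ennreal S" unfolding fin S_def by (simp add: ennreal_mult)
    finally show "intF (\<lambda>z. (theta (source R s) z)\<^sup>2) \<le> ennreal S" .
  qed
qed

text \<open>
  The operator, divided by \<open>\<lambda>(s)\<close>, has norm at most \<open>r\<close> on the square integrable functions of the quotient. The bound passes to the partial sums of the Neumann
  series by induction, and to their limit by monotone convergence.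
\<close>

lemma theta_square_bound:
  assumes R: "R \<ge> 1" and s: "s > 1" and S: "S \<ge> 0" "intF (\<lambda>z. (theta (source R s) z)\<^sup>2) \<le> ennreal S"
    and r: "r = lamr R 0 / lamr R s" "r < 1"
  shows "intF (\<lambda>z. (theta (gfun s) z)\<^sup>2) \<le> ennreal (S / (1 - r)\<^sup>2)"
proof -
  have lam: "lamr R s > 0" "lamr R 0 > 0" using lamr_pos[of R s] lamr_0_pos[of R] R s by auto
  have r0: "r > 0" using lam r by simp
  have step: "intF (\<lambda>z. (theta (gpart R s N) z)\<^sup>2) \<le> ennreal (S / (1 - r)\<^sup>2)" for N
  proof (induction N)
    case 0
    have "intF (\<lambda>z. (theta (gpart R s 0) z)\<^sup>2) = 0" unfolding intF_def theta_def by simp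
    thus ?case by (simp only: zero_le)
  next
    case (Suc N)
    let ?T = "theta (gpart R s N)" and ?S = "theta (source R s)"
    have "intF (\<lambda>z. (theta (gpart R s (Suc N)) z)\<^sup>2)
        \<le> intF (\<lambda>z. ennreal (1 / (1 - r)) * (?S z)\<^sup>2 + ennreal (1 / lamr R s) * ballint R (\<lambda>w. (?T w)\<^sup>2) z)"
    proof (rule intF_mono)
      fix z assume z: "z \<in> \<H>"
      have "(theta (gpart R s (Suc N)) z)\<^sup>2 = (?S z + ennreal (1 / lamr R s) * ballint R ?T z)\<^sup>2"
        by (simp only: theta_gpart_Suc[OF z])
      also have "\<dots> \<le> ennreal (1 / (1 - r)) * (?S z)\<^sup>2 + ennreal (1 / r) * (ennreal (1 / lamr R s) * ballint R ?T z)\<^sup>2"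
        by (rule weighted_square_sum[OF r0 r(2)])
      also have "(ennreal (1 / lamr R s) * ballint R ?T z)\<^sup>2 = ennreal ((1 / lamr R s)\<^sup>2) * (ballint R ?T z)\<^sup>2"
        using lam by (simp add: power_mult_distrib ennreal_power)
      also have "ennreal (1 / r) * (ennreal ((1 / lamr R s)\<^sup>2) * (ballint R ?T z)\<^sup>2)
          \<le> ennreal (1 / r) * (ennreal ((1 / lamr R s)\<^sup>2) * (ennreal (lamr R 0) * ballint R (\<lambda>w. (?T w)\<^sup>2) z))"
        using ballint_square[of ?T z R] z R by (intro mult_left_mono) auto
      also have "\<dots> = ennreal (1 / r * ((1 / lamr R s)\<^sup>2 * lamr R 0)) * ballint R (\<lambda>w. (?T w)\<^sup>2) z"
      proof -
        have nn: "0 \<le> 1 / r" "0 \<le> (1 / lamr R s)\<^sup>2" "0 \<le> lamr R 0" "0 \<le> (1 / lamr R s)\<^sup>2 * lamr R 0"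
          using lam r0 by auto
        show ?thesis by (simp only: ennreal_mult[OF nn(1,4)] ennreal_mult[OF nn(2,3)] mult.assoc)
      qed
      also have "1 / r * ((1 / lamr R s)\<^sup>2 * lamr R 0) = 1 / lamr R s"
        using lam by (simp add: r(1) power2_eq_square)
      finally show "(theta (gpart R s (Suc N)) z)\<^sup>2
          \<le> ennreal (1 / (1 - r)) * (?S z)\<^sup>2 + ennreal (1 / lamr R s) * ballint R (\<lambda>w. (?T w)\<^sup>2) z"
        by (simp add: add_left_mono del: gpart.simps)
    qed
    also have "\<dots> = ennreal (1 / (1 - r)) * intF (\<lambda>z. (?S z)\<^sup>2) + ennreal (1 / lamr R s) * intF (ballint R (\<lambda>w. (?T w)\<^sup>2))"
      by (simp add: intF_add intF_cmult)
    also have "intF (ballint R (\<lambda>w. (?T w)\<^sup>2)) = ennreal (lamr R 0) * intF (\<lambda>w. (?T w)\<^sup>2)"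
      unfolding intF_def using R
      by (intro integral_ballint) (auto simp: theta_act periodic_gpart)
    also have "ennreal (1 / (1 - r)) * intF (\<lambda>z. (?S z)\<^sup>2) + ennreal (1 / lamr R s) * (ennreal (lamr R 0) * intF (\<lambda>w. (?T w)\<^sup>2))
        \<le> ennreal (1 / (1 - r)) * ennreal S + ennreal (1 / lamr R s) * (ennreal (lamr R 0) * ennreal (S / (1 - r)\<^sup>2))"
      using S(2) Suc.IH by (intro add_mono mult_left_mono) auto
    also have "\<dots> = ennreal (1 / (1 - r) * S + 1 / lamr R s * (lamr R 0 * (S / (1 - r)\<^sup>2)))"
    proof -
      have lin: "ennreal x * ennreal y + ennreal x' * (ennreal y' * ennreal z') = ennreal (x * y + x' * (y' * z'))"
        if "0 \<le> x" "0 \<le> y" "0 \<le> x'" "0 \<le> y'" "0 \<le> z'" for x y x' y' z'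
        using that by (simp add: ennreal_mult ennreal_plus)
      show ?thesis by (rule lin) (use lam r S(1) in auto)
    qed
    also have "1 / (1 - r) * S + 1 / lamr R s * (lamr R 0 * (S / (1 - r)\<^sup>2)) = S / (1 - r)\<^sup>2"
    proof -
      define X where "X = S / (1 - r)\<^sup>2"
      have "1 / lamr R s * (lamr R 0 * X) = r * X" by (simp add: r(1))
      moreover have "1 / (1 - r) * S = (1 - r) * X" using r(2) by (simp add: X_def power2_eq_square)
      moreover have "(1 - r) * X + r * X = X" by (simp add: left_diff_distrib)
      ultimately show ?thesis unfolding X_def[symmetric] by (simp only:)
    qed
    finally show ?case .
  qed
  have "intF (\<lambda>z. (theta (gfun s) z)\<^sup>2) = intF (\<lambda>z. SUP N. (theta (gpart R s N) z)\<^sup>2)"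
    using theta_gfun_SUP[OF _ R s] SUP_square_ennreal[OF theta_gpart_incseq] by (intro intF_cong) simp
  also have "\<dots> = (\<integral>\<^sup>+z. (SUP N. indicator F z * (theta (gpart R s N) z)\<^sup>2) \<partial>\<mu>)"
    unfolding intF_def by (simp add: SUP_mult_left_ennreal)
  also have "\<dots> = (SUP N. intF (\<lambda>z. (theta (gpart R s N) z)\<^sup>2))"
    unfolding intF_def using theta_gpart_incseq[of R s]
    by (intro nn_integral_monotone_convergence_SUP)
      (auto simp: incseq_def le_fun_def intro!: mult_left_mono power_mono)
  also have "\<dots> \<le> ennreal (S / (1 - r)\<^sup>2)" by (rule SUP_least) (rule step)
  finally show ?thesis .
qed

text \<open>
  The factor 2 in the denominator is the one in front of the Eisenstein series.
\<close>

definition scaled :: "real \<Rightarrow> complex \<Rightarrow> ennreal" where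
  "scaled s z = ennreal ((s - 1) / 2) * theta (gfun s) z"

lemma scaled_measurable [measurable]: "scaled s \<in> borel_measurable borel"
  unfolding scaled_def by measurable

lemma scaled_act: "A \<in> \<Gamma> \<Longrightarrow> z \<in> \<H> \<Longrightarrow> scaled s (act A z) = scaled s z"
  unfolding scaled_def by (simp add: theta_act periodic_gfun)

lemma intF_scaled:
  assumes "s > 1"
  shows "intF (scaled s) = ennreal (1 + (s - 1) / s)"
proof -
  have "intF (scaled s) = ennreal ((s - 1) / 2) * ennreal (2 * (1 / (s - 1) + 1 / s))"
    unfolding scaled_def using assms by (simp add: intF_cmult intF_theta_gfun del: ennreal_plus)
  also have "\<dots> = ennreal ((s - 1) / 2 * (2 * (1 / (s - 1) + 1 / s)))"
    using assms by (subst ennreal_mult) auto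
  also have "(s - 1) / 2 * (2 * (1 / (s - 1) + 1 / s)) = 1 + (s - 1) / s"
    using assms by (simp add: field_simps)
  finally show ?thesis .
qed

lemma scaled_eq:
  assumes "z \<in> \<H>" "R \<ge> 1" "s \<ge> 1"
  shows "scaled s z = ennreal ((s - 1) / 2) * theta (source R s) z + ennreal (1 / lamr R s) * ballint R (scaled s) z"
proof -
  have "ballint R (scaled s) z = ennreal ((s - 1) / 2) * ballint R (theta (gfun s)) z"
    unfolding scaled_def by (rule ballint_cmult) simp
  thus ?thesis unfolding scaled_def
    by (subst theta_gfun_eq[OF assms]) (simp add: distrib_left mult_ac)
qed

text \<open>
  The bound \<open>S / (1 - r)\<^sup>2\<close> grows at most like \<open>(s - 1)\<^sup>-\<^sup>2\<close>, which the factor \<open>(s - 1)\<^sup>2\<close> cancels; \<open>lamr_lower\<close>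
  controls \<open>1 - r\<close> from below.
\<close>

lemma intF_scaled_square:
  obtains B where "B \<ge> 0" "\<And>s. 1 < s \<Longrightarrow> s \<le> 2 \<Longrightarrow> intF (\<lambda>z. (scaled s z)\<^sup>2) \<le> ennreal B"
proof -
  obtain S where S: "S \<ge> 0" "\<And>s. s \<ge> 1 \<Longrightarrow> intF (\<lambda>z. (theta (source 1 s) z)\<^sup>2) \<le> ennreal S"
    by (rule source_square[of 1]) (simp, rule that)
  obtain k where k: "k > 0" "\<And>s. s \<ge> 1 \<Longrightarrow> lamr 1 s \<ge> lamr 1 0 + k * (s - 1)"
    by (rule lamr_lower[of 1]) (simp, rule that)
  define L where "L = lamr 1 0 + lamr 1 2"
  show thesis
  proof (rule that)
    show "0 \<le> S * L\<^sup>2 / (4 * k\<^sup>2)" using S(1) by simp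
    fix s :: real assume s: "1 < s" "s \<le> 2"
    define r where "r = lamr 1 0 / lamr 1 s"
    have lam: "lamr 1 s > 0" using lamr_pos[of 1 s] s by simp
    have ks: "0 < k * (s - 1)" using k(1) s by simp
    have lt: "lamr 1 0 < lamr 1 s" using k(2)[of s] ks s by linarith
    hence r: "r < 1" using lam by (simp add: r_def)
    have L: "lamr 1 s \<le> L" using lamr_le[of 1 s] s by (simp add: L_def)
    have "k * (s - 1) / L \<le> (lamr 1 s - lamr 1 0) / lamr 1 s"
      using k(2)[of s] s L lam ks lt by (intro frac_le) auto
    also have "\<dots> = 1 - r" using lam by (simp add: r_def diff_divide_distrib)
    finally have gap: "k * (s - 1) / L \<le> 1 - r" .
    have L0: "L > 0" using L lam by linarith
    have "intF (\<lambda>z. (scaled s z)\<^sup>2) = ennreal (((s - 1) / 2)\<^sup>2) * intF (\<lambda>z. (theta (gfun s) z)\<^sup>2)"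
      unfolding scaled_def power_mult_distrib using s by (simp add: intF_cmult ennreal_power)
    also have "\<dots> \<le> ennreal (((s - 1) / 2)\<^sup>2) * ennreal (S / (1 - r)\<^sup>2)"
      using theta_square_bound[of 1 s S r] S s r by (intro mult_left_mono) (auto simp: r_def)
    also have "\<dots> = ennreal (((s - 1) / 2)\<^sup>2 * (S / (1 - r)\<^sup>2))"
      by (rule ennreal_mult[symmetric]) (use S(1) in auto)
    also have "((s - 1) / 2)\<^sup>2 * (S / (1 - r)\<^sup>2) \<le> ((s - 1) / 2)\<^sup>2 * (S / (k * (s - 1) / L)\<^sup>2)"
    proof -
      define d where "d = k * (s - 1) / L"
      have d: "d > 0" "d \<le> 1 - r" using gap ks L0 by (auto simp: d_def)
      hence "S / (1 - r)\<^sup>2 \<le> S / d\<^sup>2" using S(1) by (intro divide_left_mono power_mono) auto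
      thus ?thesis unfolding d_def by (rule mult_left_mono) simp
    qed
    also have "\<dots> = S * L\<^sup>2 / (4 * k\<^sup>2)"
    proof -
      define t where "t = s - 1"
      have "t > 0" using s by (simp add: t_def)
      thus ?thesis unfolding t_def[symmetric] using k(1) L0
        by (simp add: power_divide power_mult_distrib field_simps)
    qed
    finally show "intF (\<lambda>z. (scaled s z)\<^sup>2) \<le> ennreal (S * L\<^sup>2 / (4 * k\<^sup>2))"
      by (simp add: ennreal_leI)
  qed
qed

text \<open>
  A ball meets the orbit of a point a bounded number of times, so its image covers every part of the quotient at most that often.
\<close>

lemma ballint_le_intF:
  assumes "z \<in> \<H>" "R \<ge> 0"
  shows "\<exists>N::nat. \<forall>h\<in>borel_measurable borel. (\<forall>A\<in>\<Gamma>. \<forall>z\<in>\<H>. h (act A z) = h z)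
    \<longrightarrow> ballint R h z \<le> ennreal (real N) * intF h"
proof -
  obtain a c where ac: "c > 0" "\<And>w. w \<in> \<H> \<Longrightarrow> near R z w \<Longrightarrow> w \<in> rect a c"
    by (rule near_rect[OF assms]) (rule that)
  obtain N :: nat where N: "\<And>w. w \<in> \<H> \<Longrightarrow> (\<integral>\<^sup>+A. indicator (rect a c) (act A w) \<partial>count_space \<Gamma>) \<le> ennreal (real N)"
    by (rule count_returns[OF ac(1), of a]) (rule that)
  show ?thesis
  proof (intro exI ballI impI)
    fix h :: "complex \<Rightarrow> ennreal"
    assume [measurable]: "h \<in> borel_measurable borel" and inv: "\<forall>A\<in>\<Gamma>. \<forall>z\<in>\<H>. h (act A z) = h z"
    have "ballint R h z \<le> 2 * ballint R h z" by (simp add: mult_2)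
    also have "\<dots> = (\<integral>\<^sup>+A. \<integral>\<^sup>+w. indicator F w * (kern R z (act A w) * h (act A w)) \<partial>\<mu> \<partial>count_space \<Gamma>)"
      unfolding ballint_def by (rule fold_integral) simp
    also have "\<dots> = (\<integral>\<^sup>+w. \<integral>\<^sup>+A. indicator F w * (kern R z (act A w) * h (act A w)) \<partial>count_space \<Gamma> \<partial>\<mu>)"
      by (rule nn_integral_count_space_nn_integral[OF countable, symmetric]) simp
    also have "\<dots> \<le> (\<integral>\<^sup>+w. ennreal (real N) * (indicator F w * h w) \<partial>\<mu>)"
    proof (rule nn_integral_poincare_mono)
      fix w assume w: "w \<in> \<H>"
      have "(\<integral>\<^sup>+A. indicator F w * (kern R z (act A w) * h (act A w)) \<partial>count_space \<Gamma>)
          \<le> (\<integral>\<^sup>+A. (indicator F w * h w) * indicator (rect a c) (act A w) \<partial>count_space \<Gamma>)"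
      proof (rule nn_integral_mono)
        fix A assume "A \<in> space (count_space \<Gamma>)"
        hence A: "A \<in> \<Gamma>" by simp
        have "kern R z (act A w) \<le> indicator (rect a c) (act A w)"
          using ac(2)[of "act A w"] act_upper[OF in_SL2[OF A] w] by (auto simp: kern_def)
        hence "indicator F w * (kern R z (act A w) * h w) \<le> indicator F w * (indicator (rect a c) (act A w) * h w)"
          by (intro mult_left_mono mult_right_mono) auto
        thus "indicator F w * (kern R z (act A w) * h (act A w)) \<le> (indicator F w * h w) * indicator (rect a c) (act A w)"
          using inv A w by (simp add: mult_ac)
      qed
      also have "\<dots> = (indicator F w * h w) * (\<integral>\<^sup>+A. indicator (rect a c) (act A w) \<partial>count_space \<Gamma>)"
        by (rule nn_integral_cmult) simp
      also have "\<dots> \<le> (indicator F w * h w) * ennreal (real N)"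
        by (rule mult_left_mono[OF N[OF w]]) simp
      finally show "(\<integral>\<^sup>+A. indicator F w * (kern R z (act A w) * h (act A w)) \<partial>count_space \<Gamma>)
          \<le> ennreal (real N) * (indicator F w * h w)" by (simp add: mult_ac)
    qed
    also have "\<dots> = ennreal (real N) * intF h"
      unfolding intF_def by (rule nn_integral_cmult) simp
    finally show "ballint R h z \<le> ennreal (real N) * intF h" .
  qed
qed

lemma scaled_finite:
  assumes "z \<in> \<H>" "s > 1"
  shows "scaled s z < \<infinity>"
proof -
  obtain N :: nat where N: "\<And>w (s :: real). w \<in> \<H> \<Longrightarrow> s \<ge> 1 \<Longrightarrow> theta (source 1 s) w \<le> ennreal (real N)"
    by (rule theta_source_bounded[of 1]) (simp, rule that)
  obtain M :: nat where M: "\<forall>h\<in>borel_measurable borel. (\<forall>A\<in>\<Gamma>. \<forall>z\<in>\<H>. h (act A z) = h z)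
      \<longrightarrow> ballint 1 h z \<le> ennreal (real M) * intF h"
    using ballint_le_intF[OF assms(1) zero_le_one] ..
  have "ballint 1 (scaled s) z \<le> ennreal (real M) * intF (scaled s)"
    using M by (simp add: scaled_act)
  also have "\<dots> < \<infinity>" using assms by (simp add: intF_scaled ennreal_mult_less_top del: ennreal_plus)
  finally have "ballint 1 (scaled s) z < \<infinity>" .
  moreover have "theta (source 1 s) z < \<infinity>" using N[of z s] assms by (auto intro: le_less_trans)
  ultimately show ?thesis using assms
    by (subst scaled_eq[of z 1 s]) (auto simp: ennreal_mult_less_top)
qed

definition oscillation :: "real \<Rightarrow> real \<Rightarrow> ennreal" where
  "oscillation R s = intF (\<lambda>z. \<integral>\<^sup>+w. kern R z w * ennreal ((enn2real (scaled s z) - enn2real (scaled s w))\<^sup>2) \<partial>\<mu>)"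

text \<open>
  Expanding the square gives \<open>2 (\<lambda>(1) \<parallel>u\<parallel>\<^sup>2 - \<langle>u, P u\<rangle>)\<close> with \<open>P\<close> the integration over balls. Since \<open>P u = \<lambda>(s) (u - e)\<close> with an
  error \<open>e\<close> of order \<open>s - 1\<close>, and \<open>\<lambda>(1) \<le> \<lambda>(s)\<close>, this is at most \<open>2 \<lambda>(s) \<langle>u, e\<rangle>\<close>.
\<close>

lemma oscillation_bound:
  assumes R: "R \<ge> 1"
  obtains C where "C \<ge> 0" "\<And>s. 1 < s \<Longrightarrow> s \<le> 2 \<Longrightarrow> oscillation R s \<le> ennreal (C * (s - 1))"
proof -
  obtain N :: nat where N: "\<And>w (s :: real). w \<in> \<H> \<Longrightarrow> s \<ge> 1 \<Longrightarrow> theta (source R s) w \<le> ennreal (real N)"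
    by (rule theta_source_bounded[OF R]) (rule that)
  obtain B where B: "B \<ge> 0" "\<And>s. 1 < s \<Longrightarrow> s \<le> 2 \<Longrightarrow> intF (\<lambda>z. (scaled s z)\<^sup>2) \<le> ennreal B"
    by (rule intF_scaled_square) (rule that)
  define L where "L = lamr R 0 + lamr R 2"
  show thesis
  proof (rule that)
    show "0 \<le> 2 * L * real N" by (simp add: L_def lamr_nonneg)
    fix s :: real assume s: "1 < s" "s \<le> 2"
    let ?u = "scaled s" and ?e = "\<lambda>z. ennreal ((s - 1) / 2) * theta (source R s) z"
    have lam: "lamr R s > 0" using lamr_pos[of R s] R s by simp
    have L: "lamr R s \<le> L" using lamr_le[of R s] s R by (simp add: L_def)
    have fin: "?u z = ennreal (enn2real (?u z))" if "z \<in> \<H>" for z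
      using scaled_finite[OF that s(1)] by simp
    have "oscillation R s + 2 * intF (\<lambda>z. ?u z * ballint R ?u z)
        = intF (\<lambda>z. \<integral>\<^sup>+w. kern R z w * ennreal ((enn2real (?u z) - enn2real (?u w))\<^sup>2)
            + kern R z w * (2 * (?u z * ?u w)) \<partial>\<mu>)"
    proof -
      have "(\<integral>\<^sup>+w. kern R z w * (2 * (?u z * ?u w)) \<partial>\<mu>) = 2 * (?u z * ballint R ?u z)" for z
        unfolding ballint_def
        by (subst nn_integral_cmult[symmetric] | simp add: mult_ac)+
      thus ?thesis unfolding oscillation_def
        by (simp add: nn_integral_add intF_add[symmetric] intF_cmult[symmetric])
    qed
    also have "\<dots> = intF (\<lambda>z. \<integral>\<^sup>+w. kern R z w * (?u z)\<^sup>2 + kern R z w * (?u w)\<^sup>2 \<partial>\<mu>)"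
    proof (intro intF_cong nn_integral_poincare_cong)
      fix z w assume zw: "z \<in> \<H>" "w \<in> \<H>"
      define x y where "x = enn2real (?u z)" "y = enn2real (?u w)"
      have xy: "?u z = ennreal x" "?u w = ennreal y" "x \<ge> 0" "y \<ge> 0"
        using fin zw by (auto simp: x_y_def)
      have "ennreal ((x - y)\<^sup>2) + 2 * (ennreal x * ennreal y) = ennreal ((x - y)\<^sup>2 + 2 * (x * y))"
        using xy by (simp add: ennreal_mult)
      also have "(x - y)\<^sup>2 + 2 * (x * y) = x\<^sup>2 + y\<^sup>2" by (simp add: power2_eq_square algebra_simps)
      finally have "ennreal ((x - y)\<^sup>2) + 2 * (ennreal x * ennreal y) = (ennreal x)\<^sup>2 + (ennreal y)\<^sup>2"
        using xy by (simp add: ennreal_power)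
      thus "kern R z w * ennreal ((enn2real (?u z) - enn2real (?u w))\<^sup>2) + kern R z w * (2 * (?u z * ?u w))
          = kern R z w * (?u z)\<^sup>2 + kern R z w * (?u w)\<^sup>2"
        unfolding x_y_def[symmetric] xy(1,2)
        using xy(3,4) by (simp add: distrib_left[symmetric])
    qed
    also have "\<dots> = intF (\<lambda>z. ennreal (lamr R 0) * (?u z)\<^sup>2 + ballint R (\<lambda>w. (?u w)\<^sup>2) z)"
    proof (intro intF_cong)
      fix z assume z: "z \<in> \<H>"
      have "(\<integral>\<^sup>+w. kern R z w * (?u z)\<^sup>2 + kern R z w * (?u w)\<^sup>2 \<partial>\<mu>)
          = (\<integral>\<^sup>+w. kern R z w * (?u z)\<^sup>2 \<partial>\<mu>) + ballint R (\<lambda>w. (?u w)\<^sup>2) z"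
        unfolding ballint_def by (rule nn_integral_add) auto
      also have "(\<integral>\<^sup>+w. kern R z w * (?u z)\<^sup>2 \<partial>\<mu>) = ballint R (\<lambda>w. 1) z * (?u z)\<^sup>2"
        unfolding ballint_def by (subst nn_integral_multc) auto
      finally show "(\<integral>\<^sup>+w. kern R z w * (?u z)\<^sup>2 + kern R z w * (?u w)\<^sup>2 \<partial>\<mu>)
          = ennreal (lamr R 0) * (?u z)\<^sup>2 + ballint R (\<lambda>w. (?u w)\<^sup>2) z"
        using z R by (simp add: lam_0 lam_eq)
    qed
    also have "\<dots> = ennreal (lamr R 0) * intF (\<lambda>z. (?u z)\<^sup>2) + intF (ballint R (\<lambda>w. (?u w)\<^sup>2))"
      by (simp add: intF_add intF_cmult)
    also have "intF (ballint R (\<lambda>w. (?u w)\<^sup>2)) = ennreal (lamr R 0) * intF (\<lambda>z. (?u z)\<^sup>2)"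
      unfolding intF_def using R by (intro integral_ballint) (auto simp: scaled_act)
    also have "ennreal (lamr R 0) * intF (\<lambda>z. (?u z)\<^sup>2) + ennreal (lamr R 0) * intF (\<lambda>z. (?u z)\<^sup>2)
        \<le> ennreal (lamr R s) * intF (\<lambda>z. (?u z)\<^sup>2) + ennreal (lamr R s) * intF (\<lambda>z. (?u z)\<^sup>2)"
      using lamr_ge[of R s] R s by (intro add_mono mult_right_mono ennreal_leI) auto
    also have "\<dots> = 2 * (ennreal (lamr R s) * intF (\<lambda>z. (?u z)\<^sup>2))" by (simp add: mult_2)
    also have "ennreal (lamr R s) * intF (\<lambda>z. (?u z)\<^sup>2) = intF (\<lambda>z. ennreal (lamr R s) * (?u z * ?e z) + ?u z * ballint R ?u z)"
    proof -
      have "ennreal (lamr R s) * (?u z)\<^sup>2 = ennreal (lamr R s) * (?u z * ?e z) + ?u z * ballint R ?u z" if "z \<in> \<H>" for z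
      proof -
        have "ennreal (lamr R s) * (ennreal (1 / lamr R s) * ballint R ?u z) = ballint R ?u z"
          using lam by (simp add: mult.assoc[symmetric] flip: ennreal_mult)
        moreover have "(?u z)\<^sup>2 = ?u z * (?e z + ennreal (1 / lamr R s) * ballint R ?u z)"
          unfolding power2_eq_square using scaled_eq[OF that R, of s] s by simp
        moreover have "ennreal (lamr R s) * (?u z * (?e z + ennreal (1 / lamr R s) * ballint R ?u z))
            = ennreal (lamr R s) * (?u z * ?e z) + ?u z * (ennreal (lamr R s) * (ennreal (1 / lamr R s) * ballint R ?u z))"
          by (simp only: distrib_left mult_ac)
        ultimately show ?thesis by (simp only:)
      qed
      thus ?thesis by (subst intF_cmult[symmetric]) (auto intro!: intF_cong)
    qed
    also have "2 * \<dots> = 2 * (ennreal (lamr R s) * intF (\<lambda>z. ?u z * ?e z)) + 2 * intF (\<lambda>z. ?u z * ballint R ?u z)"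
      by (simp add: intF_add intF_cmult distrib_left)
    finally have ineq: "oscillation R s + 2 * intF (\<lambda>z. ?u z * ballint R ?u z)
        \<le> 2 * (ennreal (lamr R s) * intF (\<lambda>z. ?u z * ?e z)) + 2 * intF (\<lambda>z. ?u z * ballint R ?u z)" .
    \<comment> \<open>The mean square of \<open>u\<close> is finite, which allows the common term on both sides to be cancelled.\<close>
    have "2 * intF (\<lambda>z. ?u z * ballint R ?u z) \<noteq> \<infinity>"
    proof -
      have "?u z * ballint R ?u z \<le> ennreal (lamr R s) * (?u z)\<^sup>2" if "z \<in> \<H>" for z
      proof -
        have "ballint R ?u z = ennreal (lamr R s) * (ennreal (1 / lamr R s) * ballint R ?u z)"
          using lam by (simp add: mult.assoc[symmetric] flip: ennreal_mult)
        also have "\<dots> \<le> ennreal (lamr R s) * ?u z"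
          using scaled_eq[OF that R, of s] s by (intro mult_left_mono) (auto simp: le_iff_add add.commute)
        finally have "?u z * ballint R ?u z \<le> ?u z * (ennreal (lamr R s) * ?u z)" by (rule mult_left_mono) simp
        thus ?thesis by (simp add: power2_eq_square mult_ac)
      qed
      hence "intF (\<lambda>z. ?u z * ballint R ?u z) \<le> intF (\<lambda>z. ennreal (lamr R s) * (?u z)\<^sup>2)" by (rule intF_mono)
      also have "\<dots> = ennreal (lamr R s) * intF (\<lambda>z. (?u z)\<^sup>2)" by (rule intF_cmult) simp
      also have "\<dots> < \<infinity>" using B(2)[OF s] by (auto simp: ennreal_mult_less_top intro: le_less_trans)
      finally show ?thesis by (simp add: ennreal_mult_eq_top_iff)
    qed
    hence "oscillation R s \<le> 2 * (ennreal (lamr R s) * intF (\<lambda>z. ?u z * ?e z))"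
      using ineq by (simp add: ennreal_add_left_cancel_le add.commute[of _ "2 * intF (\<lambda>z. ?u z * ballint R ?u z)"])
    also have "\<dots> \<le> 2 * (ennreal L * (ennreal ((s - 1) / 2 * real N) * 2))"
    proof (intro mult_left_mono mult_mono ennreal_leI L)
      have "intF (\<lambda>z. ?u z * ?e z) \<le> intF (\<lambda>z. ennreal ((s - 1) / 2 * real N) * ?u z)"
      proof (rule intF_mono)
        fix z assume z: "z \<in> \<H>"
        have "?e z \<le> ennreal ((s - 1) / 2) * ennreal (real N)" using N[OF z, of s] s by (intro mult_left_mono) auto
        also have "\<dots> = ennreal ((s - 1) / 2 * real N)" by (rule ennreal_mult[symmetric]) (use s in auto)
        finally have "?u z * ?e z \<le> ?u z * ennreal ((s - 1) / 2 * real N)" by (rule mult_left_mono) simp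
        thus "?u z * ?e z \<le> ennreal ((s - 1) / 2 * real N) * ?u z" by (simp add: mult.commute)
      qed
      also have "\<dots> = ennreal ((s - 1) / 2 * real N) * intF ?u" by (rule intF_cmult) simp
      also have "intF ?u \<le> ennreal 2" unfolding intF_scaled[OF s(1)] using s by (intro ennreal_leI) (simp add: field_simps)
      finally show "intF (\<lambda>z. ?u z * ?e z) \<le> ennreal ((s - 1) / 2 * real N) * 2" by (simp add: mult_left_mono)
    qed auto
    also have "\<dots> = ennreal (2 * (L * ((s - 1) / 2 * real N * 2)))"
    proof -
      have lin: "2 * (ennreal x * (ennreal y * 2)) = ennreal (2 * (x * (y * 2)))" if "0 \<le> x" "0 \<le> y" for x y
      proof -
        have "2 * (ennreal x * (ennreal y * 2)) = (2 * 2) * (ennreal x * ennreal y)" by (simp only: mult_ac)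
        also have "\<dots> = ennreal (2 * (x * (y * 2)))" using that by (simp add: ennreal_mult)
        finally show ?thesis .
      qed
      show ?thesis by (rule lin) (use s in \<open>auto simp: L_def lamr_nonneg\<close>)
    qed
    also have "2 * (L * ((s - 1) / 2 * real N * 2)) = 2 * L * real N * (s - 1)" by simp
    finally show "oscillation R s \<le> ennreal (2 * L * real N * (s - 1))" .
  qed
qed

end

section \<open>The limit along the real axis\<close>

context cusp_group
begin

text \<open>
  The conjugate of the unit translation by an element taking \<open>z\<close> to a point at height \<open>y\<close> moves \<open>z\<close> by a
  distance that determines \<open>y\<close>, and only finitely many group elements move \<open>z\<close> by a bounded distance.
\<close>

lemma heights_bounded:
  assumes z: "z \<in> \<H>"
  obtains Y where "Y \<ge> 1" "\<And>A. A \<in> \<Gamma> \<Longrightarrow> Im (act A z) \<le> Y"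
proof -
  define X where "X = {C \<in> \<Gamma>. near 1 z (act C z)}"
  have fin: "finite X" unfolding X_def by (rule finite_near[OF z z]) simp
  define q where "q = (\<lambda>C. Im z * Im (act C z) / (cmod (z - act C z))\<^sup>2)"
  have q0: "q C \<ge> 0" if "C \<in> \<Gamma>" for C
    using z act_upper[OF in_SL2[OF that] z] by (simp add: q_def upper_iff)
  have sum0: "sum q X \<ge> 0" by (rule sum_nonneg) (simp add: X_def q0)
  show thesis
  proof (rule that[of "1 + sum q X"])
    show "1 \<le> 1 + sum q X" using sum0 by simp
    fix A assume A: "A \<in> \<Gamma>"
    define w where "w = act A z"
    have w: "w \<in> \<H>" using act_upper[OF in_SL2[OF A] z] by (simp add: w_def)
    show "Im (act A z) \<le> 1 + sum q X"
    proof (cases "Im w \<le> 1")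
      case True
      thus ?thesis using sum0 by (simp add: w_def)
    next
      case False
      define C where "C = adj A ** (shift 1 ** A)"
      have C: "C \<in> \<Gamma>" unfolding C_def by (intro mult_closed adj_closed shift_closed A)
      have w1: "w + 1 \<in> \<H>" using w by (simp add: upper_iff)
      have "act C z = act (adj A) (w + 1)"
        using A z in_SL2[OF A] by (simp add: C_def act_mult SL2_mult adj_SL2 act_shift act_upper w_def)
      hence AC: "act A (act C z) = w + 1" using w1 by (simp add: act_adj_cancel in_SL2 A)
      have Cz: "act C z \<in> \<H>" by (rule act_upper[OF in_SL2[OF C] z])
      have near: "near R z (act C z) \<longleftrightarrow> 1 \<le> R * (Im w)\<^sup>2" for R
        using near_act[OF in_SL2[OF A] z Cz, of R] unfolding AC w_def[symmetric]
        by (simp add: near_def power2_eq_square mult.assoc)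
      have w2: "Im w \<le> (Im w)\<^sup>2" "1 \<le> (Im w)\<^sup>2"
        using False by (auto simp: power2_eq_square intro: order_trans[OF _ mult_left_mono[of 1 "Im w" "Im w"]])
      have "\<not> near 0 z (act C z)" using near[of 0] by simp
      hence pos: "(cmod (z - act C z))\<^sup>2 > 0" by (simp add: near_def)
      have "near (1 / (Im w)\<^sup>2) z (act C z)" using near w2 False by simp
      hence le: "(cmod (z - act C z))\<^sup>2 \<le> Im z * Im (act C z) / (Im w)\<^sup>2" by (simp add: near_def)
      have "(Im w)\<^sup>2 > 0" using w2 by linarith
      hence "(cmod (z - act C z))\<^sup>2 * (Im w)\<^sup>2 \<le> Im z * Im (act C z)"
        using le by (simp only: pos_le_divide_eq)
      hence "(Im w)\<^sup>2 \<le> q C" using pos by (simp add: q_def pos_le_divide_eq mult.commute)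
      moreover have "C \<in> X" using C near[of 1] w2 by (simp add: X_def)
      hence "q C \<le> sum q X" using fin q0 by (intro member_le_sum) (auto simp: X_def)
      ultimately show ?thesis using w2 by (simp add: w_def)
    qed
  qed
qed

lemma finite_high_reps:
  assumes z: "z \<in> \<H>"
  shows "finite {t \<in> reps. Im (act t z) \<ge> 1}"
proof -
  obtain Y where Y: "Y \<ge> 1" "\<And>A. A \<in> \<Gamma> \<Longrightarrow> Im (act A z) \<le> Y"
    by (rule heights_bounded[OF z]) (rule that)
  have "Y > 0" using Y by simp
  then obtain N :: nat where N: "\<And>w. w \<in> \<H> \<Longrightarrow> theta (indicator (band Y)) w \<le> ennreal (real N)"
    by (rule theta_band_bounded) (rule that)
  let ?X = "{t \<in> reps. Im (act t z) \<ge> 1}"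
  have "emeasure (count_space reps) ?X = (\<integral>\<^sup>+t. indicator ?X t \<partial>count_space reps)"
    by (rule nn_integral_indicator[symmetric]) auto
  also have "\<dots> \<le> theta (indicator (band Y)) z"
    unfolding theta_def
  proof (rule nn_integral_mono)
    fix t assume "t \<in> space (count_space reps)"
    hence "Im (act t z) \<le> Y" using Y(2) reps_closed by simp
    moreover have "1 / Y \<le> 1" using Y by simp
    ultimately show "indicator ?X t \<le> (indicator (band Y) (act t z) :: ennreal)"
      by (auto simp: indicator_def band_def)
  qed
  also have "\<dots> < \<infinity>" using N[OF z] by (auto intro: le_less_trans)
  finally have lt: "emeasure (count_space reps) ?X < \<infinity>" .
  show ?thesis
  proof (rule ccontr)
    assume "infinite ?X"
    hence "emeasure (count_space reps) ?X = \<infinity>" by (intro emeasure_count_space_infinite) auto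
    thus False using lt by simp
  qed
qed

end

context cusp_group_domain
begin

lemma intF_scaled_le: "1 < s \<Longrightarrow> s \<le> 2 \<Longrightarrow> intF (scaled s) \<le> ennreal 2"
  unfolding intF_scaled by (intro ennreal_leI) (simp add: field_simps)

text \<open>
  The mean of \<^const>\<open>scaled\<close> over a fixed ball and its mean over a bounded set \<open>K\<close> differ by an average of \<open>u(w) - u(z)\<close> over pairs at bounded
  distance, which is small by \<open>oscillation_bound\<close> for a radius that is large enough for all these pairs.
\<close>

lemma comparison:
  assumes z0: "z0 \<in> \<H>" and K [measurable]: "K \<in> sets borel" and KF: "K \<subseteq> F"
    and bounded: "\<And>w. w \<in> K \<Longrightarrow> near r z0 w" and r: "r \<ge> 1"
  obtains C where "C \<ge> 0" "emeasure \<mu> K < \<infinity>"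
    "\<And>s. 1 < s \<Longrightarrow> s \<le> 2 \<Longrightarrow>
      \<bar>measure \<mu> K * enn2real (ballint 1 (scaled s) z0)
        - lamr 1 0 * enn2real (\<integral>\<^sup>+z. indicator K z * scaled s z \<partial>\<mu>)\<bar> \<le> C * sqrt (s - 1)"
proof -
  have r0: "r \<ge> 0" using r by simp
  obtain a c where ac: "c > 0" "\<And>w. w \<in> \<H> \<Longrightarrow> near r z0 w \<Longrightarrow> w \<in> rect a c"
    by (rule near_rect[OF z0 r0]) (rule that)
  define R where "R = max 1 ((4 * a\<^sup>2 + c\<^sup>2) * c\<^sup>2)"
  have R: "R \<ge> 1" by (simp add: R_def)
  have near: "near R z w" if zw: "z \<in> K" "w \<in> \<H>" "near 1 z0 w" for z w
  proof -
    have zH: "z \<in> \<H>" using zw KF F_upper by auto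
    have z: "z \<in> rect a c" by (rule ac(2)[OF zH bounded[OF zw(1)]])
    have "near r z0 w"
    proof -
      have "1 * (Im z0 * Im w) \<le> r * (Im z0 * Im w)" using r z0 zw(2) by (intro mult_right_mono) (auto simp: upper_iff)
      thus ?thesis using zw(3) by (simp add: near_def mult.assoc)
    qed
    hence w: "w \<in> rect a c" by (rule ac(2)[OF zw(2)])
    have "\<bar>Re z - Re w\<bar> \<le> 2 * a" using z w by (auto simp: rect_def)
    hence 1: "(Re z - Re w)\<^sup>2 \<le> (2 * a)\<^sup>2" by (rule power2_le_iff_abs_le[THEN iffD2, rotated]) (use z in \<open>auto simp: rect_def\<close>)
    have "\<bar>Im z - Im w\<bar> \<le> c" using z w zH zw(2) by (auto simp: rect_def upper_iff)
    hence 2: "(Im z - Im w)\<^sup>2 \<le> c\<^sup>2" by (rule power2_le_iff_abs_le[THEN iffD2, rotated]) (use ac in auto)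
    have "(cmod (z - w))\<^sup>2 \<le> (2 * a)\<^sup>2 + c\<^sup>2" using 1 2 by (simp add: cmod_power2)
    also have "\<dots> = (4 * a\<^sup>2 + c\<^sup>2) * c\<^sup>2 * ((1 / c) * (1 / c))" using ac(1) by (simp add: power2_eq_square)
    also have "\<dots> \<le> R * (Im z * Im w)"
      using z w ac(1) zH zw(2) by (intro mult_mono) (auto simp: rect_def R_def upper_iff)
    finally show ?thesis by (simp add: near_def mult.assoc)
  qed
  have Ksub: "K \<subseteq> rect a c" using ac(2) bounded KF F_upper by blast
  have Kfin: "emeasure \<mu> K < \<infinity>"
    using emeasure_mono[OF Ksub, of \<mu>] rect_finite[OF ac(1), of a] by (auto intro: le_less_trans)
  define V where "V = measure \<mu> K"
  have V: "emeasure \<mu> K = ennreal V" "V \<ge> 0"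
    using Kfin by (auto simp: V_def intro!: emeasure_eq_ennreal_measure)
  obtain D where D: "D \<ge> 0" "\<And>s. 1 < s \<Longrightarrow> s \<le> 2 \<Longrightarrow> oscillation R s \<le> ennreal (D * (s - 1))"
    by (rule oscillation_bound[OF R]) (rule that)
  obtain M :: nat where M: "\<forall>h\<in>borel_measurable borel. (\<forall>A\<in>\<Gamma>. \<forall>z\<in>\<H>. h (act A z) = h z)
      \<longrightarrow> ballint 1 h z0 \<le> ennreal (real M) * intF h"
    using ballint_le_intF[OF z0 zero_le_one] ..
  have m: "lamr 1 0 > 0" by (rule lamr_0_pos) simp
  show thesis
  proof (rule that[of "V * lamr 1 0 / 2 + D / 2"])
    show "0 \<le> V * lamr 1 0 / 2 + D / 2" using V m D by simp
    show "emeasure \<mu> K < \<infinity>" by (rule Kfin)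
    fix s :: real assume s: "1 < s" "s \<le> 2"
    \<comment> \<open>In \<open>\<bar>x\<bar> \<le> e / 2 + x\<^sup>2 / (2 e)\<close> this choice of \<open>e\<close> balances the constant against an oscillation of order \<open>s - 1\<close>.\<close>
    define e where "e = sqrt (s - 1)"
    have e: "e > 0" "e * e = s - 1" using s by (auto simp: e_def)
    let ?u = "scaled s"
    define P where "P = ballint 1 ?u z0"
    define I where "I = (\<integral>\<^sup>+z. indicator K z * ?u z \<partial>\<mu>)"
    let ?d = "\<lambda>z w. \<bar>enn2real (?u z) - enn2real (?u w)\<bar>"
    define E where "E = (\<integral>\<^sup>+z. \<integral>\<^sup>+w. indicator K z * kern 1 z0 w * ennreal (?d z w) \<partial>\<mu> \<partial>\<mu>)"
    have fin: "?u z = ennreal (enn2real (?u z))" if "z \<in> \<H>" for z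
      using scaled_finite[OF that s(1)] by simp
    have "P \<le> ennreal (real M) * intF ?u" using M by (simp add: P_def scaled_act)
    also have "\<dots> < \<infinity>" using intF_scaled_le[OF s] by (auto simp: ennreal_mult_less_top intro: le_less_trans)
    finally have Pfin: "P < \<infinity>" .
    have "I \<le> intF ?u" unfolding I_def intF_def using KF by (intro nn_integral_mono) (auto simp: indicator_def)
    also have "\<dots> \<le> ennreal 2" by (rule intF_scaled_le[OF s])
    also have "\<dots> < \<infinity>" by simp
    finally have Ifin: "I < \<infinity>" .
    have ballK: "(\<integral>\<^sup>+w. indicator K z * kern 1 z0 w * c \<partial>\<mu>) = indicator K z * (ennreal (lamr 1 0) * c)" for z c
    proof -
      have "(\<integral>\<^sup>+w. indicator K z * kern 1 z0 w * c \<partial>\<mu>) = (\<integral>\<^sup>+w. (indicator K z * c) * (kern 1 z0 w * 1) \<partial>\<mu>)"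
        by (simp add: mult_ac)
      also have "\<dots> = (indicator K z * c) * ballint 1 (\<lambda>w. 1) z0"
        unfolding ballint_def by (rule nn_integral_cmult) simp
      finally show ?thesis using z0 by (simp add: lam_0 lam_eq mult_ac)
    qed
    have dbl1: "(\<integral>\<^sup>+z. \<integral>\<^sup>+w. indicator K z * kern 1 z0 w * ?u z \<partial>\<mu> \<partial>\<mu>) = ennreal (lamr 1 0) * I"
    proof -
      have "(\<integral>\<^sup>+z. \<integral>\<^sup>+w. indicator K z * kern 1 z0 w * ?u z \<partial>\<mu> \<partial>\<mu>)
          = (\<integral>\<^sup>+z. ennreal (lamr 1 0) * (indicator K z * ?u z) \<partial>\<mu>)"
        unfolding ballK by (simp add: mult_ac)
      thus ?thesis unfolding I_def by (simp add: nn_integral_cmult)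
    qed
    have dbl2: "(\<integral>\<^sup>+z. \<integral>\<^sup>+w. indicator K z * kern 1 z0 w * ?u w \<partial>\<mu> \<partial>\<mu>) = ennreal V * P"
    proof -
      have "(\<integral>\<^sup>+w. indicator K z * kern 1 z0 w * ?u w \<partial>\<mu>) = indicator K z * P" for z
        unfolding P_def ballint_def by (subst nn_integral_cmult[symmetric]) (auto simp: mult_ac)
      hence "(\<integral>\<^sup>+z. \<integral>\<^sup>+w. indicator K z * kern 1 z0 w * ?u w \<partial>\<mu> \<partial>\<mu>)
          = (\<integral>\<^sup>+z. P * indicator K z \<partial>\<mu>)" by (simp add: mult.commute)
      also have "\<dots> = P * emeasure \<mu> K" by (rule nn_integral_cmult_indicator) simp
      finally show ?thesis by (simp add: V mult.commute)
    qed
    have split: "(\<integral>\<^sup>+z. \<integral>\<^sup>+w. indicator K z * kern 1 z0 w * f z w \<partial>\<mu> \<partial>\<mu>)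
       \<le> (\<integral>\<^sup>+z. \<integral>\<^sup>+w. indicator K z * kern 1 z0 w * g z w \<partial>\<mu> \<partial>\<mu>) + E"
      if f: "\<And>z w. z \<in> \<H> \<Longrightarrow> w \<in> \<H> \<Longrightarrow> f z w \<le> g z w + ennreal (?d z w)"
        and [measurable]: "(\<lambda>(z, w). g z w) \<in> borel_measurable (borel \<Otimes>\<^sub>M borel)" for f g
    proof -
      have "(\<integral>\<^sup>+z. \<integral>\<^sup>+w. indicator K z * kern 1 z0 w * f z w \<partial>\<mu> \<partial>\<mu>)
         \<le> (\<integral>\<^sup>+z. \<integral>\<^sup>+w. indicator K z * kern 1 z0 w * g z w + indicator K z * kern 1 z0 w * ennreal (?d z w) \<partial>\<mu> \<partial>\<mu>)"
        by (intro nn_integral_poincare_mono) (simp add: distrib_left[symmetric] mult_left_mono f)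
      also have "\<dots> = (\<integral>\<^sup>+z. (\<integral>\<^sup>+w. indicator K z * kern 1 z0 w * g z w \<partial>\<mu>)
           + (\<integral>\<^sup>+w. indicator K z * kern 1 z0 w * ennreal (?d z w) \<partial>\<mu>) \<partial>\<mu>)"
        by (intro nn_integral_cong nn_integral_add) measurable
      also have "\<dots> = (\<integral>\<^sup>+z. \<integral>\<^sup>+w. indicator K z * kern 1 z0 w * g z w \<partial>\<mu> \<partial>\<mu>) + E"
        unfolding E_def by (intro nn_integral_add) measurable
      finally show ?thesis .
    qed
    have Ele: "E \<le> ennreal ((V * lamr 1 0 / 2 + D / 2) * e)"
    proof -
      have pt: "indicator K z * kern 1 z0 w * ennreal (?d z w)
          \<le> indicator K z * kern 1 z0 w * ennreal (e / 2) + ennreal (1 / (2 * e)) * (indicator F z * (kern R z w * ennreal ((enn2real (?u z) - enn2real (?u w))\<^sup>2)))"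
        if "z \<in> \<H>" "w \<in> \<H>" for z w
      proof (cases "z \<in> K \<and> near 1 z0 w")
        case True
        define x where "x = ?d z w"
        have "0 \<le> (x - e)\<^sup>2 / (2 * e)" using e by simp
        also have "\<dots> = e / 2 + 1 / (2 * e) * x\<^sup>2 - x" using e(1) by (simp add: field_simps power2_eq_square)
        finally have "ennreal x \<le> ennreal (e / 2 + 1 / (2 * e) * x\<^sup>2)" by (intro ennreal_leI) simp
        also have "\<dots> = ennreal (e / 2) + ennreal (1 / (2 * e)) * ennreal (x\<^sup>2)"
        proof -
          have lin: "ennreal (x + y * z) = ennreal x + ennreal y * ennreal z" if "0 \<le> x" "0 \<le> y" "0 \<le> z" for x y z
            using that by (simp add: ennreal_mult)
          show ?thesis by (rule lin) (use e(1) in auto)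
        qed
        also have "x\<^sup>2 = (enn2real (?u z) - enn2real (?u w))\<^sup>2" by (simp add: x_def)
        finally show ?thesis using True KF near[of z w] that by (auto simp: kern_def x_def)
      qed (auto simp: kern_def)
      have "E \<le> (\<integral>\<^sup>+z. \<integral>\<^sup>+w. indicator K z * kern 1 z0 w * ennreal (e / 2)
          + ennreal (1 / (2 * e)) * (indicator F z * (kern R z w * ennreal ((enn2real (?u z) - enn2real (?u w))\<^sup>2))) \<partial>\<mu> \<partial>\<mu>)"
        unfolding E_def by (intro nn_integral_poincare_mono pt)
      also have "\<dots> = (\<integral>\<^sup>+z. indicator K z * (ennreal (lamr 1 0) * ennreal (e / 2))
          + ennreal (1 / (2 * e)) * (indicator F z * (\<integral>\<^sup>+w. kern R z w * ennreal ((enn2real (?u z) - enn2real (?u w))\<^sup>2) \<partial>\<mu>)) \<partial>\<mu>)"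
        by (intro nn_integral_cong, subst nn_integral_add) (auto simp: ballK nn_integral_cmult)
      also have "\<dots> = (\<integral>\<^sup>+z. indicator K z * (ennreal (lamr 1 0) * ennreal (e / 2)) \<partial>\<mu>) + ennreal (1 / (2 * e)) * oscillation R s"
        unfolding oscillation_def intF_def by (subst nn_integral_add) (auto simp: nn_integral_cmult)
      also have "(\<integral>\<^sup>+z. indicator K z * (ennreal (lamr 1 0) * ennreal (e / 2)) \<partial>\<mu>) = (ennreal (lamr 1 0) * ennreal (e / 2)) * ennreal V"
        unfolding V(1)[symmetric] by (subst nn_integral_cmult_indicator[symmetric]) (auto simp: mult.commute)
      also have "\<dots> + ennreal (1 / (2 * e)) * oscillation R s
          \<le> (ennreal (lamr 1 0) * ennreal (e / 2)) * ennreal V + ennreal (1 / (2 * e)) * ennreal (D * (s - 1))"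
        by (intro add_left_mono mult_left_mono D(2)[OF s]) simp
      also have "\<dots> = ennreal (lamr 1 0 * (e / 2) * V + 1 / (2 * e) * (D * (s - 1)))"
      proof -
        have lin: "(ennreal x * ennreal y) * ennreal z + ennreal x' * ennreal y' = ennreal (x * y * z + x' * y')"
          if "0 \<le> x" "0 \<le> y" "0 \<le> z" "0 \<le> x'" "0 \<le> y'" for x y z x' y'
          using that by (simp add: ennreal_mult)
        show ?thesis by (rule lin) (use m e V D s in auto)
      qed
      also have "lamr 1 0 * (e / 2) * V + 1 / (2 * e) * (D * (s - 1)) = (V * lamr 1 0 / 2 + D / 2) * e"
        unfolding e(2)[symmetric] using e(1) by (simp add: field_simps)
      finally show ?thesis .
    qed
    have dist: "a \<le> b + ennreal \<bar>enn2real b - enn2real a\<bar>" if "a < \<infinity>" "b < \<infinity>" for a b :: ennreal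
      using that by (cases a; cases b) (auto simp flip: ennreal_plus intro!: ennreal_leI)
    have "ennreal V * P \<le> ennreal (lamr 1 0) * I + E"
      unfolding dbl1[symmetric] dbl2[symmetric]
    proof (rule split)
      fix z w assume "z \<in> \<H>" "w \<in> \<H>"
      thus "?u w \<le> ?u z + ennreal (?d z w)"
        by (intro dist scaled_finite s)
    qed simp
    moreover have "ennreal (lamr 1 0) * I \<le> ennreal V * P + E"
      unfolding dbl1[symmetric] dbl2[symmetric]
    proof (rule split)
      fix z w assume "z \<in> \<H>" "w \<in> \<H>"
      thus "?u z \<le> ?u w + ennreal (?d z w)"
        by (subst abs_minus_commute) (intro dist scaled_finite s)
    qed simp
    ultimately have 1: "ennreal V * P \<le> ennreal (lamr 1 0) * I + ennreal ((V * lamr 1 0 / 2 + D / 2) * e)"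
      and 2: "ennreal (lamr 1 0) * I \<le> ennreal V * P + ennreal ((V * lamr 1 0 / 2 + D / 2) * e)"
      using Ele by (auto intro: order_trans add_left_mono)
    obtain p i where pi: "P = ennreal p" "p \<ge> 0" "I = ennreal i" "i \<ge> 0"
      using Pfin Ifin by (cases P; cases I) auto
    have E0: "(V * lamr 1 0 / 2 + D / 2) * e \<ge> 0" using V m D e by simp
    have "V * p \<le> lamr 1 0 * i + (V * lamr 1 0 / 2 + D / 2) * e"
      using 1 V m pi E0 by (simp flip: ennreal_mult ennreal_plus)
    moreover have "lamr 1 0 * i \<le> V * p + (V * lamr 1 0 / 2 + D / 2) * e"
      using 2 V m pi E0 by (simp flip: ennreal_mult ennreal_plus)
    ultimately have "\<bar>V * p - lamr 1 0 * i\<bar> \<le> (V * lamr 1 0 / 2 + D / 2) * e" by linarith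
    thus "\<bar>measure \<mu> K * enn2real (ballint 1 ?u z0)
        - lamr 1 0 * enn2real (\<integral>\<^sup>+z. indicator K z * ?u z \<partial>\<mu>)\<bar> \<le> (V * lamr 1 0 / 2 + D / 2) * sqrt (s - 1)"
      using pi unfolding P_def I_def V_def e_def by simp
  qed
qed

text \<open>
  Uniform integrability, from the pointwise bound \<open>u \<le> t / 2 + u\<^sup>2 / (2 t)\<close>.
\<close>

lemma tail_bound:
  assumes [measurable]: "K \<in> sets borel" and t: "t > 0" and B: "B \<ge> 0" "intF (\<lambda>z. (scaled s z)\<^sup>2) \<le> ennreal B"
    and d: "emeasure \<mu> (F - K) \<le> ennreal d" "d \<ge> 0"
  shows "(\<integral>\<^sup>+z. indicator (F - K) z * scaled s z \<partial>\<mu>) \<le> ennreal (t / 2 * d + B / (2 * t))"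
proof -
  have pt: "x \<le> ennreal (t / 2) + ennreal (1 / (2 * t)) * x\<^sup>2" for x
  proof (cases x)
    case (real r)
    have "0 \<le> (r - t)\<^sup>2 / (2 * t)" using t by simp
    also have "\<dots> = t / 2 + 1 / (2 * t) * r\<^sup>2 - r" using t by (simp add: field_simps power2_eq_square)
    finally have "ennreal r \<le> ennreal (t / 2 + 1 / (2 * t) * r\<^sup>2)" by (intro ennreal_leI) simp
    also have "\<dots> = ennreal (t / 2) + ennreal (1 / (2 * t)) * ennreal (r\<^sup>2)"
    proof -
      have lin: "ennreal (x + y * z) = ennreal x + ennreal y * ennreal z" if "0 \<le> x" "0 \<le> y" "0 \<le> z" for x y z
        using that by (simp add: ennreal_mult)
      show ?thesis by (rule lin) (use t in auto)
    qed
    finally show ?thesis using real by (simp add: ennreal_power)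
  next
    case top
    thus ?thesis using t by (simp add: power2_eq_square ennreal_mult_top)
  qed
  have "(\<integral>\<^sup>+z. indicator (F - K) z * scaled s z \<partial>\<mu>)
      \<le> (\<integral>\<^sup>+z. ennreal (t / 2) * indicator (F - K) z + ennreal (1 / (2 * t)) * (indicator F z * (scaled s z)\<^sup>2) \<partial>\<mu>)"
    using pt by (intro nn_integral_mono) (auto simp: indicator_def)
  also have "\<dots> = ennreal (t / 2) * emeasure \<mu> (F - K) + ennreal (1 / (2 * t)) * intF (\<lambda>z. (scaled s z)\<^sup>2)"
    unfolding intF_def by (subst nn_integral_add) (auto simp: nn_integral_cmult)
  also have "\<dots> \<le> ennreal (t / 2) * ennreal d + ennreal (1 / (2 * t)) * ennreal B"
    using B(2) d(1) by (intro add_mono mult_left_mono) auto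
  also have "\<dots> = ennreal (t / 2 * d + B / (2 * t))"
  proof -
    have "ennreal (t / 2) * ennreal d + ennreal (1 / (2 * t)) * ennreal B = ennreal (t / 2 * d + 1 / (2 * t) * B)"
      by (rule ennreal_add_mult) (use t B d in auto)
    thus ?thesis by simp
  qed
  finally show ?thesis .
qed

definition ball_mean :: "complex \<Rightarrow> real \<Rightarrow> real" where
  "ball_mean z0 s = enn2real (ballint 1 (scaled s) z0) / lamr 1 0"

text \<open>
  The parameter starts at 1 because \<open>comparison\<close> requires that \<open>r \<ge> 1\<close>.
\<close>

definition exhaust :: "complex \<Rightarrow> nat \<Rightarrow> complex set" where
  "exhaust z0 n = {w \<in> F. near (real (Suc n)) z0 w}"

lemma exhaust_measurable [measurable]: "exhaust z0 n \<in> sets borel"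
  unfolding exhaust_def near_def by measurable

lemma exhaust_incseq:
  assumes "z0 \<in> \<H>"
  shows "incseq (exhaust z0)"
proof (rule incseq_SucI, rule subsetI)
  fix n w assume w: "w \<in> exhaust z0 n"
  hence "Im w > 0" using F_upper by (auto simp: exhaust_def upper_iff)
  hence "real (Suc n) * (Im z0 * Im w) \<le> real (Suc (Suc n)) * (Im z0 * Im w)"
    using assms by (intro mult_right_mono) (auto simp: upper_iff)
  thus "w \<in> exhaust z0 (Suc n)" using w by (simp add: exhaust_def near_def mult.assoc)
qed

lemma exhaust_UN:
  assumes "z0 \<in> \<H>"
  shows "(\<Union>n. exhaust z0 n) = F"
proof (intro equalityI subsetI)
  fix w assume w: "w \<in> F"
  have pos: "Im z0 * Im w > 0" using assms w F_upper by (auto simp: upper_iff)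
  obtain n :: nat where "(cmod (z0 - w))\<^sup>2 / (Im z0 * Im w) \<le> real n" using real_arch_simple by blast
  hence "(cmod (z0 - w))\<^sup>2 / (Im z0 * Im w) \<le> real (Suc n)" by simp
  hence "(cmod (z0 - w))\<^sup>2 \<le> real (Suc n) * (Im z0 * Im w)"
    using pos by (simp only: pos_divide_le_eq)
  hence "w \<in> exhaust z0 n" using w by (simp add: exhaust_def near_def mult.assoc)
  thus "w \<in> (\<Union>n. exhaust z0 n)" by blast
qed (auto simp: exhaust_def)

lemma ball_mean_nonneg: "ball_mean z0 s \<ge> 0"
  by (simp add: ball_mean_def lamr_nonneg)

lemma ball_mean_bounded:
  assumes z0: "z0 \<in> \<H>"
  obtains M where "M \<ge> 0" "\<And>s. 1 < s \<Longrightarrow> s \<le> 2 \<Longrightarrow> ball_mean z0 s \<le> M"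
    "\<And>s. 1 < s \<Longrightarrow> s \<le> 2 \<Longrightarrow> ballint 1 (scaled s) z0 < \<infinity>"
proof -
  obtain M :: nat where M: "\<forall>h\<in>borel_measurable borel. (\<forall>A\<in>\<Gamma>. \<forall>z\<in>\<H>. h (act A z) = h z)
      \<longrightarrow> ballint 1 h z0 \<le> ennreal (real M) * intF h"
    using ballint_le_intF[OF z0 zero_le_one] ..
  have le: "ballint 1 (scaled s) z0 \<le> ennreal (real M * 2)" if s: "1 < s" "s \<le> 2" for s
  proof -
    have "ballint 1 (scaled s) z0 \<le> ennreal (real M) * intF (scaled s)" using M by (simp add: scaled_act)
    also have "\<dots> \<le> ennreal (real M) * ennreal 2" by (rule mult_left_mono[OF intF_scaled_le[OF s]]) simp
    also have "\<dots> = ennreal (real M * 2)" by (rule ennreal_mult[symmetric]) auto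
    finally show ?thesis .
  qed
  show thesis
  proof (rule that[of "real M * 2 / lamr 1 0"])
    fix s :: real assume s: "1 < s" "s \<le> 2"
    have "enn2real (ballint 1 (scaled s) z0) \<le> real M * 2"
      by (rule enn2real_leI) (use le[OF s] in auto)
    thus "ball_mean z0 s \<le> real M * 2 / lamr 1 0"
      unfolding ball_mean_def by (intro divide_right_mono lamr_nonneg)
    show "ballint 1 (scaled s) z0 < \<infinity>" using le[OF s] by (auto intro: le_less_trans)
  qed (simp add: lamr_nonneg)
qed

lemma ball_mean_comparison:
  assumes z0: "z0 \<in> \<H>"
  obtains C where "C \<ge> 0" "emeasure \<mu> (exhaust z0 n) < \<infinity>"
    "\<And>s. 1 < s \<Longrightarrow> s \<le> 2 \<Longrightarrow>
      \<bar>measure \<mu> (exhaust z0 n) * ball_mean z0 s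
        - enn2real (\<integral>\<^sup>+z. indicator (exhaust z0 n) z * scaled s z \<partial>\<mu>)\<bar> \<le> C * sqrt (s - 1)"
proof -
  have m: "lamr 1 0 > 0" by (rule lamr_0_pos) simp
  obtain C where C: "C \<ge> 0" "emeasure \<mu> (exhaust z0 n) < \<infinity>"
    "\<And>s. 1 < s \<Longrightarrow> s \<le> 2 \<Longrightarrow>
      \<bar>measure \<mu> (exhaust z0 n) * enn2real (ballint 1 (scaled s) z0)
        - lamr 1 0 * enn2real (\<integral>\<^sup>+z. indicator (exhaust z0 n) z * scaled s z \<partial>\<mu>)\<bar> \<le> C * sqrt (s - 1)"
    by (rule comparison[OF z0 exhaust_measurable, of z0 n "real (Suc n)"])
      (simp_all add: exhaust_def subset_iff)
  show thesis
  proof (rule that[of "C / lamr 1 0"])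
    show "C / lamr 1 0 \<ge> 0" using C(1) m by simp
    show "emeasure \<mu> (exhaust z0 n) < \<infinity>" by (rule C(2))
    fix s :: real assume s: "1 < s" "s \<le> 2"
    define I where "I = enn2real (\<integral>\<^sup>+z. indicator (exhaust z0 n) z * scaled s z \<partial>\<mu>)"
    define V where "V = measure \<mu> (exhaust z0 n)"
    have "enn2real (ballint 1 (scaled s) z0) = lamr 1 0 * ball_mean z0 s" using m by (simp add: ball_mean_def)
    hence "\<bar>lamr 1 0 * (V * ball_mean z0 s - I)\<bar> \<le> C * sqrt (s - 1)"
      using C(3)[OF s] by (simp add: I_def V_def algebra_simps)
    hence "lamr 1 0 * \<bar>V * ball_mean z0 s - I\<bar> \<le> C * sqrt (s - 1)" using m by (simp add: abs_mult)
    hence "\<bar>V * ball_mean z0 s - I\<bar> \<le> C / lamr 1 0 * sqrt (s - 1)" using m by (simp add: field_simps)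
    thus "\<bar>measure \<mu> (exhaust z0 n) * ball_mean z0 s
        - enn2real (\<integral>\<^sup>+z. indicator (exhaust z0 n) z * scaled s z \<partial>\<mu>)\<bar> \<le> C / lamr 1 0 * sqrt (s - 1)"
      by (simp add: I_def V_def)
  qed
qed

lemma eventually_at_right_1: "eventually (\<lambda>s :: real. 1 < s \<and> s \<le> 2) (at_right 1)"
  by (auto simp: eventually_at_right_field intro!: exI[of _ 2])

lemma small_sqrt: "e > 0 \<Longrightarrow> eventually (\<lambda>s. C * sqrt (s - 1) < e) (at_right (1 :: real))"
proof -
  assume e: "e > 0"
  have "((\<lambda>s. C * sqrt (s - 1)) \<longlongrightarrow> C * sqrt (1 - 1)) (at_right (1 :: real))"
    by (intro tendsto_intros)
  thus ?thesis using e by (intro order_tendstoD(2)) auto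
qed

lemma small_mass: "e > 0 \<Longrightarrow> eventually (\<lambda>s. (s - 1) / s < e) (at_right (1 :: real))"
proof -
  assume e: "e > 0"
  have "((\<lambda>s. (s - 1) / s) \<longlongrightarrow> (1 - 1) / 1) (at_right (1 :: real))"
    by (intro tendsto_intros) auto
  thus ?thesis using e by (intro order_tendstoD(2)) auto
qed

lemma exhaust_mass_le:
  assumes s: "1 < s"
  shows "enn2real (\<integral>\<^sup>+z. indicator (exhaust z0 n) z * scaled s z \<partial>\<mu>) \<le> 1 + (s - 1) / s"
proof (rule enn2real_leI)
  have "(\<integral>\<^sup>+z. indicator (exhaust z0 n) z * scaled s z \<partial>\<mu>) \<le> intF (scaled s)"
    unfolding intF_def by (intro nn_integral_mono) (auto simp: indicator_def exhaust_def)
  thus "(\<integral>\<^sup>+z. indicator (exhaust z0 n) z * scaled s z \<partial>\<mu>) \<le> ennreal (1 + (s - 1) / s)"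
    unfolding intF_scaled[OF s] .
qed (use s in auto)

text \<open>
  The mean over the ball, multiplied by the volume of any bounded part of the quotient, is asymptotically at most the total mass 1,
  and these volumes are unbounded.
\<close>

lemma ball_mean_tendsto_infinite:
  assumes z0: "z0 \<in> \<H>" and inf: "emeasure \<mu> F = \<infinity>"
  shows "(ball_mean z0 \<longlongrightarrow> 0) (at_right 1)"
proof (rule tendstoI)
  fix e :: real assume e: "e > 0"
  have "(\<lambda>n. emeasure \<mu> (exhaust z0 n)) \<longlonglongrightarrow> \<infinity>"
    using Lim_emeasure_incseq[of "exhaust z0" \<mu>] exhaust_incseq[OF z0] exhaust_UN[OF z0] inf
    by (auto simp: image_subset_iff)
  hence "eventually (\<lambda>n. ennreal (3 / e) < emeasure \<mu> (exhaust z0 n)) sequentially"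
    by (rule order_tendstoD(1)) simp
  then obtain n where n: "ennreal (3 / e) < emeasure \<mu> (exhaust z0 n)"
    by (auto simp: eventually_sequentially)
  obtain C where C: "C \<ge> 0" "emeasure \<mu> (exhaust z0 n) < \<infinity>"
    "\<And>s. 1 < s \<Longrightarrow> s \<le> 2 \<Longrightarrow>
      \<bar>measure \<mu> (exhaust z0 n) * ball_mean z0 s
        - enn2real (\<integral>\<^sup>+z. indicator (exhaust z0 n) z * scaled s z \<partial>\<mu>)\<bar> \<le> C * sqrt (s - 1)"
    by (rule ball_mean_comparison[OF z0, of n]) (rule that)
  define V where "V = measure \<mu> (exhaust z0 n)"
  have "ennreal (3 / e) < ennreal V"
    using n C(2) by (simp add: V_def emeasure_eq_ennreal_measure)
  hence V: "3 / e < V" using e by (simp add: ennreal_less_iff)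
  have "0 < 3 / e" using e by simp
  hence V0: "V > 0" using V by linarith
  show "eventually (\<lambda>s. dist (ball_mean z0 s) 0 < e) (at_right 1)"
    using eventually_at_right_1 small_sqrt[OF zero_less_one, of C] small_mass[OF zero_less_one]
  proof eventually_elim
    case (elim s)
    have "V * ball_mean z0 s < 3"
    proof -
      have s: "1 < s" "s \<le> 2" using elim(1) by auto
      show ?thesis using C(3)[OF s] exhaust_mass_le[OF s(1), of z0 n] elim(2,3) unfolding V_def by linarith
    qed
    hence "ball_mean z0 s < 3 / V" using V0 by (simp add: field_simps)
    also have "3 / V < e" using V V0 e by (simp add: field_simps)
    finally show ?case using ball_mean_nonneg[of z0 s] by simp
  qed
qed

text \<open>
  The part of the quotient outside a large ball has small volume, hence by \<open>tail_bound\<close> small mass; on the rest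
  \<open>u\<close> is asymptotically equal to its mean over the fixed ball.
\<close>

lemma ball_mean_tendsto_finite:
  assumes z0: "z0 \<in> \<H>" and fin: "emeasure \<mu> F < \<infinity>"
  shows "((\<lambda>s. ball_mean z0 s * measure \<mu> F) \<longlongrightarrow> 1) (at_right 1)"
proof (rule tendstoI)
  fix e' :: real assume e': "e' > 0"
  define e where "e = e' / 4"
  have e: "e > 0" using e' by (simp add: e_def)
  define V where "V = measure \<mu> F"
  obtain M where M: "M \<ge> 0" "\<And>s. 1 < s \<Longrightarrow> s \<le> 2 \<Longrightarrow> ball_mean z0 s \<le> M"
    by (rule ball_mean_bounded[OF z0]) (rule that)
  obtain B where B: "B \<ge> 0" "\<And>s. 1 < s \<Longrightarrow> s \<le> 2 \<Longrightarrow> intF (\<lambda>z. (scaled s z)\<^sup>2) \<le> ennreal B"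
    by (rule intF_scaled_square) (rule that)
  \<comment> \<open>Large enough that the contribution of the mean square in \<open>tail_bound\<close> is at most \<open>e / 2\<close>.\<close>
  define t where "t = B / e + 1"
  have t: "t > 0" "B / (2 * t) \<le> e / 2"
  proof -
    show "t > 0" using B e by (simp add: t_def add_nonneg_pos)
    moreover have "B \<le> e * t" using e by (simp add: t_def field_simps)
    ultimately show "B / (2 * t) \<le> e / 2" by (simp add: field_simps)
  qed
  have "(\<lambda>n. measure \<mu> (exhaust z0 n)) \<longlonglongrightarrow> V"
    using Lim_measure_incseq[of "exhaust z0" \<mu>] exhaust_incseq[OF z0] exhaust_UN[OF z0] fin
    by (auto simp: image_subset_iff V_def)
  moreover have "V - e / (M + t) < V" using M t e by (simp add: add_nonneg_pos)
  ultimately have "eventually (\<lambda>n. V - e / (M + t) < measure \<mu> (exhaust z0 n)) sequentially"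
    by (rule order_tendstoD(1))
  then obtain n where n: "V - e / (M + t) < measure \<mu> (exhaust z0 n)"
    by (auto simp: eventually_sequentially)
  obtain C where C: "C \<ge> 0" "emeasure \<mu> (exhaust z0 n) < \<infinity>"
    "\<And>s. 1 < s \<Longrightarrow> s \<le> 2 \<Longrightarrow>
      \<bar>measure \<mu> (exhaust z0 n) * ball_mean z0 s
        - enn2real (\<integral>\<^sup>+z. indicator (exhaust z0 n) z * scaled s z \<partial>\<mu>)\<bar> \<le> C * sqrt (s - 1)"
    by (rule ball_mean_comparison[OF z0, of n]) (rule that)
  define W where "W = measure \<mu> (exhaust z0 n)"
  define d where "d = V - W"
  have sub: "exhaust z0 n \<subseteq> F" by (auto simp: exhaust_def)
  have d0: "d \<ge> 0" unfolding d_def V_def W_def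
    using measure_mono_fmeasurable[OF sub, of \<mu>] fin by (auto simp: fmeasurable_def)
  have "emeasure \<mu> (F - exhaust z0 n) = ennreal d"
    using C(2) fin sub by (subst emeasure_Diff)
      (auto simp: d_def V_def W_def emeasure_eq_ennreal_measure ennreal_minus)
  hence em: "emeasure \<mu> (F - exhaust z0 n) \<le> ennreal d" by simp
  have "d < e / (M + t)" using n by (simp add: d_def W_def)
  hence "d * (M + t) < e" using M t by (simp add: field_simps add_nonneg_pos)
  hence "M * d + t * d < e" by (simp add: algebra_simps)
  moreover have "0 \<le> M * d" "0 \<le> t * d" using M(1) t(1) d0 by auto
  ultimately have Md: "M * d < e" "t * d < e" by linarith+
  show "eventually (\<lambda>s. dist (ball_mean z0 s * measure \<mu> F) 1 < e') (at_right 1)"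
    using eventually_at_right_1 small_sqrt[OF e, of C] small_mass[OF e]
  proof eventually_elim
    case (elim s)
    hence s: "1 < s" "s \<le> 2" by auto
    define p I where "p = ball_mean z0 s" "I = enn2real (\<integral>\<^sup>+z. indicator (exhaust z0 n) z * scaled s z \<partial>\<mu>)"
    define J where "J = (\<integral>\<^sup>+z. indicator (F - exhaust z0 n) z * scaled s z \<partial>\<mu>)"
    have J: "J \<le> ennreal (t / 2 * d + B / (2 * t))"
      unfolding J_def by (rule tail_bound[OF exhaust_measurable t(1) B(1) B(2)[OF s] em d0])
    have tot: "ennreal (1 + (s - 1) / s) = (\<integral>\<^sup>+z. indicator (exhaust z0 n) z * scaled s z \<partial>\<mu>) + J"
    proof -
      have "intF (scaled s) = (\<integral>\<^sup>+z. indicator (exhaust z0 n) z * scaled s z + indicator (F - exhaust z0 n) z * scaled s z \<partial>\<mu>)"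
        unfolding intF_def using sub by (intro nn_integral_cong) (auto simp: indicator_def)
      also have "\<dots> = (\<integral>\<^sup>+z. indicator (exhaust z0 n) z * scaled s z \<partial>\<mu>) + J"
        unfolding J_def by (rule nn_integral_add) auto
      finally show ?thesis by (simp add: intF_scaled[OF s(1)])
    qed
    have "(\<integral>\<^sup>+z. indicator (exhaust z0 n) z * scaled s z \<partial>\<mu>) < \<infinity>"
    proof -
      have "(\<integral>\<^sup>+z. indicator (exhaust z0 n) z * scaled s z \<partial>\<mu>) \<le> ennreal (1 + (s - 1) / s)"
        unfolding tot by simp
      also have "\<dots> < \<infinity>" by simp
      finally show ?thesis .
    qed
    hence I: "(\<integral>\<^sup>+z. indicator (exhaust z0 n) z * scaled s z \<partial>\<mu>) = ennreal I" "I \<ge> 0"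
      by (auto simp: p_I_def)
    have "ennreal (1 + (s - 1) / s) \<le> ennreal I + ennreal (t / 2 * d + B / (2 * t))"
      unfolding tot I(1) by (rule add_left_mono[OF J])
    also have "\<dots> = ennreal (I + (t / 2 * d + B / (2 * t)))"
      using I(2) t(1) d0 B(1) by (subst ennreal_plus) auto
    finally have "1 + (s - 1) / s \<le> I + (t / 2 * d + B / (2 * t))"
      using I(2) t(1) d0 B(1) by (subst (asm) ennreal_le_iff) auto
    moreover have "0 \<le> (s - 1) / s" using s by simp
    moreover have "t / 2 * d = (t * d) / 2" by simp
    ultimately have Ilow: "1 - e \<le> I" using t(2) Md(2) by linarith
    have Iup: "I \<le> 1 + e" using exhaust_mass_le[OF s(1), of z0 n] elim by (simp add: p_I_def)
    have cmp: "\<bar>W * p - I\<bar> < e" using C(3)[OF s] elim by (simp add: W_def p_I_def)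
    have pd: "0 \<le> p * d" "p * d < e"
    proof -
      show "0 \<le> p * d" using d0 ball_mean_nonneg by (simp add: p_I_def)
      have "p * d \<le> M * d" using M(2)[OF s] d0 by (intro mult_right_mono) (auto simp: p_I_def)
      thus "p * d < e" using Md(1) by linarith
    qed
    have "p * V = W * p + p * d" by (simp add: d_def algebra_simps)
    hence "\<bar>p * V - 1\<bar> < 4 * e" using cmp Ilow Iup pd by linarith
    thus ?case by (simp add: dist_real_def p_I_def V_def e_def)
  qed
qed

text \<open>
  The real-valued measure of a set of infinite measure is 0, and so is the inverse of 0; with these conventions both cases have the same limit.
\<close>

lemma ball_mean_tendsto:
  assumes z0: "z0 \<in> \<H>"
  shows "(ball_mean z0 \<longlongrightarrow> inverse (measure \<mu> F)) (at_right 1)"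
proof (cases "emeasure \<mu> F = \<infinity>")
  case True
  thus ?thesis using ball_mean_tendsto_infinite[OF z0] by (simp add: measure_def)
next
  case False
  hence lim: "((\<lambda>s. ball_mean z0 s * measure \<mu> F) \<longlongrightarrow> 1) (at_right 1)"
    by (intro ball_mean_tendsto_finite[OF z0]) (simp add: less_top)
  have V: "measure \<mu> F \<noteq> 0"
  proof
    assume "measure \<mu> F = 0"
    hence "((\<lambda>s :: real. 0 :: real) \<longlongrightarrow> 1) (at_right 1)" using lim by simp
    thus False by (simp add: tendsto_const_iff)
  qed
  have "((\<lambda>s. ball_mean z0 s * measure \<mu> F / measure \<mu> F) \<longlongrightarrow> 1 / measure \<mu> F) (at_right 1)"
    by (rule tendsto_divide[OF lim tendsto_const V])
  thus ?thesis using V by (simp add: inverse_eq_divide)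
qed

end

lemma has_sum_of_nn_integral:
  fixes f :: "'a \<Rightarrow> real"
  assumes nonneg: "\<And>x. x \<in> A \<Longrightarrow> f x \<ge> 0"
    and fin: "(\<integral>\<^sup>+x. ennreal (f x) \<partial>count_space A) < \<infinity>"
  shows "(f has_sum enn2real (\<integral>\<^sup>+x. ennreal (f x) \<partial>count_space A)) A"
proof -
  have AE: "AE x in count_space A. 0 \<le> f x" using nonneg by (simp add: AE_count_space)
  have int: "integrable (count_space A) f"
    using fin by (intro integrableI_nonneg AE) auto
  hence abs: "Infinite_Set_Sum.abs_summable_on f A" by (simp add: Infinite_Set_Sum.abs_summable_on_def)
  have "infsum f A = infsetsum f A" using infsetsum_infsum[OF abs] by simp
  also have "\<dots> = enn2real (\<integral>\<^sup>+x. ennreal (f x) \<partial>count_space A)"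
    unfolding infsetsum_def by (rule integral_eq_nn_integral[OF _ AE]) simp
  finally have "infsum f A = enn2real (\<integral>\<^sup>+x. ennreal (f x) \<partial>count_space A)" .
  moreover have "f summable_on A"
    using abs abs_summable_equivalent abs_summable_summable by blast
  ultimately show ?thesis by (metis has_sum_infsum)
qed

context cusp_group_domain
begin

text \<open>
  The eigenvalue equation expresses the value at a point by the mean over the ball about it and an error of order \<open>s - 1\<close>.
\<close>

lemma scaled_tendsto:
  assumes z: "z \<in> \<H>"
  shows "((\<lambda>s. enn2real (scaled s z)) \<longlongrightarrow> inverse (measure \<mu> F)) (at_right 1)"
proof -
  obtain N :: nat where N: "\<And>w (s :: real). w \<in> \<H> \<Longrightarrow> s \<ge> 1 \<Longrightarrow> theta (source 1 s) w \<le> ennreal (real N)"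
    by (rule theta_source_bounded[of 1]) (simp, rule that)
  obtain M where M: "\<And>s. 1 < s \<Longrightarrow> s \<le> 2 \<Longrightarrow> ballint 1 (scaled s) z < \<infinity>"
    by (rule ball_mean_bounded[OF z]) (rule that)
  define a where "a = (\<lambda>s. (s - 1) / 2 * enn2real (theta (source 1 s) z))"
  have m: "lamr 1 0 > 0" by (rule lamr_0_pos) simp
  have eq: "enn2real (scaled s z) = a s + lamr 1 0 / lamr 1 s * ball_mean z s" if s: "1 < s \<and> s \<le> 2" for s
  proof -
    have lam: "lamr 1 s > 0" using lamr_pos[of 1 s] s by simp
    have th: "theta (source 1 s) z = ennreal (enn2real (theta (source 1 s) z))"
      using N[OF z, of s] s by (auto simp: le_less_trans[OF _ ennreal_less_top])
    have ba: "ballint 1 (scaled s) z = ennreal (lamr 1 0 * ball_mean z s)"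
      using M[of s] s m by (simp add: ball_mean_def)
    have "scaled s z = ennreal ((s - 1) / 2) * ennreal (enn2real (theta (source 1 s) z)) + ennreal (1 / lamr 1 s) * ennreal (lamr 1 0 * ball_mean z s)"
      using scaled_eq[OF z, of 1 s] s unfolding th[symmetric] ba by simp
    also have "\<dots> = ennreal ((s - 1) / 2 * enn2real (theta (source 1 s) z) + 1 / lamr 1 s * (lamr 1 0 * ball_mean z s))"
      by (rule ennreal_add_mult) (use s m lam in \<open>auto simp: ball_mean_nonneg\<close>)
    finally have sc: "scaled s z = ennreal (a s + lamr 1 0 / lamr 1 s * ball_mean z s)" by (simp add: a_def)
    have "a s + lamr 1 0 / lamr 1 s * ball_mean z s \<ge> 0" using s m lam by (simp add: a_def ball_mean_nonneg)
    thus ?thesis unfolding sc by (rule enn2real_ennreal)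
  qed
  have a0: "(a \<longlongrightarrow> 0) (at_right 1)"
  proof (rule tendsto_sandwich)
    show "eventually (\<lambda>s. 0 \<le> a s) (at_right 1)"
      using eventually_at_right_1 by eventually_elim (simp add: a_def)
    show "eventually (\<lambda>s. a s \<le> (s - 1) / 2 * real N) (at_right 1)"
      using eventually_at_right_1
    proof eventually_elim
      case (elim s)
      have "enn2real (theta (source 1 s) z) \<le> real N" using N[OF z, of s] elim by (intro enn2real_leI) auto
      thus ?case unfolding a_def using elim by (intro mult_left_mono) auto
    qed
    have "((\<lambda>s. (s - 1) / 2 * real N) \<longlongrightarrow> (1 - 1) / 2 * real N) (at_right (1 :: real))"
      by (intro tendsto_intros) auto
    thus "((\<lambda>s. (s - 1) / 2 * real N) \<longlongrightarrow> 0) (at_right (1 :: real))" by simp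
  qed auto
  have "((\<lambda>s. a s + lamr 1 0 / lamr 1 s * ball_mean z s) \<longlongrightarrow> 0 + lamr 1 0 / lamr 1 0 * inverse (measure \<mu> F)) (at_right 1)"
    using m by (intro tendsto_intros a0 lamr_tendsto ball_mean_tendsto[OF z]) auto
  hence "((\<lambda>s. a s + lamr 1 0 / lamr 1 s * ball_mean z s) \<longlongrightarrow> inverse (measure \<mu> F)) (at_right 1)"
    using m by simp
  moreover have "eventually (\<lambda>s. a s + lamr 1 0 / lamr 1 s * ball_mean z s = enn2real (scaled s z)) (at_right 1)"
    using eventually_at_right_1 by eventually_elim (simp add: eq)
  ultimately show ?thesis by (rule Lim_transform_eventually)
qed

definition power_sum :: "complex \<Rightarrow> real \<Rightarrow> ennreal" where
  "power_sum z s = theta (\<lambda>w. ennreal (Im w powr s)) z"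

text \<open>
  The sums of \<open>y\<^sup>s\<close> and of \<^const>\<open>gfun\<close> differ only in the terms of height at least 1, of which there are finitely many, of bounded height.
\<close>

lemma power_sum_split:
  assumes z: "z \<in> \<H>"
  obtains X Y where "finite X" "Y \<ge> 1"
    "\<And>s. s \<ge> 1 \<Longrightarrow> theta (gfun s) z \<le> power_sum z s"
    "\<And>s. s \<ge> 1 \<Longrightarrow> power_sum z s \<le> theta (gfun s) z + ennreal (real (card (X :: mat2 set)) * Y powr s)"
proof -
  obtain Y where Y: "Y \<ge> 1" "\<And>A. A \<in> \<Gamma> \<Longrightarrow> Im (act A z) \<le> Y"
    by (rule heights_bounded[OF z]) (rule that)
  define X where "X = {t \<in> reps. Im (act t z) \<ge> 1}"
  have X: "finite X" "X \<subseteq> reps" unfolding X_def using finite_high_reps[OF z] by auto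
  show thesis
  proof (rule that[of X Y])
    fix s :: real assume s: "s \<ge> 1"
    show "theta (gfun s) z \<le> power_sum z s"
      unfolding power_sum_def gfun_def by (intro theta_mono z ennreal_leI) simp
    have "power_sum z s \<le> (\<integral>\<^sup>+t. gfun s (act t z) + ennreal (Y powr s) * indicator X t \<partial>count_space reps)"
      unfolding power_sum_def theta_def
    proof (rule nn_integral_mono)
      fix t assume "t \<in> space (count_space reps)"
      hence t: "t \<in> reps" "act t z \<in> \<H>" "Im (act t z) \<le> Y"
        using reps_closed in_SL2 act_upper[OF _ z] Y(2) by auto
      show "ennreal (Im (act t z) powr s) \<le> gfun s (act t z) + ennreal (Y powr s) * indicator X t"
      proof (cases "Im (act t z) \<ge> 1")
        case True
        have "Im (act t z) powr s \<le> Y powr s" using t True s by (intro powr_mono2) auto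
        thus ?thesis using True t by (simp add: X_def add_increasing ennreal_leI)
      next
        case False
        thus ?thesis using gfun_low[OF t(2) _ s] by simp
      qed
    qed
    also have "\<dots> = theta (gfun s) z + ennreal (Y powr s) * emeasure (count_space reps) X"
      unfolding theta_def using X by (subst nn_integral_add) (auto simp: nn_integral_cmult_indicator)
    also have "emeasure (count_space reps) X = ennreal (real (card X))"
      using X by (simp add: emeasure_count_space_finite ennreal_of_nat_eq_real_of_nat)
    also have "ennreal (Y powr s) * ennreal (real (card X)) = ennreal (real (card X) * Y powr s)"
      by (subst mult.commute, rule ennreal_mult[symmetric]) auto
    finally show "power_sum z s \<le> theta (gfun s) z + ennreal (real (card X) * Y powr s)" .
  qed (use X Y in auto)
qed

lemma theta_gfun_finite:
  assumes "z \<in> \<H>" "s > 1"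
  shows "theta (gfun s) z < \<infinity>"
  using scaled_finite[OF assms] assms(2) by (auto simp: scaled_def ennreal_mult_less_top)

lemma power_sum_finite:
  assumes "z \<in> \<H>" "s > 1"
  shows "power_sum z s < \<infinity>"
proof -
  obtain X Y where XY: "finite X" "Y \<ge> 1"
    "\<And>s. s \<ge> 1 \<Longrightarrow> theta (gfun s) z \<le> power_sum z s"
    "\<And>s. s \<ge> 1 \<Longrightarrow> power_sum z s \<le> theta (gfun s) z + ennreal (real (card (X :: mat2 set)) * Y powr s)"
    by (rule power_sum_split[OF assms(1)]) (rule that)
  have "power_sum z s \<le> theta (gfun s) z + ennreal (real (card X) * Y powr s)" using XY(4) assms by simp
  also have "\<dots> < \<infinity>" using theta_gfun_finite[OF assms] by simp
  finally show ?thesis .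
qed

lemma power_sum_tendsto:
  assumes z: "z \<in> \<H>"
  shows "((\<lambda>s. (s - 1) / 2 * enn2real (power_sum z s)) \<longlongrightarrow> inverse (measure \<mu> F)) (at_right 1)"
proof -
  obtain X Y where XY: "finite X" "Y \<ge> 1"
    "\<And>s. s \<ge> 1 \<Longrightarrow> theta (gfun s) z \<le> power_sum z s"
    "\<And>s. s \<ge> 1 \<Longrightarrow> power_sum z s \<le> theta (gfun s) z + ennreal (real (card (X :: mat2 set)) * Y powr s)"
    by (rule power_sum_split[OF z]) (rule that)
  have sc: "enn2real (scaled s z) = (s - 1) / 2 * enn2real (theta (gfun s) z)" if "s > 1" for s
    using that by (simp add: scaled_def enn2real_mult)
  show ?thesis
  proof (rule tendsto_sandwich)
    show "eventually (\<lambda>s. enn2real (scaled s z) \<le> (s - 1) / 2 * enn2real (power_sum z s)) (at_right 1)"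
      using eventually_at_right_1
    proof eventually_elim
      case (elim s)
      have "enn2real (theta (gfun s) z) \<le> enn2real (power_sum z s)"
        using XY(3)[of s] power_sum_finite[OF z, of s] elim by (intro enn2real_mono) auto
      thus ?case using elim sc[of s] by (simp add: mult_left_mono)
    qed
    show "eventually (\<lambda>s. (s - 1) / 2 * enn2real (power_sum z s)
        \<le> enn2real (scaled s z) + (s - 1) / 2 * (real (card X) * Y powr s)) (at_right 1)"
      using eventually_at_right_1
    proof eventually_elim
      case (elim s)
      have fin: "theta (gfun s) z < \<infinity>" using theta_gfun_finite[OF z] elim by auto
      have "enn2real (power_sum z s) \<le> enn2real (theta (gfun s) z + ennreal (real (card X) * Y powr s))"
        using XY(4)[of s] fin elim by (intro enn2real_mono) auto
      also have "\<dots> = enn2real (theta (gfun s) z) + real (card X) * Y powr s"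
        using fin by (subst enn2real_plus) auto
      finally have "(s - 1) / 2 * enn2real (power_sum z s) \<le> (s - 1) / 2 * (enn2real (theta (gfun s) z) + real (card X) * Y powr s)"
        using elim by (intro mult_left_mono) auto
      thus ?case using elim sc[of s] by (simp add: distrib_left)
    qed
    show "((\<lambda>s. enn2real (scaled s z)) \<longlongrightarrow> inverse (measure \<mu> F)) (at_right 1)"
      by (rule scaled_tendsto[OF z])
    have "((\<lambda>s. enn2real (scaled s z) + (s - 1) / 2 * (real (card X) * Y powr s))
        \<longlongrightarrow> inverse (measure \<mu> F) + (1 - 1) / 2 * (real (card X) * Y powr 1)) (at_right 1)"
      using XY(2) by (intro tendsto_intros scaled_tendsto[OF z]) auto
    thus "((\<lambda>s. enn2real (scaled s z) + (s - 1) / 2 * (real (card X) * Y powr s))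
        \<longlongrightarrow> inverse (measure \<mu> F)) (at_right 1)" by simp
  qed
qed

section \<open>The Eisenstein series of a complex variable\<close>

definition real_series :: "complex \<Rightarrow> real \<Rightarrow> real" where
  "real_series z s = enn2real (power_sum z s)"

definition complex_series :: "complex \<Rightarrow> complex \<Rightarrow> complex" where
  "complex_series z s = (\<Sum>\<^sub>\<infinity>t\<in>reps. of_real (Im (act t z)) powr s)"

lemma real_series_has_sum:
  assumes "z \<in> \<H>" "s > 1"
  shows "((\<lambda>t. Im (act t z) powr s) has_sum real_series z s) reps"
  unfolding real_series_def power_sum_def theta_def
  by (rule has_sum_of_nn_integral) (use power_sum_finite[OF assms] in \<open>auto simp: power_sum_def theta_def\<close>)

lemma real_series_nonneg: "real_series z s \<ge> 0"
  by (simp add: real_series_def)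

lemma height_pos: "z \<in> \<H> \<Longrightarrow> t \<in> reps \<Longrightarrow> Im (act t z) > 0"
  using act_upper[of t z] reps_closed in_SL2 by (auto simp: upper_iff)

lemma norm_term:
  assumes "z \<in> \<H>" "t \<in> reps"
  shows "norm (of_real (Im (act t z)) powr s :: complex) = Im (act t z) powr Re s"
  using height_pos[OF assms] by (subst norm_powr_real_powr) auto

lemma complex_series_has_sum:
  assumes z: "z \<in> \<H>" and s: "Re s > 1"
  shows "((\<lambda>t. of_real (Im (act t z)) powr s) has_sum complex_series z s) reps"
proof -
  have "(\<lambda>t. Im (act t z) powr Re s) summable_on reps"
    using real_series_has_sum[OF z s] by (rule has_sum_imp_summable)
  hence "(\<lambda>t. norm (of_real (Im (act t z)) powr s :: complex)) summable_on reps"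
    by (rule summable_on_cong[THEN iffD1, rotated]) (simp add: norm_term z)
  hence "(\<lambda>t. of_real (Im (act t z)) powr s :: complex) summable_on reps"
    by (rule abs_summable_summable)
  thus ?thesis unfolding complex_series_def by (rule has_sum_infsum)
qed

lemma norm_complex_series_le:
  assumes z: "z \<in> \<H>" and s: "Re s > 1"
  shows "norm (complex_series z s) \<le> real_series z (Re s)"
  by (rule norm_infsum_le[OF complex_series_has_sum[OF z s] real_series_has_sum[OF z s]])
    (simp add: norm_term z)

lemma complex_series_of_real:
  assumes z: "z \<in> \<H>" and s: "s > 1"
  shows "complex_series z (of_real s) = of_real (real_series z s)"
proof -
  have "((\<lambda>t. complex_of_real (Im (act t z) powr s)) has_sum of_real (real_series z s)) reps"
    by (rule has_sum_of_real[OF real_series_has_sum[OF z s]])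
  moreover have "((\<lambda>t. complex_of_real (Im (act t z) powr s)) has_sum complex_series z (of_real s)) reps"
    using complex_series_has_sum[OF z, of "of_real s"] s height_pos[OF z]
    by (subst has_sum_cong[where g = "\<lambda>t. of_real (Im (act t z)) powr of_real s"]) (auto simp: powr_of_real less_imp_le)
  ultimately show ?thesis by (rule has_sum_unique[symmetric])
qed

lemma powr_between:
  assumes "y > (0 :: real)" "a \<le> x" "x \<le> b"
  shows "y powr x \<le> y powr a + y powr b"
proof (cases "y \<ge> 1")
  case True
  thus ?thesis using powr_mono[of x b y] assms by (simp add: add_increasing)
next
  case False
  thus ?thesis using powr_mono'[of a x y] assms by (simp add: add_increasing2)
qed

lemma complex_series_holomorphic:
  assumes z: "z \<in> \<H>"
  shows "complex_series z holomorphic_on {s. Re s > 1}"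
  unfolding holomorphic_on_def
proof (rule ballI)
  fix s :: complex assume "s \<in> {s. Re s > 1}"
  hence s: "Re s > 1" by simp
  define r where "r = (Re s - 1) / 2"
  have r: "r > 0" using s by (simp add: r_def)
  have re: "1 + r \<le> Re w" "Re w \<le> 1 + 3 * r" if "w \<in> cball s r" for w
  proof -
    have "\<bar>Re s - Re w\<bar> \<le> r" using that abs_Re_le_cmod[of "s - w"] by (simp add: dist_norm)
    moreover have "r * 2 = Re s - 1" by (simp add: r_def)
    ultimately show "1 + r \<le> Re w" "Re w \<le> 1 + 3 * r" by linarith+
  qed
  have unif: "uniform_limit (cball s r) (\<lambda>X w. \<Sum>t\<in>X. of_real (Im (act t z)) powr w) (complex_series z) (finite_subsets_at_top reps)"
    unfolding complex_series_def
  proof (rule Weierstrass_m_test_general)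
    fix t w assume t: "t \<in> reps" and w: "w \<in> cball s r"
    show "norm (of_real (Im (act t z)) powr w :: complex) \<le> Im (act t z) powr (1 + r) + Im (act t z) powr (1 + 3 * r)"
      unfolding norm_term[OF z t] by (rule powr_between[OF height_pos[OF z t] re[OF w]])
  next
    show "(\<lambda>t. Im (act t z) powr (1 + r) + Im (act t z) powr (1 + 3 * r)) summable_on reps"
      using r by (intro summable_on_add has_sum_imp_summable[OF real_series_has_sum[OF z]]) auto
  qed
  have hol: "(\<lambda>w. \<Sum>t\<in>X. of_real (Im (act t z)) powr w :: complex) holomorphic_on UNIV" if "X \<subseteq> reps" for X
    using that height_pos[OF z] by (intro holomorphic_intros) fastforce
  have "complex_series z holomorphic_on ball s r"
  proof (rule holomorphic_uniform_limit[OF _ unif])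
    show "\<forall>\<^sub>F X in finite_subsets_at_top reps. continuous_on (cball s r) (\<lambda>w. \<Sum>t\<in>X. of_real (Im (act t z)) powr w :: complex)
        \<and> (\<lambda>w. \<Sum>t\<in>X. of_real (Im (act t z)) powr w :: complex) holomorphic_on ball s r"
      using eventually_finite_subsets_at_top_weakI[of reps "\<lambda>X. X \<subseteq> reps"]
      by (rule eventually_mono) (auto intro: holomorphic_on_imp_continuous_on holomorphic_on_subset[OF hol])
  qed auto
  hence "complex_series z field_differentiable (at s)"
    by (rule holomorphic_on_imp_differentiable_at) (use r in auto)
  thus "complex_series z field_differentiable (at s within {s. Re s > 1})"
    by (rule field_differentiable_at_within)
qed

text \<open>
  Near 1 the function has a limit; away from 1 each term of the series is at most the sum of its values at the two ends of the interval.
\<close>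

lemma scaled_series_bounded:
  assumes z: "z \<in> \<H>"
  shows "\<exists>B. \<forall>x. 1 < x \<longrightarrow> x \<le> b \<longrightarrow> (x - 1) / 2 * real_series z x \<le> B"
proof -
  let ?L = "inverse (measure \<mu> F)"
  have "eventually (\<lambda>s. (s - 1) / 2 * real_series z s < ?L + 1) (at_right 1)"
    using power_sum_tendsto[OF z] unfolding real_series_def by (rule order_tendstoD(2)) simp
  then obtain d where d: "d > 1" "\<And>s. 1 < s \<Longrightarrow> s < d \<Longrightarrow> (s - 1) / 2 * real_series z s < ?L + 1"
    by (auto simp: eventually_at_right_field)
  define B where "B = ?L + 1 + \<bar>b\<bar> * (real_series z d + real_series z (max b d))"
  show ?thesis
  proof (intro exI allI impI)
    fix x assume x: "1 < x" "x \<le> b"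
    have B0: "0 \<le> \<bar>b\<bar> * (real_series z d + real_series z (max b d))" by (simp add: real_series_nonneg)
    show "(x - 1) / 2 * real_series z x \<le> B"
    proof (cases "x < d")
      case True
      thus ?thesis using d(2)[OF x(1)] B0 by (simp add: B_def)
    next
      case False
      have md: "max b d > 1" using d(1) by simp
      have "real_series z x \<le> real_series z d + real_series z (max b d)"
      proof (rule has_sum_mono[OF real_series_has_sum[OF z x(1)]
            has_sum_add[OF real_series_has_sum[OF z d(1)] real_series_has_sum[OF z md]]])
        fix t assume "t \<in> reps"
        thus "Im (act t z) powr x \<le> Im (act t z) powr d + Im (act t z) powr max b d"
          using False x by (intro powr_between height_pos z) auto
      qed
      hence "(x - 1) / 2 * real_series z x \<le> \<bar>b\<bar> * (real_series z d + real_series z (max b d))"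
        using x by (intro mult_mono) (auto simp: real_series_nonneg)
      thus ?thesis by (simp add: B_def add_increasing)
    qed
  qed
qed

end

text \<open>
  Rescaling around 1 turns the values of the function at points tending to 1 inside a sector into the values, at points
  of a fixed compact set, of a normal family that tends to a constant on the positive reals.
\<close>

lemma sector_limit:
  fixes h :: "complex \<Rightarrow> complex" and g :: "real \<Rightarrow> real"
  assumes hol: "h holomorphic_on {s. Re s > 1}"
    and bound: "\<And>s. Re s > 1 \<Longrightarrow> norm (h s) \<le> norm (s - 1) / (Re s - 1) * g (Re s)"
    and g: "\<And>b. \<exists>B. \<forall>x. 1 < x \<longrightarrow> x \<le> b \<longrightarrow> g x \<le> B"
    and lim: "((\<lambda>x. h (of_real x)) \<longlongrightarrow> L) (at_right 1)"
  shows "(h \<longlongrightarrow> L) (at 1 within U \<sigma>)"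
  unfolding tendsto_at_iff_sequentially
proof (intro allI impI, rule ccontr)
  fix X assume XU: "\<forall>i. X i \<in> U \<sigma> - {1}" and X1: "X \<longlonglongrightarrow> (1 :: complex)"
    and no: "\<not> (h \<circ> X) \<longlonglongrightarrow> L"
  obtain e where e: "e > 0" "\<And>N. \<exists>n\<ge>N. dist (h (X n)) L \<ge> e"
    using no unfolding lim_sequentially o_def by (auto simp: not_less)
  have inf: "infinite {n. dist (h (X n)) L \<ge> e}"
    unfolding infinite_nat_iff_unbounded_le using e(2) by auto
  define q where "q = enumerate {n. dist (h (X n)) L \<ge> e}"
  have q: "strict_mono q" "\<And>n. dist (h (X (q n))) L \<ge> e"
    using strict_mono_enumerate[OF inf] enumerate_in_set[OF inf] by (auto simp: q_def)
  define Y where "Y = X \<circ> q"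
  have Y1: "Y \<longlonglongrightarrow> 1" unfolding Y_def using X1 q(1) by (rule LIMSEQ_subseq_LIMSEQ)
  have YU: "Re (Y n) > 1" "cmod (Y n - 1) / (Re (Y n) - 1) < \<sigma>" for n
    using XU by (auto simp: Y_def U_def)
  define d where "d = (\<lambda>n. Re (Y n) - 1)"
  have d: "d n > 0" for n using YU by (simp add: d_def)
  have "(\<lambda>n. Re (Y n) - 1) \<longlonglongrightarrow> Re 1 - 1" by (intro tendsto_intros Y1)
  hence d0: "d \<longlonglongrightarrow> 0" by (simp add: d_def)
  obtain D where D: "\<And>n. d n \<le> D"
  proof -
    have "Bseq d" using d0 by (intro convergent_imp_Bseq convergentI)
    then obtain D where D: "\<And>n. norm (d n) \<le> D" by (auto simp: Bseq_def)
    have "d n \<le> D" for n using D[of n] d[of n] by simp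
    thus thesis by (rule that)
  qed
  have D0: "D > 0" using D[of 0] d[of 0] by simp
  define S where "S = {w. Re w > 0}"
  define f where "f = (\<lambda>n w. h (1 + of_real (d n) * w))"
  have S: "open S" "connected S"
    unfolding S_def using open_halfspace_Re_gt[of 0] convex_halfspace_Re_gt[of 0]
    by (auto intro: convex_connected)
  have fh: "f n holomorphic_on S" for n
    unfolding f_def
  proof (rule holomorphic_on_compose_gen[of "\<lambda>w. 1 + of_real (d n) * w" S h "{s. Re s > 1}", unfolded o_def])
    show "(\<lambda>w. 1 + of_real (d n) * w) ` S \<subseteq> {s. 1 < Re s}" using d[of n] by (auto simp: S_def)
  qed (auto intro!: holomorphic_intros hol)
  have fb: "\<exists>B. \<forall>k\<in>range f. \<forall>w\<in>K. norm (k w) \<le> B" if K: "compact K" "K \<subseteq> S" for K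
  proof (cases "K = {}")
    case False
    have "continuous_on K (\<lambda>w. norm w / Re w)"
      using K(2) by (intro continuous_intros) (auto simp: S_def)
    then obtain w1 where w1: "\<And>w. w \<in> K \<Longrightarrow> norm w / Re w \<le> norm w1 / Re w1"
      using continuous_attains_sup[OF K(1) False] by blast
    have "continuous_on K Re" by (intro continuous_intros)
    then obtain w2 where w2: "\<And>w. w \<in> K \<Longrightarrow> Re w \<le> Re w2"
      using continuous_attains_sup[OF K(1) False] by blast
    define c where "c = max 0 (norm w1 / Re w1)"
    obtain B where B: "\<And>x. 1 < x \<Longrightarrow> x \<le> 1 + D * Re w2 \<Longrightarrow> g x \<le> B" using g by blast
    show ?thesis
    proof (intro exI ballI)
      fix k w assume "k \<in> range f" and w: "w \<in> K"
      then obtain n where k: "k = f n" by auto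
      have rw: "Re w > 0" using w K by (auto simp: S_def)
      have r1: "Re (1 + of_real (d n) * w) > 1" using rw d[of n] by simp
      have "d n * Re w \<le> D * Re w2" using D[of n] D0 w2[OF w] rw by (intro mult_mono) auto
      hence gB: "g (Re (1 + of_real (d n) * w)) \<le> B" using r1 by (intro B) auto
      have "norm (k w) \<le> norm (of_real (d n) * w) / (d n * Re w) * g (Re (1 + of_real (d n) * w))"
        using bound[OF r1] by (simp add: k f_def)
      also have "norm (of_real (d n) * w) / (d n * Re w) = norm w / Re w"
        using d[of n] by (simp add: norm_mult)
      also have "norm w / Re w * g (Re (1 + of_real (d n) * w)) \<le> norm w / Re w * max 0 B"
        using gB rw by (intro mult_left_mono) auto
      also have "\<dots> \<le> c * max 0 B"
        using w1[OF w] by (intro mult_right_mono) (auto simp: c_def)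
      finally show "norm (k w) \<le> c * max 0 B" .
    qed
  qed auto
  obtain G r where G: "G holomorphic_on S" "strict_mono (r :: nat \<Rightarrow> nat)"
      "\<And>x. x \<in> S \<Longrightarrow> ((\<lambda>n. f (r n) x) \<longlongrightarrow> G x) sequentially"
      "\<And>K. compact K \<Longrightarrow> K \<subseteq> S \<Longrightarrow> uniform_limit K (f \<circ> r) G sequentially"
  proof (rule Montel[OF S(1), of "range f" f])
    show "k holomorphic_on S" if "k \<in> range f" for k using that fh by auto
    show "\<exists>B. \<forall>k\<in>range f. \<forall>w\<in>K. norm (k w) \<le> B" if "compact K" "K \<subseteq> S" for K using that by (rule fb)
    show "range f \<subseteq> range f" by (rule order_refl)
  qed (rule that)
  have Greal: "G (of_real x) = L" if x: "x > 0" for x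
  proof (rule LIMSEQ_unique)
    show "(\<lambda>n. f (r n) (of_real x)) \<longlonglongrightarrow> G (of_real x)" using x by (intro G(3)) (simp add: S_def)
    have "filterlim (\<lambda>n. 1 + d (r n) * x) (at_right 1) sequentially"
      unfolding filterlim_at
    proof
      have "(\<lambda>n. 1 + d (r n) * x) \<longlonglongrightarrow> 1 + 0 * x"
        using LIMSEQ_subseq_LIMSEQ[OF d0 G(2)] by (intro tendsto_intros) (simp add: o_def)
      thus "(\<lambda>n. 1 + d (r n) * x) \<longlonglongrightarrow> 1" by simp
      show "\<forall>\<^sub>F n in sequentially. 1 + d (r n) * x \<in> {1<..} \<and> 1 + d (r n) * x \<noteq> 1"
        using x d by (intro always_eventually) (auto simp: less_imp_neq[symmetric])
    qed
    from filterlim_compose[OF lim this]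
    show "(\<lambda>n. f (r n) (of_real x)) \<longlonglongrightarrow> L" by (simp add: f_def)
  qed
  have GL: "G w = L" if "w \<in> S" for w
  proof -
    have "(\<lambda>w. G w - L) w = 0"
    proof (rule analytic_continuation[of "\<lambda>w. G w - L" S "of_real ` {0<..}" 1 w])
      show "(1 :: complex) islimpt of_real ` {0<..}"
        unfolding islimpt_approachable
      proof (intro allI impI)
        fix e :: real assume e: "e > 0"
        show "\<exists>x'\<in>complex_of_real ` {0<..}. x' \<noteq> 1 \<and> dist x' 1 < e"
        proof (rule bexI[of _ "of_real (1 + e / 2)"])
          have "complex_of_real (1 + e / 2) - 1 = of_real (e / 2)" by simp
          thus "complex_of_real (1 + e / 2) \<noteq> 1 \<and> dist (complex_of_real (1 + e / 2)) 1 < e"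
            using e unfolding dist_norm by (simp add: norm_divide)
          show "complex_of_real (1 + e / 2) \<in> complex_of_real ` {0<..}" using e by (intro imageI) simp
        qed
      qed
    qed (use that S G(1) Greal in \<open>auto simp: S_def intro!: holomorphic_intros\<close>)
    thus ?thesis by simp
  qed
  define K where "K = cball 0 \<sigma> \<inter> {w :: complex. Re w = 1}"
  have K: "compact K" "K \<subseteq> S"
  proof -
    show "compact K" unfolding K_def
      by (intro compact_Int_closed compact_cball closed_halfspace_Re_eq)
    show "K \<subseteq> S" by (auto simp: K_def S_def)
  qed
  \<comment> \<open>In the rescaled coordinate the points lie on the segment of the line \<open>Re w = 1\<close> cut out by the sector.\<close>
  define w where "w = (\<lambda>n. (Y n - 1) / of_real (d n))"
  have wK: "w n \<in> K" for n
  proof -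
    have "Re (w n) = 1" using d[of n] by (simp add: w_def d_def)
    moreover have "norm (w n) = cmod (Y n - 1) / d n"
      using d[of n] by (simp add: w_def norm_divide)
    hence "norm (w n) = cmod (Y n - 1) / (Re (Y n) - 1)" by (simp only: d_def)
    ultimately show ?thesis using YU(2)[of n] by (simp add: K_def)
  qed
  have fw: "f n (w n) = h (Y n)" for n
    using d[of n] by (simp add: f_def w_def)
  have "\<forall>\<^sub>F n in sequentially. \<forall>x\<in>K. dist ((f \<circ> r) n x) (G x) < e"
    using G(4)[OF K] e(1) by (auto simp: uniform_limit_iff)
  then obtain n where n: "\<forall>x\<in>K. dist ((f \<circ> r) n x) (G x) < e"
    by (auto simp: eventually_sequentially)
  have "dist (h (Y (r n))) L < e"
    using n[rule_format, OF wK[of "r n"]] GL[of "w (r n)"] wK[of "r n"] K(2) by (auto simp: fw)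
  thus False using q(2)[of "r n"] by (simp add: Y_def)
qed

context cusp_group_domain
begin

lemma eisenstein_limit:
  assumes z: "z \<in> \<H>"
  shows "((\<lambda>s. (s - 1) * eisenstein \<Gamma> z s) \<longlongrightarrow> of_real (inverse (measure \<mu> F))) (at 1 within U \<sigma>)"
proof (rule sector_limit[where g = "\<lambda>x. (x - 1) / 2 * real_series z x"])
  have E: "eisenstein \<Gamma> z s = 1 / 2 * complex_series z s" for s
    by (simp add: eisenstein_eq complex_series_def)
  show "(\<lambda>s. (s - 1) * eisenstein \<Gamma> z s) holomorphic_on {s. Re s > 1}"
    unfolding E by (intro holomorphic_intros complex_series_holomorphic z)
  show "norm ((s - 1) * eisenstein \<Gamma> z s) \<le> norm (s - 1) / (Re s - 1) * ((Re s - 1) / 2 * real_series z (Re s))"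
    if s: "Re s > 1" for s
  proof -
    have "norm ((s - 1) * eisenstein \<Gamma> z s) = norm (s - 1) / 2 * norm (complex_series z s)"
      by (simp add: E norm_mult)
    also have "\<dots> \<le> norm (s - 1) / 2 * real_series z (Re s)"
      by (intro mult_left_mono norm_complex_series_le z s) auto
    also have "\<dots> = norm (s - 1) / (Re s - 1) * ((Re s - 1) / 2 * real_series z (Re s))"
      using s by simp
    finally show ?thesis .
  qed
  show "\<exists>B. \<forall>x. 1 < x \<longrightarrow> x \<le> b \<longrightarrow> (x - 1) / 2 * real_series z x \<le> B" for b
    by (rule scaled_series_bounded[OF z])
  have "((\<lambda>x. complex_of_real ((x - 1) / 2 * real_series z x)) \<longlongrightarrow> of_real (inverse (measure \<mu> F))) (at_right 1)"
    using power_sum_tendsto[OF z] unfolding real_series_def by (rule tendsto_of_real)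
  moreover have "eventually (\<lambda>x. complex_of_real ((x - 1) / 2 * real_series z x) = (of_real x - 1) * eisenstein \<Gamma> z (of_real x)) (at_right 1)"
    using eventually_at_right_1
    by eventually_elim (simp add: E complex_series_of_real z)
  ultimately show "((\<lambda>x. (of_real x - 1) * eisenstein \<Gamma> z (of_real x)) \<longlongrightarrow> of_real (inverse (measure \<mu> F))) (at_right 1)"
    by (rule Lim_transform_eventually)
qed

lemma eisenstein_summable:
  assumes "z \<in> \<H>" "Re s > 1"
  shows "eisenstein_term z s summable_on cosets"
  unfolding summable_eisenstein_iff
  using complex_series_has_sum[OF assms] by (rule has_sum_imp_summable)

end

theorem theorem16p4:
  fixes \<Gamma>\<^sub>0 :: "mat2 set"
  assumes "is_lattice \<Gamma>\<^sub>0"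
    and "- mat 1 \<in> \<Gamma>\<^sub>0"
    and "maximal_unipotent_subgroup \<Lambda>\<^sub>0 \<Gamma>\<^sub>0"
  shows "(\<forall>z\<in>\<H>. \<forall>s. Re s > 1 \<longrightarrow>
            eisenstein_term z s summable_on (lcosets\<^bsub>SL2R\<lparr>carrier := \<Gamma>\<^sub>0\<rparr>\<^esub> \<Lambda>\<^sub>0)) \<and>
         (\<forall>\<sigma>>0. \<forall>z\<in>\<H>.
            ((\<lambda>s. (s - 1) * eisenstein \<Gamma>\<^sub>0 z s) \<longlongrightarrow>
               of_real (inverse (quotient_volume \<Gamma>\<^sub>0))) (at 1 within U \<sigma>))"
proof -
  interpret cusp_group \<Gamma>\<^sub>0
    using assms by (intro cusp_group.intro)
      (simp_all add: is_lattice_def maximal_unipotent_subgroup_def unipotent_subgroup_def)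
  interpret cusp_group_domain \<Gamma>\<^sub>0 "SOME F. fundamental_set \<Gamma>\<^sub>0 F"
    by unfold_locales (rule someI_ex[OF fundamental_set_exists])
  show ?thesis
    using eisenstein_summable eisenstein_limit
    by (simp add: cosets_def quotient_volume_def)
qed

end
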